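(* Let $\hat\beta^{(\varepsilon)}=\{\hat\beta^{(\varepsilon)}_k\}$ be the block general empirical Bayes (GEB) estimator defined in the context, based on independent $y_k\sim N(\beta_k,\varepsilon^2)$, $k\le N\le\infty$, with blocks $[j]$ of sizes $n_j$. Then there exists a universal constant $M<\infty$ such that, for all $\varepsilon>0$, all deterministic sequences $\beta$ and all $p>0$, $$R^{(\varepsilon)}(\hat\beta^{(\varepsilon)},\beta)-R^{(\varepsilon,* )}(\beta)\le M\varepsilon^2\sum_j\left\{n_j\,r_{p\wedge2}\!\left(n_j,\frac{\big(\sum_{k\in[j]}|\beta_k|^p\big)^{1/p}}{\varepsilon n_j^{1/p}}\right)+\frac{1}{(\log n_j+1)^{3/2}}\right\},$$ where $$r_p(n,C)\equiv\min\left(1,\frac{C^p}{(\log n)^{p/2-1}},\max\left[\frac{(\log n)^2}{\sqrt n},\left\{\frac{C(\log n)^{3/2}}{\sqrt n}\right\}^{p/(p+1)}\right]\right).$$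
   Context: Model: $y_k$, $k\le N\le\infty$, are independent, $y_k\sim N(\beta_k,\varepsilon^2)$ with $\varepsilon>0$ known; $E^{(\varepsilon)}_\beta$ is the corresponding expectation. The index set is partitioned into consecutive finite blocks $[j]=(k_{j-1},k_j]$ of sizes $n_j=k_j-k_{j-1}$. Risk: $R^{(\varepsilon)}(\hat\beta,\beta)\equiv\sum_{k=1}^N E^{(\varepsilon)}_\beta(\hat\beta_k-\beta_k)^2$. Ideal risk: $R^{(\varepsilon,* )}(\beta)\equiv\inf R^{(\varepsilon)}(\hat\beta,\beta)$, the infimum being over all separable estimators $\hat\beta_k=h_j(y_k)$ for $k\in[j]$ with arbitrary Borel functions $h_j$ (allowed to depend on $\beta$). If $R^{(\varepsilon,* )}(\beta)=\infty$, an upper bound for $R^{(\varepsilon)}-R^{(\varepsilon,* )}$ is read as $R^{(\varepsilon)}\le R^{(\varepsilon,* )}+\cdots$. Block GEB estimator: fix tuning constants $n_*>2$, $\rho_0>0$, $b_0>0$ and a sequence $\eta_n\to0$, and set $\rho(n)=(1+\eta_n)\rho_0\sqrt{2(\log n)/n}>0$, $b(n)=b_0(\log n)/\sqrt n$. Let $X_k\equiv y_k/\varepsilon$. In blocks with $n_j\ge n_*$, $\hat\beta^{(\varepsilon)}_k\equiv\varepsilon\,\hat t_{[j]}(y_k/\varepsilon)$, $k\in[j]$, where $$\hat t_{[j]}(x)\equiv\begin{cases}x+\hat\varphi_{[j]}'(x)/\max\{\rho(n_j),\hat\varphi_{[j]}(x)\},&\hat\kappa_{[j]}>b(n_j),\\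 \operatorname{sgn}(x)(|x|-\sqrt{2\log n_j})^+,&\hat\kappa_{[j]}\le b(n_j),\end{cases}$$ $$\hat\varphi_{[j]}(x)\equiv\frac1{n_j}\sum_{k\in[j]}\sqrt{2\log n_j}\,K\big(\sqrt{2\log n_j}(x-X_k)\big),\quad K(x)\equiv\frac{\sin x}{\pi x},\qquad \hat\kappa_{[j]}\equiv1-\frac{\sqrt2}{n_j}\sum_{k\in[j]}e^{-X_k^2/2}.$$ In blocks with $n_j<n_*$ one uses either $\hat\beta_k^{(\varepsilon)}=y_k$ or the James–Stein estimator of the vector $(\beta_k,k\in[j])$. "Universal constant" means a constant that may depend on the tuning constants $(n_*,\rho_0,b_0,\{\eta_n\})$ but on nothing else (not on $\varepsilon,\beta,p,N$ or the blocks). *)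

theory Defs
  imports "HOL-Probability.Probability"
begin

section \<open>Gaussian sequence model and blocks\<close>

definition index_set :: "enat \<Rightarrow> nat set" where
  "index_set N = {i. 1 \<le> i \<and> enat i \<le> N}"

text \<open>
  The joint law of the observations \<open>y\<^sub>i\<close>, \<open>i \<le> N\<close>, realised on the sequence space.
  The second argument of \<^const>\<open>normal_density\<close> is the standard deviation.
\<close>

definition gauss_seq :: "enat \<Rightarrow> real \<Rightarrow> (nat \<Rightarrow> real) \<Rightarrow> (nat \<Rightarrow> real) measure" where
  "gauss_seq N \<epsilon> \<beta> = Pi\<^sub>M (index_set N) (\<lambda>i. density lborel (normal_density (\<beta> i) \<epsilon>))"

definition block :: "(nat \<Rightarrow> nat) \<Rightarrow> nat \<Rightarrow> nat set" where
  "block k j = {k (j - 1)<..k j}"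

text \<open>The blocks are numbered \<open>1, 2, \<dots>\<close> up to their (possibly infinite) number \<open>J\<close>.\<close>

definition blocks :: "enat \<Rightarrow> nat set" where
  "blocks J = {j. 1 \<le> j \<and> enat j \<le> J}"

text \<open>Strict monotonicity says that all blocks are nonempty; it also makes them disjoint.\<close>

definition block_partition :: "enat \<Rightarrow> enat \<Rightarrow> (nat \<Rightarrow> nat) \<Rightarrow> bool" where
  "block_partition N J k \<longleftrightarrow>
     k 0 = 0 \<and> (\<forall>j\<in>blocks J. k (j - 1) < k j) \<and> (\<Union>j\<in>blocks J. block k j) = index_set N"

definition block_index :: "(nat \<Rightarrow> nat) \<Rightarrow> nat \<Rightarrow> nat" where
  "block_index k i = (LEAST j. i \<le> k j)"

lemma block_index_eq:
  assumes "block_partition N J k" and "j \<in> blocks J" and "i \<in> block k j"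
  shows "block_index k i = j"
  unfolding block_index_def
proof (rule Least_equality)
  show "i \<le> k j" using assms(3) by (simp add: block_def)
  have mono: "k a \<le> k b" if "a \<le> b" "enat b \<le> J" for a b
    using that
  proof (induction b rule: dec_induct)
    case (step b)
    have "enat b \<le> J" using step.prems by (meson Suc_ile_eq order_less_imp_le)
    moreover have "k b < k (Suc b)"
      using assms(1) step.prems unfolding block_partition_def blocks_def by force
    ultimately show ?case using step.IH by simp
  qed simp
  show "j \<le> j'" if "i \<le> k j'" for j'
  proof (rule ccontr)
    assume "\<not> j \<le> j'"
    then have "j' \<le> j - 1" and le: "j - 1 \<le> j" by auto
    moreover have "enat (j - 1) \<le> J"
      using assms(2) le unfolding blocks_def by (metis enat_ord_simps(1) mem_Collect_eq order_trans)
    ultimately have "k j' \<le> k (j - 1)" using mono by blast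
    then show False using that assms(3) by (simp add: block_def)
  qed
qed

section \<open>Risk and ideal risk\<close>

text \<open>Both take values in \<open>[0, \<infinity>]\<close>. An estimator maps the observed sequence to a sequence.\<close>

definition risk ::
  "enat \<Rightarrow> real \<Rightarrow> ((nat \<Rightarrow> real) \<Rightarrow> nat \<Rightarrow> real) \<Rightarrow> (nat \<Rightarrow> real) \<Rightarrow> ennreal" where
  "risk N \<epsilon> \<beta>hat \<beta> =
     (\<Sum>\<^sub>\<infinity>i\<in>index_set N. \<integral>\<^sup>+ y. ennreal ((\<beta>hat y i - \<beta> i)\<^sup>2) \<partial>gauss_seq N \<epsilon> \<beta>)"

definition separable_estimator ::
  "(nat \<Rightarrow> nat) \<Rightarrow> (nat \<Rightarrow> real \<Rightarrow> real) \<Rightarrow> (nat \<Rightarrow> real) \<Rightarrow> nat \<Rightarrow> real" where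
  "separable_estimator k h y i = h (block_index k i) (y i)"

definition ideal_risk :: "enat \<Rightarrow> (nat \<Rightarrow> nat) \<Rightarrow> real \<Rightarrow> (nat \<Rightarrow> real) \<Rightarrow> ennreal" where
  "ideal_risk N k \<epsilon> \<beta> =
     (INF h\<in>{h. \<forall>j. h j \<in> borel_measurable borel}. risk N \<epsilon> (separable_estimator k h) \<beta>)"

section \<open>The block general empirical Bayes estimator\<close>

definition geb_rho :: "real \<Rightarrow> (nat \<Rightarrow> real) \<Rightarrow> nat \<Rightarrow> real" where
  "geb_rho \<rho>0 \<eta> n = (1 + \<eta> n) * \<rho>0 * sqrt (2 * ln (real n) / real n)"

definition geb_b :: "real \<Rightarrow> nat \<Rightarrow> real" where
  "geb_b b0 n = b0 * ln (real n) / sqrt (real n)"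

text \<open>\<open>sin x / (\<pi> x)\<close> with the value \<open>1 / \<pi>\<close> at \<open>0\<close>, since \<^term>\<open>sinc\<close> is continuously extended.\<close>

definition geb_kernel :: "real \<Rightarrow> real" where
  "geb_kernel x = sinc x / pi"

definition geb_phi :: "nat set \<Rightarrow> (nat \<Rightarrow> real) \<Rightarrow> real \<Rightarrow> real" where
  "geb_phi B X x =
     (1 / real (card B)) * (\<Sum>i\<in>B. sqrt (2 * ln (real (card B))) *
        geb_kernel (sqrt (2 * ln (real (card B))) * (x - X i)))"

definition geb_kappa :: "nat set \<Rightarrow> (nat \<Rightarrow> real) \<Rightarrow> real" where
  "geb_kappa B X = 1 - sqrt 2 / real (card B) * (\<Sum>i\<in>B. exp (- (X i)\<^sup>2 / 2))"

definition geb_t ::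
  "real \<Rightarrow> real \<Rightarrow> (nat \<Rightarrow> real) \<Rightarrow> nat set \<Rightarrow> (nat \<Rightarrow> real) \<Rightarrow> real \<Rightarrow> real" where
  "geb_t \<rho>0 b0 \<eta> B X x =
     (if geb_kappa B X > geb_b b0 (card B)
      then x + deriv (geb_phi B X) x / max (geb_rho \<rho>0 \<eta> (card B)) (geb_phi B X x)
      else sgn x * max 0 (\<bar>x\<bar> - sqrt (2 * ln (real (card B)))))"

text \<open>
  The factor \<open>n - 2\<close> is truncated at \<open>0\<close>: James-Stein shrinkage is meant for dimension at
  least \<open>3\<close>, and in dimensions \<open>1\<close> and \<open>2\<close> the estimator is the observation itself. (Without the
  truncation the risk in dimension \<open>1\<close> would be infinite.)
\<close>

definition james_stein :: "real \<Rightarrow> nat set \<Rightarrow> (nat \<Rightarrow> real) \<Rightarrow> nat \<Rightarrow> real" where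
  "james_stein \<epsilon> B y i = (1 - real (card B - 2) * \<epsilon>\<^sup>2 / (\<Sum>l\<in>B. (y l)\<^sup>2)) * y i"

text \<open>
  The flag \<open>js j\<close> records whether James-Stein or the observation itself is used in block \<open>j\<close>
  when that block is small.
\<close>

definition block_geb ::
  "real \<Rightarrow> real \<Rightarrow> real \<Rightarrow> (nat \<Rightarrow> real) \<Rightarrow> (nat \<Rightarrow> bool) \<Rightarrow> (nat \<Rightarrow> nat) \<Rightarrow> real \<Rightarrow>
   (nat \<Rightarrow> real) \<Rightarrow> nat \<Rightarrow> real" where
  "block_geb nstar \<rho>0 b0 \<eta> js k \<epsilon> y i =
     (let j = block_index k i; B = block k j in
      if real (card B) \<ge> nstar then \<epsilon> * geb_t \<rho>0 b0 \<eta> B (\<lambda>l. y l / \<epsilon>) (y i / \<epsilon>)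
      else if js j then james_stein \<epsilon> B y i
      else y i)"

section \<open>The rate function\<close>

text \<open>
  At \<open>n = 1\<close> the third entry of the minimum vanishes, so \<open>rate p 1 C = 0\<close> whatever the
  convention for the second.
\<close>

definition rate :: "real \<Rightarrow> nat \<Rightarrow> real \<Rightarrow> real" where
  "rate p n C =
     min 1 (min (C powr p / ln (real n) powr (p / 2 - 1))
       (max ((ln (real n))\<^sup>2 / sqrt (real n))
            ((C * ln (real n) powr (3 / 2) / sqrt (real n)) powr (p / (p + 1)))))"

end

theory Submission
  imports Defs
begin

text \<open>
  Rescale a block of \<open>n\<close> observations to unit variance and let \<open>f\<close> be the average of their densities. For every separable
  rule \<open>h\<close> the average risk exceeds that of \<open>x + f' x / f x\<close> by exactly \<open>\<integral> f (h - x - f' / f)\<^sup>2\<close>. The sinc kernel with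
  bandwidth \<open>1 / sqrt (2 ln n)\<close> estimates \<open>f\<close> and \<open>f'\<close> with bias at most \<open>1 / n\<close>, since the characteristic function of a
  Gaussian mixture is negligible beyond the frequency \<open>sqrt (2 ln n)\<close>. The variance of the estimate of \<open>f'\<close> integrates to
  \<open>O((ln n) powr (3 / 2) / n)\<close>, and division by the floor \<open>\<rho>\<close>, which is of order \<open>sqrt (ln n / n)\<close>, leaves an excess
  \<open>O(ln n / sqrt n)\<close> besides the truncation term \<open>\<integral> (f' / f)\<^sup>2 f\<close> over \<open>{f < \<rho>}\<close>. The latter is at most
  \<open>O(L \<rho> ln n)\<close> inside a window \<open>\<bar>x\<bar> \<le> L\<close> and at most the proportion of large means outside of it; optimizing \<open>L\<close> produces
  the exponent \<open>p / (p + 1)\<close> of the rate. When the means are sparse, soft thresholding costs at most a multiple of the sum of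
  \<open>min (\<theta>\<^sup>2) (ln n)\<close>, and by Hoeffding's inequality the test picks the wrong rule only with probability \<open>O(n powr -8)\<close>.
\<close>

section \<open>The sinc kernel\<close>

text \<open>The regret \<open>ln n / sqrt n\<close> by itself can exceed the second entry of the
  rate when the means are very sparse. The test repairs this: its threshold \<open>b\<close> is
  itself of order \<open>a\<^sup>2 / sqrt n\<close>, so where the empirical Bayes branch is likely,
  that quantity is at most a multiple of \<open>energy\<close>, the average of
  \<open>min (\<theta>\<^sup>2) (ln n)\<close>, and \<open>energy\<close> is at most the second
  entry. Near or below the threshold \<open>energy\<close> is of order
  \<open>(ln n)\<^sup>2 / sqrt n\<close> at most, and soft thresholding suffices. The additive term
  with exponent 3/2 comes from soft thresholding at \<open>sqrt (2 ln n)\<close> when all means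
  vanish. A second obstacle is that the score is estimated from the very observation that it
  corrects. That observation is exchanged for an independent copy at the relative cost
  \<open>(1 + \<delta>) ^ 3\<close> with \<delta> of order \<open>1 / sqrt n\<close>. This factor
  has to tend to 1, since it multiplies the ideal risk, which can be of order n.\<close>

definition dsinc :: "real \<Rightarrow> real" where
  "dsinc v = (if v = 0 then 0 else (v * cos v - sin v) / v\<^sup>2)"

lemma DERIV_sinc: "(sinc has_real_derivative dsinc x) (at x)"
proof (cases "x = 0")
  case False
  have "((\<lambda>x. sin x / x) has_real_derivative dsinc x) (at x)"
    using False by (auto intro!: derivative_eq_intros simp: dsinc_def power2_eq_square divide_simps)
  moreover have "\<forall>\<^sub>F y in nhds x. sin y / y = sinc y"
    using False t1_space_nhds[of x 0] by (auto elim!: eventually_mono)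
  ultimately show ?thesis
    using DERIV_cong_ev[of x x "\<lambda>x. sin x / x" "\<lambda>x. sinc x" "dsinc x" "dsinc x"] by blast
next
  case True
  \<comment> \<open>At the origin the quotient rule says nothing; the third-order Taylor bound for
    \<open>sin\<close> makes the difference quotient of \<open>sinc\<close> tend to 0 there.\<close>
  have bound: "\<bar>sinc h - 1\<bar> \<le> h\<^sup>2" for h :: real
  proof (cases "h = 0")
    case False
    have "\<bar>sin h - h\<bar> \<le> inverse (fact 3) * \<bar>h\<bar> ^ 3"
      using Maclaurin_sin_bound[of h 3] by (simp add: numeral_3_eq_3 sin_coeff_def)
    also have "\<dots> \<le> \<bar>h\<bar> ^ 3"
      by (simp add: fact_numeral mult_left_le_one_le)
    finally have "\<bar>sin h - h\<bar> / \<bar>h\<bar> \<le> \<bar>h\<bar> ^ 3 / \<bar>h\<bar>"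
      by (rule divide_right_mono) simp
    moreover have "\<bar>sinc h - 1\<bar> = \<bar>sin h - h\<bar> / \<bar>h\<bar>"
      using False by (simp add: diff_divide_distrib flip: abs_divide)
    ultimately show ?thesis
      using False by (simp add: power3_eq_cube power2_eq_square flip: abs_mult)
  qed simp
  have "(\<lambda>h. (sinc (0 + h) - sinc 0) / h) \<midarrow>0\<rightarrow> 0"
  proof (rule Lim_null_comparison)
    show "\<forall>\<^sub>F h in at 0. norm ((sinc (0 + h) - sinc 0) / h) \<le> \<bar>h::real\<bar>"
      unfolding eventually_at_filter
    proof (intro always_eventually allI impI)
      fix h :: real assume "h \<noteq> 0"
      then show "norm ((sinc (0 + h) - sinc 0) / h) \<le> \<bar>h\<bar>"
        using divide_right_mono[OF bound[of h], of "\<bar>h\<bar>"]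
        by (cases "h > 0") (auto simp: abs_divide power2_eq_square)
    qed
    show "((\<lambda>h. \<bar>h::real\<bar>) \<longlongrightarrow> 0) (at 0)"
      by (simp add: tendsto_rabs_zero)
  qed
  then show ?thesis
    using True by (simp add: DERIV_def dsinc_def)
qed

text \<open>The numerator \<open>v * cos v - sin v\<close> has derivative
  \<open>- (v * sin v)\<close>, hence is at most \<open>v\<^sup>2\<close> in absolute value; far out
  it is at most \<open>2 * \<bar>v\<bar>\<close>. The resulting bounds 1 and
  \<open>4 / v\<^sup>2\<close> both fit under \<open>5 / (1 + v\<^sup>2)\<close>, with the switch at
  \<open>v\<^sup>2 = 4\<close>.\<close>

lemma dsinc_bound: "(dsinc v)\<^sup>2 \<le> 5 / (1 + v\<^sup>2)" "\<bar>dsinc v\<bar> \<le> 1"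
proof -
  have num: "\<bar>v * cos v - sin v\<bar> \<le> v\<^sup>2" if "v \<ge> 0" for v :: real
  proof -
    have d: "((\<lambda>v. v * cos v - sin v) has_real_derivative - (t * sin t)) (at t)" for t :: real
      by (auto intro!: derivative_eq_intros)
    have "\<exists>z>0. z < v \<and> (v * cos v - sin v) - (0 * cos 0 - sin 0) = (v - 0) * (- (z * sin z))" if "v > 0"
      using MVT2[of 0 v "\<lambda>v. v * cos v - sin v" "\<lambda>t. - (t * sin t)"] that d by auto
    moreover have "\<bar>v * (z * sin z)\<bar> \<le> v\<^sup>2" if "0 < z" "z < v" for z
    proof -
      have "\<bar>z * sin z\<bar> \<le> v * 1"
        unfolding abs_mult using that by (intro mult_mono) auto
      then show ?thesis
        using that by (simp add: abs_mult power2_eq_square mult_left_mono)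
    qed
    ultimately show ?thesis
      using that by (cases "v = 0") force+
  qed
  have num': "\<bar>v * cos v - sin v\<bar> \<le> v\<^sup>2" for v :: real
    using num[of v] num[of "-v"] by (cases "v \<ge> 0") auto
  show 1: "\<bar>dsinc v\<bar> \<le> 1" for v
    using num'[of v] by (auto simp: dsinc_def divide_simps)
  have 2: "(dsinc v)\<^sup>2 \<le> 4 / v\<^sup>2" if "\<bar>v\<bar> > 1" for v
  proof -
    have "\<bar>v * cos v - sin v\<bar> \<le> \<bar>v\<bar> * 1 + 1"
      by (rule order_trans[OF abs_triangle_ineq4]) (intro add_mono, auto simp: abs_mult mult_left_le)
    also have "\<dots> \<le> 2 * \<bar>v\<bar>" using that by simp
    finally have "\<bar>v * cos v - sin v\<bar> / v\<^sup>2 \<le> 2 * \<bar>v\<bar> / v\<^sup>2"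
      by (rule divide_right_mono) simp
    also have "\<dots> = 2 / \<bar>v\<bar>"
      using that by (simp add: power2_eq_square divide_simps)
    finally have "\<bar>dsinc v\<bar> \<le> 2 / \<bar>v\<bar>"
      using that by (auto simp: dsinc_def)
    from power_mono[OF this, of 2] show ?thesis
      by (simp add: power_divide)
  qed
  show "(dsinc v)\<^sup>2 \<le> 5 / (1 + v\<^sup>2)"
  proof (cases "v\<^sup>2 \<le> 4")
    case True
    have "(dsinc v)\<^sup>2 \<le> 1"
      using 1[of v] by (simp add: abs_square_le_1)
    also have "1 \<le> 5 / (1 + v\<^sup>2)"
      using True by (simp add: add_pos_nonneg)
    finally show ?thesis .
  next
    case False
    then have "\<bar>v\<bar> > 1"
      by (metis abs_le_square_iff abs_one one_power2 not_le order_trans one_le_numeral)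
    from 2[OF this] have "(dsinc v)\<^sup>2 \<le> 4 / v\<^sup>2" .
    also have "\<dots> \<le> 5 / (1 + v\<^sup>2)"
      using False by (simp add: divide_simps add_pos_nonneg)
    finally show ?thesis .
  qed
qed

lemma dsinc_borel [measurable]: "dsinc \<in> borel_measurable borel"
  unfolding dsinc_def[abs_def] by measurable

lemma sinc_bound: "(sinc v)\<^sup>2 \<le> 2 / (1 + v\<^sup>2)" "\<bar>sinc v\<bar> \<le> 1" for v :: real
proof -
  have ab: "\<bar>sin v\<bar> \<le> \<bar>v\<bar>" by (rule abs_sin_x_le_abs_x)
  show 1: "\<bar>sinc v\<bar> \<le> 1"
    using ab by (auto simp: abs_divide divide_simps)
  show "(sinc v)\<^sup>2 \<le> 2 / (1 + v\<^sup>2)"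
  proof (cases "v\<^sup>2 \<le> 1")
    case True
    have "(sinc v)\<^sup>2 \<le> 1"
      using 1 by (simp add: abs_square_le_1)
    also have "1 \<le> 2 / (1 + v\<^sup>2)"
      using True by (simp add: add_pos_nonneg)
    finally show ?thesis .
  next
    case False
    then have "(sinc v)\<^sup>2 \<le> 1 / v\<^sup>2"
      by (auto simp: power_divide divide_simps abs_square_le_1)
    also have "\<dots> \<le> 2 / (1 + v\<^sup>2)"
      using False by (simp add: divide_simps add_pos_nonneg)
    finally show ?thesis .
  qed
qed

definition kern :: "real \<Rightarrow> real \<Rightarrow> real" where
  "kern a u = a * geb_kernel (a * u)"

definition kern' :: "real \<Rightarrow> real \<Rightarrow> real" where
  "kern' a u = a\<^sup>2 / pi * dsinc (a * u)"

lemma kern_borel [measurable]: "kern a \<in> borel_measurable borel" "kern' a \<in> borel_measurable borel"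
proof -
  have "(\<lambda>u. sinc (a * u)) \<in> borel_measurable borel"
    by (rule measurable_compose[OF _ borel_measurable_sinc]) measurable
  then show "kern a \<in> borel_measurable borel"
    unfolding kern_def[abs_def] geb_kernel_def by (intro borel_measurable_times borel_measurable_divide) auto
  show "kern' a \<in> borel_measurable borel"
    unfolding kern'_def[abs_def] by measurable
qed

lemma DERIV_kern [derivative_intros]:
  assumes "(g has_real_derivative g') (at x)"
  shows "((\<lambda>x. kern a (g x)) has_real_derivative (kern' a (g x) * g')) (at x)"
proof -
  have "((\<lambda>x. sinc (a * g x)) has_real_derivative dsinc (a * g x) * (a * g')) (at x)"
    by (rule DERIV_chain2[OF DERIV_sinc]) (auto intro!: derivative_eq_intros assms)
  then show ?thesis
    unfolding kern_def kern'_def geb_kernel_def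
    by (auto intro!: derivative_eq_intros simp: power2_eq_square)
qed

lemma pi_ge_3: "pi \<ge> 3"
  using sin_x_le_x[of "pi / 6"] by (simp add: sin_30)

text \<open>Envelope shared by the squares of both kernels. A supremum bound would not do: the
  moments of the deviations are integrated over the whole line, and \<open>wgt\<close> keeps their
  decay, with total mass \<open>pi / a\<close>.\<close>

definition wgt :: "real \<Rightarrow> real \<Rightarrow> real" where
  "wgt a u = 1 / (1 + (a * u)\<^sup>2)"

lemma wgt_pos: "0 < wgt a u" "wgt a u \<le> 1"
  by (auto simp: wgt_def add_pos_nonneg)

lemma wgt_borel [measurable]: "wgt a \<in> borel_measurable borel"
  unfolding wgt_def[abs_def] by measurable

lemma kern_bounds:
  assumes "a \<ge> 0"
  shows "\<bar>kern a u\<bar> \<le> a" "\<bar>kern' a u\<bar> \<le> a\<^sup>2"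
    "(kern a u)\<^sup>2 \<le> a\<^sup>2 * wgt a u" "(kern' a u)\<^sup>2 \<le> a^4 * wgt a u"
proof -
  have cancel: "(c / d) / c = 1 / d" if "c \<noteq> 0" for c d :: real
    using that by simp
  have pi1: "pi \<ge> 1" using pi_ge_3 by simp
  have "\<bar>kern a u\<bar> = a * (\<bar>sinc (a * u)\<bar> / pi)"
    using assms by (simp add: kern_def geb_kernel_def abs_mult)
  also have "\<dots> \<le> a * (1 / 1)"
    using sinc_bound(2)[of "a * u"] pi1 assms by (intro mult_left_mono frac_le) auto
  finally show "\<bar>kern a u\<bar> \<le> a" by simp
  have "\<bar>dsinc (a * u)\<bar> / pi \<le> 1"
    using dsinc_bound(2)[of "a * u"] pi1 by (simp add: divide_simps)
  then have "a\<^sup>2 * (\<bar>dsinc (a * u)\<bar> / pi) \<le> a\<^sup>2"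
    by (intro mult_left_le) auto
  then show "\<bar>kern' a u\<bar> \<le> a\<^sup>2"
    unfolding kern'_def abs_mult abs_divide by simp
  \<comment> \<open>Large enough to absorb the numerators 2 and 5 of \<open>sinc_bound\<close> and
    \<open>dsinc_bound\<close>.\<close>
  have pi9: "pi\<^sup>2 \<ge> 5"
    using power_mono[of 3 pi 2] pi_ge_3 by simp
  have "(sinc (a * u))\<^sup>2 / pi\<^sup>2 \<le> (2 / (1 + (a * u)\<^sup>2)) / 2"
    using pi9 by (intro frac_le sinc_bound) (auto intro!: divide_nonneg_nonneg add_nonneg_nonneg)
  also have "(2 / (1 + (a * u)\<^sup>2)) / 2 = wgt a u"
    unfolding wgt_def by (rule cancel) simp
  finally have "a\<^sup>2 * ((sinc (a * u))\<^sup>2 / pi\<^sup>2) \<le> a\<^sup>2 * wgt a u"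
    by (rule mult_left_mono) simp
  moreover have "(kern a u)\<^sup>2 = a\<^sup>2 * ((sinc (a * u))\<^sup>2 / pi\<^sup>2)"
    unfolding kern_def geb_kernel_def power_mult_distrib power_divide ..
  ultimately show "(kern a u)\<^sup>2 \<le> a\<^sup>2 * wgt a u" by (simp only:)
  have "(dsinc (a * u))\<^sup>2 / pi\<^sup>2 \<le> (5 / (1 + (a * u)\<^sup>2)) / 5"
    using pi9 by (intro frac_le dsinc_bound) (auto intro!: divide_nonneg_nonneg add_nonneg_nonneg)
  also have "(5 / (1 + (a * u)\<^sup>2)) / 5 = wgt a u"
    unfolding wgt_def by (rule cancel) simp
  finally have "a ^ 4 * ((dsinc (a * u))\<^sup>2 / pi\<^sup>2) \<le> a ^ 4 * wgt a u"
    by (rule mult_left_mono) simp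
  then show "(kern' a u)\<^sup>2 \<le> a^4 * wgt a u"
    unfolding kern'_def by (simp add: power_mult_distrib power_divide flip: power_mult)
qed

lemma nn_integral_lborel_uminus:
  fixes h :: "real \<Rightarrow> ennreal"
  assumes "h \<in> borel_measurable borel"
  shows "(\<integral>\<^sup>+x. h (- x) \<partial>lborel) = (\<integral>\<^sup>+x. h x \<partial>lborel)"
  using nn_integral_real_affine[OF assms, of "-1" 0] by simp

lemma nn_integral_wgt:
  assumes "a > 0"
  shows "(\<integral>\<^sup>+x. ennreal (wgt a (x - y)) \<partial>lborel) = ennreal (pi / a)"
proof -
  have half: "(\<integral>\<^sup>+x. ennreal (wgt 1 x) * indicator {0..} x \<partial>lborel) = ennreal (pi / 2)"
  proof -
    have "(\<integral>\<^sup>+x. ennreal (wgt 1 x) * indicator {0..} x \<partial>lborel) = ennreal (pi / 2 - arctan 0)"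
      by (rule nn_integral_FTC_atLeast[where F = arctan])
         (auto simp: wgt_def tendsto_arctan_at_top intro!: derivative_eq_intros simp: field_simps)
    then show ?thesis by simp
  qed
  have "(\<integral>\<^sup>+x. ennreal (wgt 1 x) \<partial>lborel) =
      (\<integral>\<^sup>+x. ennreal (wgt 1 x) * indicator {0..} x + ennreal (wgt 1 (-x)) * indicator {0..} (-x) \<partial>lborel)"
  proof (rule nn_integral_cong_AE)
    show "AE x in lborel. ennreal (wgt 1 x) =
        ennreal (wgt 1 x) * indicator {0..} x + ennreal (wgt 1 (-x)) * indicator {0..} (-x)"
      using AE_lborel_singleton[of 0]
      by eventually_elim (auto simp: wgt_def split: split_indicator)
  qed
  also have "\<dots> = ennreal (pi / 2) + (\<integral>\<^sup>+x. ennreal (wgt 1 (-x)) * indicator {0..} (-x) \<partial>lborel)"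
    by (subst nn_integral_add) (auto simp: half)
  also have "(\<integral>\<^sup>+x. ennreal (wgt 1 (-x)) * indicator {0..} (-x) \<partial>lborel) =
      (\<integral>\<^sup>+x. ennreal (wgt 1 x) * indicator {0..} x \<partial>lborel)"
    using nn_integral_lborel_uminus[of "\<lambda>x. ennreal (wgt 1 x) * indicator {0..} x"] by simp
  finally have full: "(\<integral>\<^sup>+x. ennreal (wgt 1 x) \<partial>lborel) = ennreal pi"
    by (simp add: half flip: ennreal_plus)
  have "ennreal (1 / a) * (\<integral>\<^sup>+x. ennreal (wgt 1 x) \<partial>lborel) =
      ennreal (1 / a) * (ennreal \<bar>a\<bar> * (\<integral>\<^sup>+x. ennreal (wgt 1 (- a * y + a * x)) \<partial>lborel))"
    using nn_integral_real_affine[of "\<lambda>x. ennreal (wgt 1 x)" a "- a * y"] assms by simp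
  also have "\<dots> = (\<integral>\<^sup>+x. ennreal (wgt 1 (- a * y + a * x)) \<partial>lborel)"
    using assms by (simp flip: mult.assoc ennreal_mult)
  also have "\<dots> = (\<integral>\<^sup>+x. ennreal (wgt a (x - y)) \<partial>lborel)"
    by (simp add: wgt_def algebra_simps)
  finally show ?thesis
    using assms by (simp add: full flip: ennreal_mult)
qed

section \<open>Fourier bounds for the bias\<close>

abbreviation gd :: "real \<Rightarrow> real" where "gd \<equiv> normal_density 0 1"

lemma gd_eq: "gd x = exp (- x\<^sup>2 / 2) / sqrt (2 * pi)"
  by (simp add: std_normal_density_def)

text \<open>Real and imaginary part of the normal characteristic function: convolution with the
  standard Gaussian multiplies an oscillation of frequency t by
  \<open>exp (- t\<^sup>2 / 2)\<close>.\<close>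

lemma gd_trig:
  "(\<integral>z. gd z * cos (t * (u - z)) \<partial>lborel) = exp (- t\<^sup>2 / 2) * cos (t * u)"
  "(\<integral>z. gd z * sin (t * (u - z)) \<partial>lborel) = exp (- t\<^sup>2 / 2) * sin (t * u)"
proof -
  interpret D: real_distribution std_normal_distribution
    by (rule real_dist_normal_dist)
  have ch: "(CLINT x|std_normal_distribution. iexp (t * x)) = complex_of_real (exp (- t\<^sup>2 / 2))"
    using fun_cong[OF char_std_normal_distribution, of t] by (simp add: char_def)
  have i: "integrable std_normal_distribution (\<lambda>x. iexp (t * x))"
    by (rule D.integrable_iexp) auto
  have c: "(\<integral>z. gd z * cos (t * z) \<partial>lborel) = exp (- t\<^sup>2 / 2)"
    using arg_cong[OF ch, of Re] integral_Re[OF i] by (simp add: integral_density Re_exp Im_exp)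
  have s: "(\<integral>z. gd z * sin (t * z) \<partial>lborel) = 0"
    using arg_cong[OF ch, of Im] integral_Im[OF i] by (simp add: integral_density Re_exp Im_exp)
  have ic: "integrable lborel (\<lambda>z. gd z * cos (t * z))"
    by (rule Bochner_Integration.integrable_bound[OF integrable_normal_density[of 1 0]])
       (auto intro!: AE_I2 simp: abs_mult mult_left_le)
  have isn: "integrable lborel (\<lambda>z. gd z * sin (t * z))"
    by (rule Bochner_Integration.integrable_bound[OF integrable_normal_density[of 1 0]])
       (auto intro!: AE_I2 simp: abs_mult mult_left_le)
  have "(\<lambda>z. gd z * cos (t * (u - z))) = (\<lambda>z. cos (t * u) * (gd z * cos (t * z)) + sin (t * u) * (gd z * sin (t * z)))"
    by (simp add: right_diff_distrib cos_diff algebra_simps)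
  then show "(\<integral>z. gd z * cos (t * (u - z)) \<partial>lborel) = exp (- t\<^sup>2 / 2) * cos (t * u)"
    using ic isn c s by (simp add: mult.commute)
  have "(\<lambda>z. gd z * sin (t * (u - z))) = (\<lambda>z. sin (t * u) * (gd z * cos (t * z)) - cos (t * u) * (gd z * sin (t * z)))"
    by (simp add: right_diff_distrib sin_diff algebra_simps)
  then show "(\<integral>z. gd z * sin (t * (u - z)) \<partial>lborel) = exp (- t\<^sup>2 / 2) * sin (t * u)"
    using ic isn c s by (simp add: mult.commute)
qed

text \<open>The sinc kernel is the Fourier inverse of the indicator of \<open>[-a, a]\<close>,
  folded onto \<open>[0, a]\<close> by evenness. The formula in \<open>kern'_integral\<close> is its
  derivative under the integral sign.\<close>

lemma kern_integral:
  assumes "a \<ge> 0"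
  shows "kern a u = (\<integral>t. 1 * cos (t * u) * indicator {0..a} t \<partial>lborel) / pi"
proof (cases "u = 0")
  case True
  have "(\<integral>t. (1::real) * indicator {0..a} t \<partial>lborel) = a - 0"
    by (rule integral_FTC_Icc_real[OF assms]) (auto intro!: derivative_eq_intros)
  then show ?thesis using True by (simp add: kern_def geb_kernel_def)
next
  case False
  have "(\<integral>t. cos (t * u) * indicator {0..a} t \<partial>lborel) = sin (a * u) / u - sin (0 * u) / u"
    by (rule integral_FTC_Icc_real[OF assms]) (use False in \<open>auto intro!: derivative_eq_intros\<close>)
  then show ?thesis using False by (simp add: kern_def geb_kernel_def)
qed

lemma kern'_integral:
  assumes "a \<ge> 0"
  shows "kern' a u = - ((\<integral>t. t * sin (t * u) * indicator {0..a} t \<partial>lborel) / pi)"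
proof (cases "u = 0")
  case True
  then show ?thesis by (simp add: kern'_def dsinc_def)
next
  case False
  have "(\<integral>t. (t * sin (t * u)) * indicator {0..a} t \<partial>lborel) =
      (sin (a * u) - a * u * cos (a * u)) / u\<^sup>2 - (sin (0 * u) - 0 * u * cos (0 * u)) / u\<^sup>2"
    by (rule integral_FTC_Icc_real[OF assms])
       (use False in \<open>auto intro!: derivative_eq_intros simp: power2_eq_square field_simps\<close>)
  moreover have "a\<^sup>2 * dsinc (a * u) = (a * u * cos (a * u) - sin (a * u)) / u\<^sup>2"
    using False by (cases "a = 0") (simp_all add: dsinc_def power_mult_distrib)
  moreover have "kern' a u = (a\<^sup>2 * dsinc (a * u)) / pi"
    by (simp add: kern'_def)
  ultimately show ?thesis
    by (simp add: minus_divide_left)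
qed

text \<open>The integrand is dominated by \<open>gd z\<close> times a constant on
  \<open>[0, a]\<close>. A general bounded T serves cosine and sine at once.\<close>

lemma gd_kern_fubini:
  fixes T c :: "real \<Rightarrow> real"
  assumes T [measurable]: "T \<in> borel_measurable borel" and Tb: "\<And>x. \<bar>T x\<bar> \<le> 1"
    and c [measurable]: "c \<in> borel_measurable borel" and cb: "\<And>t. 0 \<le> t \<Longrightarrow> t \<le> a \<Longrightarrow> \<bar>c t\<bar> \<le> K"
  shows "(\<integral>z. gd z * (\<integral>t. c t * T (t * (u - z)) * indicator {0..a} t \<partial>lborel) \<partial>lborel) =
    (\<integral>t. c t * (\<integral>z. gd z * T (t * (u - z)) \<partial>lborel) * indicator {0..a} t \<partial>lborel)"
proof -
  define G where "G = (\<lambda>(z, t). gd z * (c t * T (t * (u - z)) * indicator {0..a} t))"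
  have bound: "\<bar>gd z * (c t * T (t * (u - z)) * indicator {0..a} t)\<bar> \<le> gd z * (K * indicator {0..a} t)" for z t
  proof -
    have "\<bar>c t\<bar> * \<bar>T (t * (u - z))\<bar> \<le> K * 1" if "0 \<le> t" "t \<le> a"
      using cb[OF that] by (intro mult_mono Tb) auto
    then show ?thesis
      by (auto simp: abs_mult split: split_indicator intro!: mult_left_mono)
  qed
  have G: "integrable (lborel \<Otimes>\<^sub>M lborel) G"
  proof (rule lborel_pair.Fubini_integrable)
    show [measurable]: "G \<in> borel_measurable (lborel \<Otimes>\<^sub>M lborel)"
      unfolding G_def by measurable
    have iK: "integrable lborel (\<lambda>t. gd z * (K * indicator {0..a} t))" for z :: real
      by (intro integrable_mult_right integrable_real_indicator) (auto simp: emeasure_lborel_Icc_eq)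
    have i2: "integrable lborel (\<lambda>t. G (z, t))" for z
      by (rule Bochner_Integration.integrable_bound[OF iK[of z]])
         (use bound[of z] in \<open>auto simp: G_def intro!: AE_I2 order_trans[OF _ abs_ge_self]\<close>)
    then show "AE z in lborel. integrable lborel (\<lambda>t. G (z, t))" by simp
    show "integrable lborel (\<lambda>z. \<integral>t. norm (G (z, t)) \<partial>lborel)"
    proof (rule Bochner_Integration.integrable_bound)
      show "integrable lborel (\<lambda>z. gd z * (\<integral>t. K * indicator {0..a} t \<partial>lborel))"
        by simp
      have "(\<integral>t. norm (G (z, t)) \<partial>lborel) \<le> (\<integral>t. gd z * (K * indicator {0..a} t) \<partial>lborel)" for z
        using bound[of z] i2[of z] iK[of z] by (intro integral_mono) (auto simp: G_def)
      then show "AE z in lborel. norm (\<integral>t. norm (G (z, t)) \<partial>lborel) \<le> norm (gd z * (\<integral>t. K * indicator {0..a} t \<partial>lborel))"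
        by (intro AE_I2) (auto intro!: order_trans[OF _ abs_ge_self])
    qed measurable
  qed
  have "(\<integral>z. gd z * (\<integral>t. c t * T (t * (u - z)) * indicator {0..a} t \<partial>lborel) \<partial>lborel)
      = (\<integral>z. (\<integral>t. G (z, t) \<partial>lborel) \<partial>lborel)"
    by (simp add: G_def)
  also have "\<dots> = (\<integral>t. (\<integral>z. G (z, t) \<partial>lborel) \<partial>lborel)"
    using lborel_pair.Fubini_integral[of "\<lambda>z t. G (z, t)"] G by simp
  also have "\<dots> = (\<integral>t. (\<integral>z. (c t * indicator {0..a} t) * (gd z * T (t * (u - z))) \<partial>lborel) \<partial>lborel)"
    unfolding G_def by (intro Bochner_Integration.integral_cong refl) (simp add: algebra_simps)
  also have "\<dots> = (\<integral>t. c t * (\<integral>z. gd z * T (t * (u - z)) \<partial>lborel) * indicator {0..a} t \<partial>lborel)"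
    by (simp only: integral_mult_right_zero) (simp only: mult_ac)
  finally show ?thesis .
qed

text \<open>Fourier inversion integral of \<open>pi * gd u\<close>, cut off at frequency a;
  \<open>gsin\<close> is the same for \<open>pi * (u * gd u)\<close>, that is, for minus the
  derivative.\<close>

definition gcos :: "real \<Rightarrow> real \<Rightarrow> real" where
  "gcos a u = (\<integral>t. exp (- t\<^sup>2 / 2) * cos (t * u) * indicator {0..a} t \<partial>lborel)"

definition gsin :: "real \<Rightarrow> real \<Rightarrow> real" where
  "gsin a u = (\<integral>t. (t * exp (- t\<^sup>2 / 2)) * sin (t * u) * indicator {0..a} t \<partial>lborel)"

text \<open>Smoothing by the sinc kernel merely cuts off the Fourier inversion of \<open>gd\<close>
  at frequency a, so the bias is a tail of that integral.\<close>

lemma gd_kern: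
  assumes "a \<ge> 0"
  shows "(\<integral>z. gd z * kern a (u - z) \<partial>lborel) = gcos a u / pi"
    and "(\<integral>z. gd z * kern' a (u - z) \<partial>lborel) = - gsin a u / pi"
proof -
  have "(\<integral>z. gd z * kern a (u - z) \<partial>lborel) =
      (\<integral>z. gd z * (\<integral>t. 1 * cos (t * (u - z)) * indicator {0..a} t \<partial>lborel) \<partial>lborel) / pi"
    unfolding kern_integral[OF assms] by (simp only: times_divide_eq_right integral_divide_zero)
  also have "\<dots> = gcos a u / pi"
    by (subst gd_kern_fubini[where K = 1]) (auto simp: gcos_def gd_trig)
  finally show "(\<integral>z. gd z * kern a (u - z) \<partial>lborel) = gcos a u / pi" .
  have "(\<integral>z. gd z * kern' a (u - z) \<partial>lborel) =
      - ((\<integral>z. gd z * (\<integral>t. t * sin (t * (u - z)) * indicator {0..a} t \<partial>lborel) \<partial>lborel) / pi)"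
    unfolding kern'_integral[OF assms]
    by (simp only: mult_minus_right times_divide_eq_right Bochner_Integration.integral_minus integral_divide_zero)
  also have "\<dots> = - gsin a u / pi"
    by (subst gd_kern_fubini[where K = a]) (auto simp: gsin_def gd_trig mult.assoc)
  finally show "(\<integral>z. gd z * kern' a (u - z) \<partial>lborel) = - gsin a u / pi" .
qed

text \<open>For \<open>t \<ge> a \<ge> 1\<close> both integrands are at most
  \<open>t * exp (- t\<^sup>2 / 2)\<close>, which has an explicit antiderivative.\<close>

lemma gcos_gsin_diff:
  assumes "1 \<le> a" "a \<le> R"
  shows "\<bar>gcos R u - gcos a u\<bar> \<le> exp (- a\<^sup>2 / 2)" "\<bar>gsin R u - gsin a u\<bar> \<le> exp (- a\<^sup>2 / 2)"
proof -
  have R0: "0 \<le> R" "0 \<le> a" using assms by auto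
  have i: "integrable lborel (\<lambda>t. f t * indicator {p..q} t)"
    if "\<And>t. isCont f t" for f :: "real \<Rightarrow> real" and p q
    using borel_integrable_atLeastAtMost[of p q f] that by simp
  have tail: "(\<integral>t. (t * exp (- t\<^sup>2 / 2)) * indicator {a..R} t \<partial>lborel) = - exp (- R\<^sup>2 / 2) - (- exp (- a\<^sup>2 / 2))"
    by (rule integral_FTC_Icc_real) (use assms in \<open>auto intro!: derivative_eq_intros\<close>)
  have gen: "\<bar>(\<integral>t. f t * indicator {0..R} t \<partial>lborel) - (\<integral>t. f t * indicator {0..a} t \<partial>lborel)\<bar> \<le> exp (- a\<^sup>2 / 2)"
    if c: "\<And>t. isCont f t" and b: "\<And>t. a \<le> t \<Longrightarrow> \<bar>f t\<bar> \<le> t * exp (- t\<^sup>2 / 2)" for f :: "real \<Rightarrow> real"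
  proof -
    have "(\<integral>t. f t * indicator {0..R} t \<partial>lborel) - (\<integral>t. f t * indicator {0..a} t \<partial>lborel)
        = (\<integral>t. f t * indicator {0..R} t - f t * indicator {0..a} t \<partial>lborel)"
      using i[OF c] by simp
    also have "\<bar>\<dots>\<bar> \<le> (\<integral>t. \<bar>f t * indicator {0..R} t - f t * indicator {0..a} t\<bar> \<partial>lborel)"
      by simp
    also have "\<dots> \<le> (\<integral>t. (t * exp (- t\<^sup>2 / 2)) * indicator {a..R} t \<partial>lborel)"
    proof (rule integral_mono)
      show "integrable lborel (\<lambda>t. \<bar>f t * indicator {0..R} t - f t * indicator {0..a} t\<bar>)"
        by (intro integrable_abs Bochner_Integration.integrable_diff i c)
      show "integrable lborel (\<lambda>t. (t * exp (- t\<^sup>2 / 2)) * indicator {a..R} t)"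
        by (rule i) auto
      show "\<bar>f t * indicator {0..R} t - f t * indicator {0..a} t\<bar> \<le> (t * exp (- t\<^sup>2 / 2)) * indicator {a..R} t" for t
        using b[of t] assms by (auto split: split_indicator)
    qed
    also have "\<dots> \<le> exp (- a\<^sup>2 / 2)"
      unfolding tail by simp
    finally show ?thesis .
  qed
  show "\<bar>gcos R u - gcos a u\<bar> \<le> exp (- a\<^sup>2 / 2)"
    unfolding gcos_def
  proof (rule gen)
    fix t assume "a \<le> t"
    then have "1 \<le> t" using assms by simp
    then have "exp (- t\<^sup>2 / 2) * \<bar>cos (t * u)\<bar> \<le> exp (- t\<^sup>2 / 2) * t"
      by (intro mult_left_mono order_trans[OF abs_cos_le_one]) auto
    then show "\<bar>exp (- t\<^sup>2 / 2) * cos (t * u)\<bar> \<le> t * exp (- t\<^sup>2 / 2)"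
      by (simp add: abs_mult mult.commute)
  qed auto
  show "\<bar>gsin R u - gsin a u\<bar> \<le> exp (- a\<^sup>2 / 2)"
    unfolding gsin_def
  proof (rule gen)
    fix t assume "a \<le> t"
    then have "1 \<le> t" using assms by simp
    then have "(t * exp (- t\<^sup>2 / 2)) * \<bar>sin (t * u)\<bar> \<le> (t * exp (- t\<^sup>2 / 2)) * 1"
      by (intro mult_left_mono abs_sin_le_one) auto
    then show "\<bar>(t * exp (- t\<^sup>2 / 2)) * sin (t * u)\<bar> \<le> t * exp (- t\<^sup>2 / 2)"
      using \<open>1 \<le> t\<close> by (simp add: abs_mult)
  qed auto
qed

text \<open>Integration by parts; it reduces the limit of \<open>gsin\<close> to that of
  \<open>gcos\<close>, so that one inversion formula serves both.\<close>

lemma gsin_eq: "0 \<le> R \<Longrightarrow> gsin R u = u * gcos R u - exp (- R\<^sup>2 / 2) * sin (R * u)"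
proof -
  assume R: "0 \<le> R"
  have i: "integrable lborel (\<lambda>t. f t * indicator {p..q} t)"
    if "\<And>t. isCont f t" for f :: "real \<Rightarrow> real" and p q
    using borel_integrable_atLeastAtMost[of p q f] that by simp
  have "(\<integral>t. ((t * exp (- t\<^sup>2 / 2)) * sin (t * u) - u * (exp (- t\<^sup>2 / 2) * cos (t * u))) * indicator {0..R} t \<partial>lborel)
      = - (exp (- R\<^sup>2 / 2) * sin (R * u)) - (- (exp (- 0\<^sup>2 / 2) * sin (0 * u)))"
    by (rule integral_FTC_Icc_real[OF R])
       (auto intro!: derivative_eq_intros simp: algebra_simps)
  moreover have "(\<integral>t. ((t * exp (- t\<^sup>2 / 2)) * sin (t * u) - u * (exp (- t\<^sup>2 / 2) * cos (t * u))) * indicator {0..R} t \<partial>lborel)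
      = (\<integral>t. (t * exp (- t\<^sup>2 / 2)) * sin (t * u) * indicator {0..R} t - u * (exp (- t\<^sup>2 / 2) * cos (t * u) * indicator {0..R} t) \<partial>lborel)"
    by (intro Bochner_Integration.integral_cong refl) (simp add: algebra_simps)
  moreover have "\<dots> = gsin R u - u * gcos R u"
    unfolding gsin_def gcos_def
    by (subst Bochner_Integration.integral_diff) (auto intro!: i integrable_mult_right)
  ultimately show ?thesis by simp
qed

text \<open>Up to the factor \<open>sqrt (2 * pi)\<close> the Gaussian is its own Fourier transform,
  so \<open>gd_trig\<close> with u as the frequency doubles as the inversion formula. Evenness
  halves the integral.\<close>

lemma gcos_lim: "((\<lambda>R. gcos R u) \<longlongrightarrow> pi * gd u) at_top"
proof -
  define f where "f = (\<lambda>t. exp (- t\<^sup>2 / 2) * cos (t * u))"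
  have f_gd: "f t = sqrt (2 * pi) * (gd t * cos (t * u))" for t
    by (simp add: f_def gd_eq)
  have fi: "integrable lborel f"
    unfolding f_gd[abs_def]
    by (intro integrable_mult_right Bochner_Integration.integrable_bound[OF integrable_normal_density[of 1 0]])
       (auto intro!: AE_I2 simp: abs_mult mult_left_le)
  have full: "(\<integral>t. f t \<partial>lborel) = sqrt (2 * pi) * exp (- u\<^sup>2 / 2)"
    using gd_trig(1)[of u 0] unfolding f_gd[abs_def] by (simp add: mult.commute)
  define h where "h = (\<lambda>t. indicator {0..} t *\<^sub>R f t)"
  have hi: "integrable lborel h"
    unfolding h_def using fi by (intro integrable_mult_indicator) auto
  have "has_bochner_integral lborel f (2 *\<^sub>R (\<integral>t. h t \<partial>lborel))"
    using hi by (intro has_bochner_integral_even_function) (auto simp: h_def f_def has_bochner_integral_integrable)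
  then have "(\<integral>t. h t \<partial>lborel) = sqrt (2 * pi) * exp (- u\<^sup>2 / 2) / 2"
    using full by (auto simp: has_bochner_integral_iff)
  also have "\<dots> = pi * gd u"
    using real_sqrt_mult_self[of "2 * pi"] by (simp add: gd_eq field_simps)
  finally have hv: "(\<integral>t. h t \<partial>lborel) = pi * gd u" .
  have "((\<lambda>y. \<integral>x. indicator {..y} x *\<^sub>R h x \<partial>lborel) \<longlongrightarrow> (\<integral>t. h t \<partial>lborel)) at_top"
    by (rule tendsto_integral_at_top) (use hi in auto)
  moreover have "(\<integral>x. indicator {..y} x *\<^sub>R h x \<partial>lborel) = gcos y u" for y
    unfolding gcos_def h_def f_def
    by (intro Bochner_Integration.integral_cong refl) (auto split: split_indicator)
  ultimately show ?thesis
    by (simp add: hv)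
qed

lemma gcos_gsin_bias:
  assumes "1 \<le> a"
  shows "\<bar>gcos a u / pi - gd u\<bar> \<le> exp (- a\<^sup>2 / 2)" "\<bar>gsin a u / pi - u * gd u\<bar> \<le> exp (- a\<^sup>2 / 2)"
proof -
  have pi1: "pi \<ge> 1" using pi_ge_3 by simp
  have div: "\<bar>x / pi - y\<bar> \<le> e" if "\<bar>pi * y - x\<bar> \<le> e" for x y e :: real
  proof -
    have "\<bar>x / pi - y\<bar> = \<bar>pi * y - x\<bar> / pi"
    proof -
      have "x / pi - y = (x - pi * y) / pi" by (simp add: diff_divide_distrib)
      then show ?thesis by (simp add: abs_divide abs_minus_commute)
    qed
    also have "\<dots> \<le> \<bar>pi * y - x\<bar> / 1"
      using pi1 by (intro divide_left_mono) auto
    finally show ?thesis using that by simp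
  qed
  show "\<bar>gcos a u / pi - gd u\<bar> \<le> exp (- a\<^sup>2 / 2)"
  proof (rule div, rule tendsto_upperbound)
    show "((\<lambda>R. \<bar>gcos R u - gcos a u\<bar>) \<longlongrightarrow> \<bar>pi * gd u - gcos a u\<bar>) at_top"
      by (intro tendsto_intros gcos_lim)
    show "\<forall>\<^sub>F R in at_top. \<bar>gcos R u - gcos a u\<bar> \<le> exp (- a\<^sup>2 / 2)"
      using eventually_ge_at_top[of a] by eventually_elim (rule gcos_gsin_diff[OF assms])
  qed simp
  have "((\<lambda>R. exp (- R\<^sup>2 / 2) * sin (R * u)) \<longlongrightarrow> 0) at_top"
  proof (rule Lim_null_comparison)
    show "\<forall>\<^sub>F R in at_top. norm (exp (- R\<^sup>2 / 2) * sin (R * u)) \<le> exp (- R\<^sup>2 / 2)"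
      by (auto simp: abs_mult mult_left_le)
    have "filterlim (\<lambda>R::real. R\<^sup>2 / 2) at_top at_top"
      by (intro filterlim_tendsto_pos_mult_at_top[OF tendsto_const[of "1/2"], simplified] filterlim_pow_at_top filterlim_ident) auto
    then show "((\<lambda>R::real. exp (- R\<^sup>2 / 2)) \<longlongrightarrow> 0) at_top"
      by (auto intro!: filterlim_compose[OF exp_at_bot] simp: filterlim_uminus_at_bot)
  qed
  then have "((\<lambda>R. u * gcos R u - exp (- R\<^sup>2 / 2) * sin (R * u)) \<longlongrightarrow> u * (pi * gd u) - 0) at_top"
    by (intro tendsto_intros gcos_lim)
  moreover have "\<forall>\<^sub>F R in at_top. u * gcos R u - exp (- R\<^sup>2 / 2) * sin (R * u) = gsin R u"
    using eventually_ge_at_top[of 0] by eventually_elim (simp add: gsin_eq)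
  ultimately have lim: "((\<lambda>R. gsin R u) \<longlongrightarrow> pi * (u * gd u)) at_top"
    using Lim_transform_eventually by (force simp: mult.left_commute)
  show "\<bar>gsin a u / pi - u * gd u\<bar> \<le> exp (- a\<^sup>2 / 2)"
  proof (rule div, rule tendsto_upperbound)
    show "((\<lambda>R. \<bar>gsin R u - gsin a u\<bar>) \<longlongrightarrow> \<bar>pi * (u * gd u) - gsin a u\<bar>) at_top"
      by (intro tendsto_intros lim)
    show "\<forall>\<^sub>F R in at_top. \<bar>gsin R u - gsin a u\<bar> \<le> exp (- a\<^sup>2 / 2)"
      using eventually_ge_at_top[of a] by eventually_elim (rule gcos_gsin_diff[OF assms])
  qed simp
qed

lemma kern_bias:
  assumes "1 \<le> a"
  shows "\<bar>(\<integral>z. gd z * kern a (u - z) \<partial>lborel) - gd u\<bar> \<le> exp (- a\<^sup>2 / 2)"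
    and "\<bar>(\<integral>z. gd z * kern' a (u - z) \<partial>lborel) - (- u * gd u)\<bar> \<le> exp (- a\<^sup>2 / 2)"
proof -
  have a: "0 \<le> a" using assms by simp
  show "\<bar>(\<integral>z. gd z * kern a (u - z) \<partial>lborel) - gd u\<bar> \<le> exp (- a\<^sup>2 / 2)"
    unfolding gd_kern[OF a] using gcos_gsin_bias[OF assms] by simp
  show "\<bar>(\<integral>z. gd z * kern' a (u - z) \<partial>lborel) - (- u * gd u)\<bar> \<le> exp (- a\<^sup>2 / 2)"
    unfolding gd_kern[OF a] using gcos_gsin_bias(2)[OF assms, of u] by (simp add: abs_minus_commute)
qed

section \<open>Gaussian mixtures\<close>

lemma sq_sum_le: "(u + v)\<^sup>2 \<le> 2 * u\<^sup>2 + 2 * v\<^sup>2" for u v :: real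
  using sum_squares_bound[of u v] by (simp add: power2_sum)

definition mix :: "nat set \<Rightarrow> (nat \<Rightarrow> real) \<Rightarrow> real \<Rightarrow> real" where
  "mix B \<theta> x = (\<Sum>k\<in>B. gd (x - \<theta> k)) / real (card B)"

definition mix' :: "nat set \<Rightarrow> (nat \<Rightarrow> real) \<Rightarrow> real \<Rightarrow> real" where
  "mix' B \<theta> x = (\<Sum>k\<in>B. - (x - \<theta> k) * gd (x - \<theta> k)) / real (card B)"

text \<open>Dominates \<open>f'\<^sup>2 / f\<close> by Cauchy-Schwarz and, unlike that quotient, is
  linear in the components, so that its integral over a set splits into one Gaussian moment per
  mean.\<close>

definition mixq :: "nat set \<Rightarrow> (nat \<Rightarrow> real) \<Rightarrow> real \<Rightarrow> real" where
  "mixq B \<theta> x = (\<Sum>k\<in>B. (x - \<theta> k)\<^sup>2 * gd (x - \<theta> k)) / real (card B)"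

lemma gd_pos [simp]: "0 < gd x" and gd_nonneg [simp]: "0 \<le> gd x"
  by (auto simp: normal_density_pos)

lemma sqrt_2pi: "2 \<le> sqrt (2 * pi)" "sqrt (2 * pi) \<le> 3"
  using pi_ge_3 pi_less_4 by (auto intro: real_le_rsqrt real_le_lsqrt)

lemma gd_le: "gd x \<le> 1 / 2"
  unfolding gd_eq using sqrt_2pi by (intro frac_le) auto

lemma gd_le_1: "gd x \<le> 1"
  using gd_le[of x] by simp

lemma mix_borel [measurable]:
  "mix B \<theta> \<in> borel_measurable borel" "mix' B \<theta> \<in> borel_measurable borel" "mixq B \<theta> \<in> borel_measurable borel"
  unfolding mix_def[abs_def] mix'_def[abs_def] mixq_def[abs_def] by measurable

locale finite_block =
  fixes B :: "nat set" and \<theta> :: "nat \<Rightarrow> real" and n :: real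
  assumes fin: "finite B" and ne: "B \<noteq> {}"
  defines "n \<equiv> real (card B)"
begin

lemma n_pos: "n > 0" "n \<ge> 1"
  using fin ne by (auto simp: n_def card_gt_0_iff Suc_le_eq)

abbreviation "f \<equiv> mix B \<theta>"
abbreviation "f' \<equiv> mix' B \<theta>"
abbreviation "g \<equiv> mixq B \<theta>"

lemma f_pos: "f x > 0"
  unfolding mix_def using fin ne n_pos by (intro divide_pos_pos sum_pos) (auto simp: n_def)

lemma g_nonneg: "g x \<ge> 0"
  unfolding mixq_def by (intro divide_nonneg_nonneg sum_nonneg) auto

text \<open>Tweedie's formula: \<open>x + f' x / f x\<close> is the posterior mean for the uniform
  prior on the means of the block. Hence the cross term vanishes and the decomposition is an
  identity for every h.\<close>

lemma bayes_pointwise: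
  "(\<Sum>k\<in>B. gd (x - \<theta> k) * (h - \<theta> k)\<^sup>2) =
    (\<Sum>k\<in>B. gd (x - \<theta> k) * (x + f' x / f x - \<theta> k)\<^sup>2) + n * f x * (h - (x + f' x / f x))\<^sup>2"
proof -
  define m where "m = x + f' x / f x"
  have A: "(\<Sum>k\<in>B. gd (x - \<theta> k)) = n * f x"
    using n_pos by (simp add: mix_def n_def)
  have "n * f' x = (\<Sum>k\<in>B. gd (x - \<theta> k) * \<theta> k - x * gd (x - \<theta> k))"
    using n_pos by (simp add: mix'_def n_def algebra_simps)
  then have "n * f' x = (\<Sum>k\<in>B. gd (x - \<theta> k) * \<theta> k) - x * (n * f x)"
    by (simp add: sum_subtractf A flip: sum_distrib_left)
  moreover have "m * f x = x * f x + f' x"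
    using f_pos[of x] by (simp add: m_def field_simps)
  then have "n * (m * f x) = n * (x * f x + f' x)" by simp
  then have "n * f x * m = x * (n * f x) + n * f' x"
    by (simp only: distrib_left mult_ac)
  ultimately have C: "(\<Sum>k\<in>B. gd (x - \<theta> k) * \<theta> k) = n * f x * m"
    by simp
  have "(\<Sum>k\<in>B. gd (x - \<theta> k) * (h - \<theta> k)\<^sup>2) =
      (\<Sum>k\<in>B. gd (x - \<theta> k) * (m - \<theta> k)\<^sup>2 + gd (x - \<theta> k) * (h - m)\<^sup>2
        + 2 * (h - m) * m * gd (x - \<theta> k) - 2 * (h - m) * (gd (x - \<theta> k) * \<theta> k))"
    by (intro sum.cong refl) (simp add: power2_eq_square algebra_simps)
  also have "\<dots> = (\<Sum>k\<in>B. gd (x - \<theta> k) * (m - \<theta> k)\<^sup>2) + n * f x * (h - m)\<^sup>2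
      + 2 * (h - m) * m * (n * f x) - 2 * (h - m) * (n * f x * m)"
    unfolding sum.distrib sum_subtractf sum_distrib_left[symmetric] sum_distrib_right[symmetric] A C by simp
  finally show ?thesis
    by (simp add: m_def)
qed

lemma f'_sq_le: "(f' x)\<^sup>2 \<le> f x * g x"
proof -
  have "(\<Sum>k\<in>B. - (x - \<theta> k) * gd (x - \<theta> k))\<^sup>2 = (\<Sum>k\<in>B. sqrt (gd (x - \<theta> k)) * (- (x - \<theta> k) * sqrt (gd (x - \<theta> k))))\<^sup>2"
    by (intro arg_cong[where f="\<lambda>s. s\<^sup>2"] sum.cong refl) (simp add: algebra_simps flip: real_sqrt_mult)
  also have "\<dots> \<le> (\<Sum>k\<in>B. (sqrt (gd (x - \<theta> k)))\<^sup>2) * (\<Sum>k\<in>B. (- (x - \<theta> k) * sqrt (gd (x - \<theta> k)))\<^sup>2)"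
    by (rule Cauchy_Schwarz_ineq_sum)
  also have "\<dots> = (\<Sum>k\<in>B. gd (x - \<theta> k)) * (\<Sum>k\<in>B. (x - \<theta> k)\<^sup>2 * gd (x - \<theta> k))"
    unfolding power_mult_distrib power2_minus by simp
  finally show ?thesis
    unfolding mix_def mix'_def mixq_def
    by (simp add: power_divide power2_eq_square[of "real (card B)"] divide_right_mono)
qed

text \<open>Concavity of the entropy, applied to the posterior weights.\<close>

lemma g_le: "g x \<le> 2 * f x * ln (1 / f x)"
proof -
  define p where "p = (\<lambda>k. gd (x - \<theta> k))"
  define q where "q = f x"
  have q: "q > 0" using f_pos by (simp add: q_def)
  have p: "p k > 0" for k by (simp add: p_def)
  have sump: "(\<Sum>k\<in>B. p k) = n * q"
    using n_pos by (simp add: q_def p_def mix_def n_def)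
  have each: "(x - \<theta> k)\<^sup>2 * p k \<le> 2 * (p k * ln (1 / q) - p k + q)" for k
  proof -
    have "ln (p k) \<le> - ((x - \<theta> k)\<^sup>2 / 2)"
    proof -
      have "p k \<le> exp (- (x - \<theta> k)\<^sup>2 / 2) / 1"
        unfolding p_def gd_eq using pi_ge_3 by (intro divide_left_mono) auto
      then show ?thesis
        using p[of k] ln_mono[of "p k"] by fastforce
    qed
    then have "(x - \<theta> k)\<^sup>2 / 2 \<le> ln (1 / q) + ln (q / p k)"
      using p[of k] q by (simp add: ln_div)
    also have "\<dots> \<le> ln (1 / q) + (q / p k - 1)"
      using p[of k] q by (intro add_left_mono ln_le_minus_one) auto
    finally have "p k * ((x - \<theta> k)\<^sup>2 / 2) \<le> p k * (ln (1 / q) + (q / p k - 1))"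
      using p[of k] by (intro mult_left_mono) auto
    also have "\<dots> = p k * ln (1 / q) - p k + q"
      using p[of k] by (simp add: distrib_left right_diff_distrib)
    finally show ?thesis
      by (simp add: mult.commute)
  qed
  \<comment> \<open>Summed over the block, \<open>- p k\<close> and \<open>q\<close> cancel, because
    \<open>q\<close> is the average of the \<open>p k\<close>; only the entropy term
    survives.\<close>
  have "(\<Sum>k\<in>B. (x - \<theta> k)\<^sup>2 * p k) \<le> (\<Sum>k\<in>B. 2 * (p k * ln (1 / q) - p k + q))"
    by (intro sum_mono each)
  also have "\<dots> = 2 * ((\<Sum>k\<in>B. p k) * ln (1 / q) - (\<Sum>k\<in>B. p k) + n * q)"
    by (simp add: sum.distrib sum_subtractf n_def flip: sum_distrib_left sum_distrib_right)
  also have "\<dots> = n * (2 * q * ln (1 / q))"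
    by (simp add: sump)
  finally show ?thesis
    using n_pos by (simp add: mixq_def p_def q_def[symmetric] n_def[symmetric] divide_le_eq mult.commute)
qed

text \<open>Below \<rho> the logarithm \<open>ln (1 / f x)\<close> is unbounded, but
  \<open>f x * ln (\<rho> / f x)\<close> is at most \<rho>. So \<open>ln (1 / \<rho>)\<close> can
  take its place once the factor \<open>f x\<close> is raised to \<rho>.\<close>

lemma g_le_max:
  assumes "\<rho> > 0"
  shows "g x \<le> 2 * max \<rho> (f x) * (max 0 (ln (1 / \<rho>)) + 1)"
proof -
  define \<Lambda> where "\<Lambda> = max 0 (ln (1 / \<rho>))"
  have \<Lambda>: "\<Lambda> \<ge> 0" "ln (1 / \<rho>) \<le> \<Lambda>" by (auto simp: \<Lambda>_def)
  have fx: "f x > 0" by (rule f_pos)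
  have "f x * ln (1 / f x) \<le> max \<rho> (f x) * (\<Lambda> + 1)"
  proof (cases "f x \<ge> \<rho>")
    case True
    then have "1 / f x \<le> 1 / \<rho>"
      using assms by (simp add: frac_le)
    then have "ln (1 / f x) \<le> ln (1 / \<rho>)"
      using assms fx by (subst ln_le_cancel_iff) auto
    then have "ln (1 / f x) \<le> \<Lambda> + 1" using \<Lambda> by linarith
    then have "f x * ln (1 / f x) \<le> f x * (\<Lambda> + 1)"
      using fx by (intro mult_left_mono) auto
    then show ?thesis using True by (simp add: max_def)
  next
    case False
    have "ln (\<rho> / f x) \<le> \<rho> / f x - 1"
      using assms fx by (intro ln_le_minus_one) auto
    then have "f x * ln (\<rho> / f x) \<le> f x * (\<rho> / f x - 1)"
      using fx by (intro mult_left_mono) auto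
    also have "\<dots> \<le> \<rho>" using fx by (simp add: field_simps)
    finally have 1: "f x * ln (\<rho> / f x) \<le> \<rho>" .
    have "ln (1 / f x) = ln (1 / \<rho>) + ln (\<rho> / f x)"
      using assms fx by (simp add: ln_div)
    then have "f x * ln (1 / f x) = f x * ln (1 / \<rho>) + f x * ln (\<rho> / f x)"
      by (simp add: algebra_simps)
    also have "\<dots> \<le> \<rho> * \<Lambda> + \<rho>"
    proof (intro add_mono 1)
      have "f x * ln (1 / \<rho>) \<le> f x * \<Lambda>" using fx \<Lambda> by (intro mult_left_mono) auto
      also have "\<dots> \<le> \<rho> * \<Lambda>" using False \<Lambda> by (intro mult_right_mono) auto
      finally show "f x * ln (1 / \<rho>) \<le> \<rho> * \<Lambda>" .
    qed
    finally show ?thesis using False by (simp add: algebra_simps max_def)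
  qed
  then show ?thesis
    using g_le[of x] by (simp add: \<Lambda>_def)
qed

text \<open>In \<open>f'\<^sup>2 \<le> f * g\<close> both factors are at most
  \<open>max \<rho> f\<close> up to the logarithm, so the denominator cancels. The bound is uniform
  in x and in the means.\<close>

lemma score_le:
  assumes "\<rho> > 0"
  shows "(f' x / max \<rho> (f x))\<^sup>2 \<le> 2 * (max 0 (ln (1 / \<rho>)) + 1)"
proof -
  define m where "m = max \<rho> (f x)"
  have m: "m > 0" "f x \<le> m" using assms by (auto simp: m_def)
  have "(f' x)\<^sup>2 \<le> f x * g x" by (rule f'_sq_le)
  also have "\<dots> \<le> m * (2 * m * (max 0 (ln (1 / \<rho>)) + 1))"
    using g_le_max[OF assms, of x] m f_pos[of x] g_nonneg[of x] unfolding m_def[symmetric]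
    by (intro mult_mono) auto
  finally have "(f' x)\<^sup>2 / m\<^sup>2 \<le> m * (2 * m * (max 0 (ln (1 / \<rho>)) + 1)) / m\<^sup>2"
    by (rule divide_right_mono) simp
  also have "\<dots> = 2 * (max 0 (ln (1 / \<rho>)) + 1)"
    using m by (simp add: power2_eq_square)
  finally show ?thesis
    by (simp add: m_def power_divide)
qed

lemma f'_sq_over_f: "(f' x)\<^sup>2 / f x \<le> g x"
  using f'_sq_le[of x] f_pos[of x] by (simp add: divide_le_eq mult.commute)

end

section \<open>Moments of sums of independent variables\<close>

lemma (in prob_space) integrable_bounded:
  fixes X :: "'a \<Rightarrow> real"
  assumes "X \<in> borel_measurable M" "\<And>x. x \<in> space M \<Longrightarrow> \<bar>X x\<bar> \<le> c"
  shows "integrable M X"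
  by (rule integrable_const_bound[of _ c]) (use assms in auto)

lemma (in prob_space) expectation_abs_le:
  fixes X :: "'a \<Rightarrow> real"
  assumes "X \<in> borel_measurable M" "\<And>x. x \<in> space M \<Longrightarrow> \<bar>X x\<bar> \<le> c"
  shows "\<bar>expectation X\<bar> \<le> c"
proof -
  have "\<bar>expectation X\<bar> \<le> expectation (\<lambda>x. \<bar>X x\<bar>)"
    by simp
  also have "\<dots> \<le> c"
    using assms integrable_bounded[OF assms]
    by (intro integral_le_const) auto
  finally show ?thesis .
qed

text \<open>A Rosenthal-type bound. In the expansion of \<open>(Y i + S) ^ 4\<close> the terms
  containing a first power vanish by independence and centering. The remaining mixed term is
  \<open>6 * (E2 i * s)\<close>, which the square in \<open>3 * (E2 i + s)\<^sup>2\<close> absorbs.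
  The second moment is part of the induction because this mixed term uses it.\<close>

lemma (in prob_space) centered_sum_moments:
  fixes Y :: "'i \<Rightarrow> 'a \<Rightarrow> real"
  assumes "finite I" "indep_vars (\<lambda>_. borel) Y I"
    and "\<And>i x. i \<in> I \<Longrightarrow> x \<in> space M \<Longrightarrow> \<bar>Y i x\<bar> \<le> c"
    and "\<And>i. i \<in> I \<Longrightarrow> expectation (Y i) = 0"
  shows "expectation (\<lambda>x. (\<Sum>i\<in>I. Y i x)\<^sup>2) = (\<Sum>i\<in>I. expectation (\<lambda>x. (Y i x)\<^sup>2)) \<and>
    expectation (\<lambda>x. (\<Sum>i\<in>I. Y i x)^4) \<le>
      3 * (\<Sum>i\<in>I. expectation (\<lambda>x. (Y i x)\<^sup>2))\<^sup>2 + c\<^sup>2 * (\<Sum>i\<in>I. expectation (\<lambda>x. (Y i x)\<^sup>2))"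
  using assms
proof (induction I rule: finite_induct)
  case (insert i I)
  define S where "S = (\<lambda>x. \<Sum>j\<in>I. Y j x)"
  define E2 where "E2 = (\<lambda>i. expectation (\<lambda>x. (Y i x)\<^sup>2))"
  have rv [measurable]: "random_variable borel (Y j)" if "j \<in> insert i I" for j
    using insert.prems(1) that unfolding indep_vars_def by auto
  have rvS [measurable]: "random_variable borel S" "random_variable borel (Y i)"
    unfolding S_def using rv by auto
  have Sb: "\<bar>S x\<bar> \<le> real (card I) * c" if "x \<in> space M" for x
    unfolding S_def using insert.prems(2) that
    by (intro order_trans[OF sum_abs]) (metis (mono_tags, lifting) insertCI sum_bounded_above)
  have Yb: "\<bar>Y i x\<bar> \<le> c" if "x \<in> space M" for x
    using insert.prems(2) that by auto
  have c0: "c \<ge> 0" 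
    using Yb not_empty by force
  have Spow: "integrable M (\<lambda>x. S x ^ k)" for k
    using Sb by (intro integrable_bounded[of _ "(real (card I) * c) ^ k"]) (auto simp: power_abs intro: power_mono)
  have Ypow: "integrable M (\<lambda>x. Y i x ^ k)" for k
    using Yb by (intro integrable_bounded[of _ "c ^ k"]) (auto simp: power_abs intro: power_mono)
  have ind: "indep_var borel (Y i) borel S"
    unfolding S_def using insert by (intro indep_vars_sum) auto
  have indp: "indep_var borel (\<lambda>x. Y i x ^ k) borel (\<lambda>x. S x ^ l)" for k l
    using indep_var_compose[OF ind, of "\<lambda>x. x ^ k" borel "\<lambda>x. x ^ l" borel] by (simp add: comp_def)
  have prod: "expectation (\<lambda>x. Y i x ^ k * S x ^ l) = expectation (\<lambda>x. Y i x ^ k) * expectation (\<lambda>x. S x ^ l)"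
    and prodi: "integrable M (\<lambda>x. Y i x ^ k * S x ^ l)" for k l
    using indep_var_lebesgue_integral[OF indp] indep_var_integrable[OF indp] Spow Ypow by auto
  define P where "P = (\<lambda>k l x. Y i x ^ k * S x ^ l)"
  have P: "expectation (P k l) = expectation (\<lambda>x. Y i x ^ k) * expectation (\<lambda>x. S x ^ l)"
    "integrable M (P k l)" for k l
    using prod prodi by (simp_all add: P_def)
  have E0: "expectation (Y i) = 0" "expectation S = 0"
  proof -
    show "expectation (Y i) = 0" using insert by auto
    have "expectation S = (\<Sum>j\<in>I. expectation (Y j))"
      unfolding S_def using insert.prems(2) rv
      by (intro Bochner_Integration.integral_sum integrable_bounded[of _ c]) auto
    then show "expectation S = 0" using insert by auto
  qed
  have IH: "expectation (\<lambda>x. S x ^ 2) = (\<Sum>i\<in>I. E2 i)"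
    "expectation (\<lambda>x. S x ^ 4) \<le> 3 * (\<Sum>i\<in>I. E2 i)\<^sup>2 + c\<^sup>2 * (\<Sum>i\<in>I. E2 i)"
    using insert.IH insert.prems indep_vars_subset[OF insert.prems(1), of I] unfolding S_def E2_def
    by auto
  have two: "expectation (\<lambda>x. (Y i x + S x)\<^sup>2) = E2 i + expectation (\<lambda>x. S x ^ 2)"
  proof -
    have eq: "(\<lambda>x. (Y i x + S x)\<^sup>2) = (\<lambda>x. P 2 0 x + 2 * P 1 1 x + P 0 2 x)"
      by (auto simp: P_def power2_eq_square algebra_simps)
    have "expectation (\<lambda>x. (Y i x + S x)\<^sup>2) = expectation (\<lambda>x. Y i x ^ 2) * expectation (\<lambda>x. S x ^ 0)
        + 2 * (expectation (\<lambda>x. Y i x ^ 1) * expectation (\<lambda>x. S x ^ 1))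
        + expectation (\<lambda>x. Y i x ^ 0) * expectation (\<lambda>x. S x ^ 2)"
      unfolding eq by (simp add: P del: power_0 power_one_right One_nat_def)
    then show ?thesis
      using E0 by (simp add: prob_space E2_def)
  qed
  have four: "expectation (\<lambda>x. (Y i x + S x)^4) =
      expectation (\<lambda>x. Y i x ^ 4) + 6 * (E2 i * expectation (\<lambda>x. S x ^ 2)) + expectation (\<lambda>x. S x ^ 4)"
  proof -
    have eq: "(\<lambda>x. (Y i x + S x)^4) = (\<lambda>x. P 4 0 x + 4 * P 3 1 x + 6 * P 2 2 x + 4 * P 1 3 x + P 0 4 x)"
      by (auto simp: P_def power4_eq_xxxx power3_eq_cube power2_eq_square algebra_simps)
    have "expectation (\<lambda>x. (Y i x + S x)^4) = expectation (\<lambda>x. Y i x ^ 4) * expectation (\<lambda>x. S x ^ 0)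
        + 4 * (expectation (\<lambda>x. Y i x ^ 3) * expectation (\<lambda>x. S x ^ 1))
        + 6 * (expectation (\<lambda>x. Y i x ^ 2) * expectation (\<lambda>x. S x ^ 2))
        + 4 * (expectation (\<lambda>x. Y i x ^ 1) * expectation (\<lambda>x. S x ^ 3))
        + expectation (\<lambda>x. Y i x ^ 0) * expectation (\<lambda>x. S x ^ 4)"
      unfolding eq by (simp add: P del: power_0 power_one_right One_nat_def)
    then show ?thesis
      using E0 by (simp add: prob_space E2_def)
  qed
  have Y4: "expectation (\<lambda>x. Y i x ^ 4) \<le> c\<^sup>2 * E2 i"
  proof -
    have "expectation (\<lambda>x. Y i x ^ 4) \<le> expectation (\<lambda>x. c\<^sup>2 * Y i x ^ 2)"
    proof (rule integral_mono)
      show "integrable M (\<lambda>x. Y i x ^ 4)" "integrable M (\<lambda>x. c\<^sup>2 * Y i x ^ 2)"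
        using Ypow by auto
      fix x assume "x \<in> space M"
      then have "(Y i x)\<^sup>2 \<le> c\<^sup>2"
        using Yb c0 by (metis abs_le_square_iff abs_of_nonneg)
      then show "Y i x ^ 4 \<le> c\<^sup>2 * Y i x ^ 2"
        using mult_right_mono[of "(Y i x)\<^sup>2" "c\<^sup>2" "(Y i x)\<^sup>2"] by (simp flip: power_add)
    qed
    then show ?thesis
      by (simp add: E2_def)
  qed
  have E2pos: "E2 j \<ge> 0" for j
    by (auto simp: E2_def intro: integral_nonneg)
  define s where "s = (\<Sum>i\<in>I. E2 i)"
  have eq: "(\<lambda>x. (\<Sum>j\<in>insert i I. Y j x)) = (\<lambda>x. Y i x + S x)"
    using insert by (simp add: S_def)
  have sumE: "(\<Sum>j\<in>insert i I. E2 j) = E2 i + s"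
    using insert by (simp add: s_def)
  have "expectation (\<lambda>x. (Y i x + S x)^4) \<le> c\<^sup>2 * E2 i + 6 * (E2 i * s) + (3 * s\<^sup>2 + c\<^sup>2 * s)"
    unfolding four using Y4 IH by (simp add: s_def)
  also have "\<dots> \<le> 3 * (E2 i + s)\<^sup>2 + c\<^sup>2 * (E2 i + s)"
    by (simp add: power2_eq_square algebra_simps)
  finally show ?case
    using two IH unfolding eq E2_def[symmetric] sumE fun_cong[OF eq] by (simp add: s_def)
qed simp

text \<open>Centering only lowers the second moments but doubles the uniform bound c, whence
  \<open>4 * c\<^sup>2\<close>. The raw second moments are what the envelope \<open>wgt\<close>
  controls.\<close>

lemma (in prob_space) sum_deviation_moments:
  fixes Y :: "'i \<Rightarrow> 'a \<Rightarrow> real"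
  assumes I: "finite I" and ind: "indep_vars (\<lambda>_. borel) Y I"
    and b: "\<And>i x. i \<in> I \<Longrightarrow> x \<in> space M \<Longrightarrow> \<bar>Y i x\<bar> \<le> c"
    and v: "(\<Sum>i\<in>I. expectation (\<lambda>x. (Y i x)\<^sup>2)) \<le> v"
  defines "D \<equiv> \<lambda>x. (\<Sum>i\<in>I. Y i x) - (\<Sum>i\<in>I. expectation (Y i))"
  shows "(\<integral>\<^sup>+x. ennreal ((D x)\<^sup>2) \<partial>M) \<le> ennreal v"
    and "(\<integral>\<^sup>+x. ennreal ((D x)^4) \<partial>M) \<le> ennreal (3 * v\<^sup>2 + 4 * c\<^sup>2 * v)"
proof -
  define Z where "Z = (\<lambda>i x. Y i x - expectation (Y i))"
  have rv [measurable]: "random_variable borel (Y j)" if "j \<in> I" for j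
    using ind that unfolding indep_vars_def by auto
  have iY: "integrable M (Y i)" if "i \<in> I" for i
    using integrable_bounded[OF rv b] that by auto
  have eb: "\<bar>expectation (Y i)\<bar> \<le> c" if "i \<in> I" for i
    using expectation_abs_le[OF rv b] that by auto
  have Zb: "\<bar>Z i x\<bar> \<le> 2 * c" if "i \<in> I" "x \<in> space M" for i x
    unfolding Z_def using b[OF that] eb[OF that(1)] by linarith
  have D: "D x = (\<Sum>i\<in>I. Z i x)" for x
    by (simp add: D_def Z_def sum_subtractf)
  have indZ: "indep_vars (\<lambda>_. borel) Z I"
    unfolding Z_def using indep_vars_compose2[OF ind, of "\<lambda>i y. y - expectation (Y i)" "\<lambda>_. borel"] by simp
  have EZ: "expectation (Z i) = 0" if "i \<in> I" for i
    unfolding Z_def using iY[OF that] by (simp add: prob_space)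
  have varZ: "expectation (\<lambda>x. (Z i x)\<^sup>2) \<le> expectation (\<lambda>x. (Y i x)\<^sup>2)" if i: "i \<in> I" for i
  proof -
    have "integrable M (\<lambda>x. (Y i x)\<^sup>2)"
      using rv[OF i] b[OF i] by (intro integrable_bounded[of _ "c\<^sup>2"]) (auto simp: abs_le_square_iff[symmetric] intro: order_trans[OF _ abs_ge_self])
    then show ?thesis
      unfolding Z_def using variance_eq[OF iY[OF i]] by simp
  qed
  define s where "s = (\<Sum>i\<in>I. expectation (\<lambda>x. (Z i x)\<^sup>2))"
  have s: "0 \<le> s" "s \<le> v"
    unfolding s_def using order_trans[OF sum_mono[OF varZ] v] by (auto intro!: sum_nonneg integral_nonneg)
  have Db: "\<bar>D x\<bar> \<le> real (card I) * (2 * c)" if "x \<in> space M" for x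
    unfolding D using Zb that
    by (intro order_trans[OF sum_abs]) (metis (mono_tags, lifting) sum_bounded_above)
  have Dm [measurable]: "random_variable borel D"
    unfolding D_def using rv by auto
  have Dpow: "integrable M (\<lambda>x. D x ^ k)" for k
    using Db by (intro integrable_bounded[of _ "(real (card I) * (2 * c)) ^ k"]) (auto simp: power_abs intro: power_mono)
  note m = centered_sum_moments[OF I indZ Zb EZ, folded s_def D]
  have "(\<integral>\<^sup>+x. ennreal ((D x)\<^sup>2) \<partial>M) = ennreal (expectation (\<lambda>x. (D x)\<^sup>2))"
    by (intro nn_integral_eq_integral Dpow) auto
  also have "\<dots> \<le> ennreal v"
    using m s by (intro ennreal_leI) auto
  finally show "(\<integral>\<^sup>+x. ennreal ((D x)\<^sup>2) \<partial>M) \<le> ennreal v" .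
  have "(\<integral>\<^sup>+x. ennreal ((D x)^4) \<partial>M) = ennreal (expectation (\<lambda>x. (D x)^4))"
    by (intro nn_integral_eq_integral Dpow) auto
  also have "\<dots> \<le> ennreal (3 * s\<^sup>2 + (2 * c)\<^sup>2 * s)"
    using m by (intro ennreal_leI) auto
  also have "\<dots> \<le> ennreal (3 * v\<^sup>2 + 4 * c\<^sup>2 * v)"
    using s by (intro ennreal_leI add_mono mult_mono) auto
  finally show "(\<integral>\<^sup>+x. ennreal ((D x)^4) \<partial>M) \<le> ennreal (3 * v\<^sup>2 + 4 * c\<^sup>2 * v)" .
qed

section \<open>Kernel estimates of the marginal density\<close>

text \<open>On the product space restriction to the index set is the identity, so the joint law of
  the coordinates is the product of their marginal laws.\<close>

lemma indep_vars_coordinates: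
  assumes N: "\<And>i. i \<in> I \<Longrightarrow> prob_space (N i)" and I: "I \<noteq> {}"
  shows "prob_space.indep_vars (PiM I N) N (\<lambda>i X. X i) I"
proof -
  interpret prob_space "PiM I N" using N by (rule prob_space_PiM)
  have "distr (PiM I N) (PiM I N) (\<lambda>X. \<lambda>i\<in>I. X i) = distr (PiM I N) (PiM I N) (\<lambda>X. X)"
    by (rule distr_cong) (auto simp: space_PiM PiE_def extensional_restrict)
  moreover have "PiM I (\<lambda>i. distr (PiM I N) (N i) (\<lambda>X. X i)) = PiM I N"
    by (rule PiM_cong) (use N in \<open>auto simp: distr_PiM_component\<close>)
  ultimately show ?thesis
    by (subst indep_vars_iff_distr_eq_PiM'[OF I]) auto
qed

abbreviation Nrm :: "real \<Rightarrow> real measure" where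
  "Nrm \<mu> \<equiv> density lborel (normal_density \<mu> 1)"

lemma normal_density_gd: "normal_density \<mu> 1 x = gd (x - \<mu>)"
  by (simp add: normal_density_def)

lemma prob_space_Nrm [simp]: "prob_space (Nrm \<mu>)"
  by (rule prob_space_normal_density) simp

lemma nn_integral_Nrm:
  "h \<in> borel_measurable borel \<Longrightarrow> (\<integral>\<^sup>+x. h x \<partial>Nrm \<mu>) = (\<integral>\<^sup>+x. ennreal (gd (x - \<mu>)) * h x \<partial>lborel)"
  by (subst nn_integral_density) (auto simp: normal_density_gd[of \<mu>])

lemma nn_integral_gd: "(\<integral>\<^sup>+x. ennreal (gd (x - \<mu>)) \<partial>lborel) = 1"
  using prob_space.emeasure_space_1[OF prob_space_Nrm[of \<mu>]]
  by (simp add: emeasure_density normal_density_gd[of \<mu>])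

lemma integral_Nrm:
  fixes h :: "real \<Rightarrow> real"
  assumes [measurable]: "h \<in> borel_measurable borel"
  shows "(\<integral>x. h x \<partial>Nrm \<mu>) = (\<integral>z. gd z * h (\<mu> + z) \<partial>lborel)"
proof -
  have "(\<integral>x. h x \<partial>Nrm \<mu>) = (\<integral>x. gd (x - \<mu>) * h x \<partial>lborel)"
    by (subst integral_density) (auto simp: normal_density_gd[of \<mu>])
  also have "\<dots> = (\<integral>z. gd z * h (\<mu> + z) \<partial>lborel)"
    by (subst lborel_integral_real_affine[of 1 _ \<mu>]) auto
  finally show ?thesis .
qed

lemma nn_integral_Nrm_sq: "(\<integral>\<^sup>+x. ennreal ((x - \<mu>)\<^sup>2) \<partial>Nrm \<mu>) = 1"
proof -
  have "has_bochner_integral lborel (\<lambda>x. normal_density \<mu> 1 x * (x - \<mu>) ^ (2 * 1)) (fact (2 * 1) / ((2 / 1\<^sup>2) ^ 1 * fact 1))"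
    by (rule normal_moment_even) simp
  then have m: "has_bochner_integral lborel (\<lambda>x. gd (x - \<mu>) * (x - \<mu>)\<^sup>2) 1"
    by (simp add: normal_density_gd[of \<mu>] fact_numeral)
  have "(\<integral>\<^sup>+x. ennreal ((x - \<mu>)\<^sup>2) \<partial>Nrm \<mu>) = (\<integral>\<^sup>+x. ennreal (gd (x - \<mu>) * (x - \<mu>)\<^sup>2) \<partial>lborel)"
    by (subst nn_integral_Nrm) (auto simp: ennreal_mult)
  also have "\<dots> = 1"
    using m by (subst nn_integral_eq_integral) (auto simp: has_bochner_integral_iff)
  finally show ?thesis .
qed

lemma nn_integral_Nrm_4: "(\<integral>\<^sup>+x. ennreal ((x - \<mu>)^4) \<partial>Nrm \<mu>) = 3"
proof -
  have "has_bochner_integral lborel (\<lambda>x. normal_density \<mu> 1 x * (x - \<mu>) ^ (2 * 2)) (fact (2 * 2) / ((2 / 1\<^sup>2) ^ 2 * fact 2))"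
    by (rule normal_moment_even) simp
  then have m: "has_bochner_integral lborel (\<lambda>x. gd (x - \<mu>) * (x - \<mu>)^4) 3"
    by (simp add: normal_density_gd[of \<mu>] fact_numeral)
  have "(\<integral>\<^sup>+x. ennreal ((x - \<mu>)^4) \<partial>Nrm \<mu>) = (\<integral>\<^sup>+x. ennreal (gd (x - \<mu>) * (x - \<mu>)^4) \<partial>lborel)"
    by (subst nn_integral_Nrm) (auto simp: ennreal_mult)
  also have "\<dots> = ennreal 3"
    using m by (subst nn_integral_eq_integral) (auto simp: has_bochner_integral_iff)
  finally show ?thesis by simp
qed

lemma gd_mono: "\<bar>x\<bar> \<le> \<bar>y\<bar> \<Longrightarrow> gd y \<le> gd x"
proof -
  assume "\<bar>x\<bar> \<le> \<bar>y\<bar>"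
  then have "x\<^sup>2 \<le> y\<^sup>2" by (simp only: abs_le_square_iff)
  then show ?thesis unfolding gd_eq by (intro divide_right_mono) auto
qed

lemma le_ennreal_of_le_1: "x \<le> 1 \<Longrightarrow> 1 \<le> y \<Longrightarrow> x \<le> ennreal y"
  by (metis ennreal_1 ennreal_leI order_trans)

text \<open>\<open>- ((z + 1) * gd z)\<close> has derivative
  \<open>(z\<^sup>2 + z - 1) * gd z\<close>, which dominates \<open>z\<^sup>2 * gd z\<close> for
  \<open>z \<ge> 1\<close>. This gives a tail bound in closed form.\<close>

lemma gd_tail:
  assumes "t \<ge> 1"
  shows "(\<integral>\<^sup>+x. ennreal ((x - \<mu>)\<^sup>2) * indicator {x. t \<le> \<bar>x - \<mu>\<bar>} x \<partial>Nrm \<mu>) \<le> ennreal (2 * (t + 1) * gd t)"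
proof -
  define h where "h = (\<lambda>z. (z\<^sup>2 + z - 1) * gd z)"
  have lim: "((\<lambda>z. - ((z + 1) * gd z)) \<longlongrightarrow> 0) at_top"
    unfolding gd_eq by real_asymp
  have "((\<lambda>z. - ((z + 1) * (exp (- z\<^sup>2 / 2) / c))) has_real_derivative (z\<^sup>2 + z - 1) * (exp (- z\<^sup>2 / 2) / c)) (at z)" if "c \<noteq> 0" for z c :: real
    using that by (auto intro!: derivative_eq_intros simp: algebra_simps power2_eq_square add_divide_distrib diff_divide_distrib)
  then have der: "((\<lambda>z. - ((z + 1) * gd z)) has_real_derivative h z) (at z)" for z
    unfolding gd_eq h_def by simp
  have one: "(\<integral>\<^sup>+z. ennreal (z\<^sup>2 * gd z) * indicator {t..} z \<partial>lborel) \<le> ennreal ((t + 1) * gd t)"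
  proof -
    have "(\<integral>\<^sup>+z. ennreal (z\<^sup>2 * gd z) * indicator {t..} z \<partial>lborel) \<le> (\<integral>\<^sup>+z. ennreal (h z) * indicator {t..} z \<partial>lborel)"
      using assms by (intro nn_integral_mono) (auto simp: h_def split: split_indicator intro!: ennreal_leI mult_right_mono)
    also have "\<dots> = ennreal (0 - (- ((t + 1) * gd t)))"
    proof (rule nn_integral_FTC_atLeast[OF _ der _ lim])
      show "h \<in> borel_measurable borel" unfolding h_def by measurable
      show "0 \<le> h x" if "t \<le> x" for x
        using that assms zero_le_power2[of x] unfolding h_def by (intro mult_nonneg_nonneg) (linarith, simp)
    qed
    finally show ?thesis by simp
  qed
  have "(\<integral>\<^sup>+x. ennreal ((x - \<mu>)\<^sup>2) * indicator {x. t \<le> \<bar>x - \<mu>\<bar>} x \<partial>Nrm \<mu>) =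
      (\<integral>\<^sup>+x. ennreal (gd (x - \<mu>)) * (ennreal ((x - \<mu>)\<^sup>2) * indicator {x. t \<le> \<bar>x - \<mu>\<bar>} x) \<partial>lborel)"
    by (rule nn_integral_Nrm) measurable
  also have "\<dots> = (\<integral>\<^sup>+z. ennreal (gd z) * (ennreal (z\<^sup>2) * indicator {z. t \<le> \<bar>z\<bar>} z) \<partial>lborel)"
    by (subst nn_integral_real_affine[where c = 1 and t = \<mu>]) (auto simp: indicator_def)
  also have "\<dots> = (\<integral>\<^sup>+z. ennreal (z\<^sup>2 * gd z) * indicator {t..} z + ennreal ((-z)\<^sup>2 * gd (-z)) * indicator {t..} (-z) \<partial>lborel)"
    using assms by (intro nn_integral_cong) (auto simp: gd_eq mult.commute split: split_indicator simp flip: ennreal_mult)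
  also have "\<dots> = (\<integral>\<^sup>+z. ennreal (z\<^sup>2 * gd z) * indicator {t..} z \<partial>lborel) + (\<integral>\<^sup>+z. ennreal ((-z)\<^sup>2 * gd (-z)) * indicator {t..} (-z) \<partial>lborel)"
    by (rule nn_integral_add) measurable
  also have "(\<integral>\<^sup>+z. ennreal ((-z)\<^sup>2 * gd (-z)) * indicator {t..} (-z) \<partial>lborel) = (\<integral>\<^sup>+z. ennreal (z\<^sup>2 * gd z) * indicator {t..} z \<partial>lborel)"
    using nn_integral_lborel_uminus[of "\<lambda>z. ennreal (z\<^sup>2 * gd z) * indicator {t..} z"] by simp
  also have "(\<integral>\<^sup>+z. ennreal (z\<^sup>2 * gd z) * indicator {t..} z \<partial>lborel) + (\<integral>\<^sup>+z. ennreal (z\<^sup>2 * gd z) * indicator {t..} z \<partial>lborel) \<le> ennreal ((t + 1) * gd t) + ennreal ((t + 1) * gd t)"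
    by (intro add_mono one)
  also have "\<dots> = ennreal (2 * (t + 1) * gd t)"
    using assms by (simp add: algebra_simps flip: ennreal_plus)
  finally show ?thesis .
qed

context finite_block
begin

text \<open>Law of the observations of the block after division by \<epsilon>, when
  \<open>\<theta> i = \<beta> i / \<epsilon>\<close>.\<close>

definition P :: "(nat \<Rightarrow> real) measure" where "P = PiM B (\<lambda>i. Nrm (\<theta> i))"

abbreviation "total_risk l \<equiv> \<Sum>k\<in>B. \<integral>\<^sup>+X. ennreal (l k X) \<partial>P"

lemma prob_space_P: "prob_space P"
  unfolding P_def by (rule prob_space_PiM) simp

sublocale P: prob_space P by (rule prob_space_P)

lemma sets_P [measurable_cong]: "sets P = sets (PiM B (\<lambda>_. borel))"
  unfolding P_def by (rule sets_PiM_cong) auto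

lemma coord_measurable: "k \<in> B \<Longrightarrow> (\<lambda>X. X k) \<in> borel_measurable P"
  by measurable

lemma distr_coord: "k \<in> B \<Longrightarrow> distr P borel (\<lambda>X. X k) = Nrm (\<theta> k)"
proof -
  assume k: "k \<in> B"
  have "distr P borel (\<lambda>X. X k) = distr P (Nrm (\<theta> k)) (\<lambda>X. X k)"
    by (rule distr_cong) auto
  also have "\<dots> = Nrm (\<theta> k)"
    unfolding P_def using distr_PiM_component[of B "\<lambda>i. Nrm (\<theta> i)" k] k by simp
  finally show ?thesis .
qed

lemma nn_integral_coord:
  assumes "k \<in> B" "h \<in> borel_measurable borel"
  shows "(\<integral>\<^sup>+X. h (X k) \<partial>P) = (\<integral>\<^sup>+x. h x \<partial>Nrm (\<theta> k))"
  using nn_integral_distr[of "\<lambda>X. X k" P borel h] assms coord_measurable by (simp add: distr_coord)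

lemma integral_coord:
  fixes h :: "real \<Rightarrow> real"
  assumes "k \<in> B" "h \<in> borel_measurable borel"
  shows "(\<integral>X. h (X k) \<partial>P) = (\<integral>z. gd z * h (\<theta> k + z) \<partial>lborel)"
  using integral_distr[of "\<lambda>X. X k" P borel h] assms coord_measurable by (simp add: distr_coord integral_Nrm)

lemma indep_coord:
  assumes "\<And>k. k \<in> B \<Longrightarrow> h k \<in> borel_measurable borel"
  shows "P.indep_vars (\<lambda>_. borel) (\<lambda>k X. h k (X k)) B"
proof -
  have "P.indep_vars (\<lambda>i. Nrm (\<theta> i)) (\<lambda>k X. X k) B"
    using indep_vars_coordinates[of B "\<lambda>i. Nrm (\<theta> i)"] ne by (simp add: P_def)
  then show ?thesis
    by (rule P.indep_vars_compose2) (use assms in auto)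
qed

end

text \<open>
  The factor \<open>r\<close> stands for \<open>(1 + \<eta>\<^sub>n) \<rho>\<^sub>0\<close>. The bounds \<open>r1\<close> and \<open>r2\<close> are parameters of their own because the
  constants below may depend on them, but not on \<open>n\<close> or \<open>r\<close>.
\<close>

locale geb_block = finite_block +
  fixes a r r1 r2 \<rho> :: real
  assumes card3: "card B \<ge> 3" and r: "0 < r1" "r1 \<le> r" "r \<le> r2"
  defines "a \<equiv> sqrt (2 * ln n)" and "\<rho> \<equiv> r * a / sqrt n"
begin

lemma n3: "n \<ge> 3"
  using card3 by (simp add: n_def)

lemma ln_n: "ln n \<ge> 1"
proof -
  have "exp 1 \<le> (3::real)" by (rule exp_le)
  also have "\<dots> \<le> n" by (rule n3)
  finally show ?thesis using n_pos by (subst ln_ge_iff) auto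
qed

lemma a_sq: "a\<^sup>2 = 2 * ln n"
  using ln_n by (simp add: a_def)

lemma a_ge: "a \<ge> 1" "a\<^sup>2 \<ge> 2" "a > 0" "a \<ge> 0"
proof -
  show "a\<^sup>2 \<ge> 2" using a_sq ln_n by simp
  show "a \<ge> 1" using ln_n unfolding a_def by simp
  then show "a > 0" "a \<ge> 0" by auto
qed

lemma a_le: "a \<le> n"
proof -
  have "a\<^sup>2 \<le> 2 * (n - 1)"
    using ln_le_minus_one[of n] n_pos by (simp add: a_sq)
  also have "\<dots> \<le> n\<^sup>2"
    using sum_squares_ge_zero[of "n - 1" 1] by (simp add: power2_eq_square algebra_simps)
  finally show ?thesis using n_pos by (simp add: power2_le_iff_abs_le)
qed

lemma exp_a: "exp (- a\<^sup>2 / 2) = 1 / n"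
  using n_pos by (simp add: a_sq exp_minus field_simps)

lemma rho_pos: "\<rho> > 0" "r > 0"
proof -
  show "r > 0" using r by simp
  then show "\<rho> > 0" using a_ge n_pos by (simp add: \<rho>_def)
qed

text \<open>Chosen such that \<open>ln (1 / \<rho>)\<close> and the additive constants of
  \<open>score_le\<close> fit under \<open>lam * a\<^sup>2\<close>. It depends on \<open>r1\<close>
  alone.\<close>

definition "lam = 3 + 2 * max 0 (ln (1 / r1))"

lemma lam: "lam \<ge> 3"
  by (simp add: lam_def)

lemma lam_a: "2 * (max 0 (ln (1 / \<rho>)) + 1) \<le> lam * a\<^sup>2"
proof -
  define l where "l = max 0 (ln (1 / r1))"
  have l: "l \<ge> 0" by (simp add: l_def)
  have "1 / \<rho> = (1 / r) * (sqrt n * (1 / a))"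
    by (simp add: \<rho>_def)
  also have "ln \<dots> = ln (1 / r) + (ln n / 2 - ln a)"
    using rho_pos n_pos a_ge by (simp add: ln_mult ln_div ln_sqrt)
  also have "\<dots> \<le> l + a\<^sup>2 / 4"
  proof -
    have "ln (1 / r) \<le> ln (1 / r1)"
      using r by (subst ln_le_cancel_iff) (auto intro: frac_le)
    moreover have "ln a \<ge> 0" using a_ge by simp
    ultimately show ?thesis by (simp add: l_def a_sq)
  qed
  finally have "2 * (max 0 (ln (1 / \<rho>)) + 1) \<le> 2 * l + a\<^sup>2 / 2 + 2"
    using l a_ge by auto
  also have "\<dots> \<le> (3 + 2 * l) * a\<^sup>2"
    using a_ge(2) l mult_left_mono[of 2 "a\<^sup>2" l] by (simp add: algebra_simps)
  finally show ?thesis by (simp add: lam_def l_def)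
qed

lemma score_le_a: "(f' x / max \<rho> (f x))\<^sup>2 \<le> lam * a\<^sup>2"
  using score_le[OF rho_pos(1), of x] lam_a by linarith

lemma g_le_a: "g x \<le> max \<rho> (f x) * (lam * a\<^sup>2)"
proof -
  have "g x \<le> max \<rho> (f x) * (2 * (max 0 (ln (1 / \<rho>)) + 1))"
    using g_le_max[OF rho_pos(1), of x] by (simp only: mult_ac)
  also have "\<dots> \<le> max \<rho> (f x) * (lam * a\<^sup>2)"
    using lam_a rho_pos by (intro mult_left_mono) auto
  finally show ?thesis .
qed

definition phat :: "(nat \<Rightarrow> real) \<Rightarrow> real \<Rightarrow> real" where
  "phat X x = (\<Sum>k\<in>B. kern a (x - X k) / n)"

definition phat' :: "(nat \<Rightarrow> real) \<Rightarrow> real \<Rightarrow> real" where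
  "phat' X x = (\<Sum>k\<in>B. kern' a (x - X k) / n)"

lemma geb_phi_eq: "geb_phi B X x = phat X x"
  by (simp add: geb_phi_def phat_def kern_def a_def n_def sum_divide_distrib)

lemma deriv_geb_phi: "deriv (geb_phi B X) x = phat' X x"
proof -
  have "geb_phi B X = phat X" by (rule ext) (rule geb_phi_eq)
  moreover have "(phat X has_real_derivative phat' X x) (at x)"
    unfolding phat_def[abs_def] phat'_def
    using n_pos by (auto intro!: derivative_eq_intros sum.cong)
  ultimately show ?thesis by (simp add: DERIV_imp_deriv)
qed

text \<open>All deviation moments at x are bounded by multiples of this averaged envelope. Its
  integral \<open>pi / a\<close> saves a factor a against the heights of the kernels, and its
  supremum \<open>2 / a\<close> turns a squared variance into a multiple of
  \<open>kmass x\<close>.\<close>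

definition kmass :: "real \<Rightarrow> real" where
  "kmass x = (\<Sum>k\<in>B. P.expectation (\<lambda>X. wgt a (x - X k))) / n"

lemma wgt_expectation:
  assumes "k \<in> B"
  shows "ennreal (P.expectation (\<lambda>X. wgt a (x - X k))) = (\<integral>\<^sup>+X. ennreal (wgt a (x - X k)) \<partial>P)"
    "P.expectation (\<lambda>X. wgt a (x - X k)) \<ge> 0"
    "P.expectation (\<lambda>X. wgt a (x - X k)) \<le> 2 / a"
    "integrable P (\<lambda>X. wgt a (x - X k))"
proof -
  have [measurable]: "(\<lambda>X. X k) \<in> borel_measurable P" using assms by (rule coord_measurable)
  show i: "integrable P (\<lambda>X. wgt a (x - X k))"
    using wgt_pos by (intro P.integrable_bounded[of _ 1]) (auto simp: less_imp_le)
  show eq: "ennreal (P.expectation (\<lambda>X. wgt a (x - X k))) = (\<integral>\<^sup>+X. ennreal (wgt a (x - X k)) \<partial>P)"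
    using wgt_pos by (intro nn_integral_eq_integral[symmetric] i) (auto simp: less_imp_le)
  show pos: "P.expectation (\<lambda>X. wgt a (x - X k)) \<ge> 0"
    by (intro Bochner_Integration.integral_nonneg less_imp_le wgt_pos)
  have "(\<integral>\<^sup>+X. ennreal (wgt a (x - X k)) \<partial>P) = (\<integral>\<^sup>+y. ennreal (gd (y - \<theta> k)) * ennreal (wgt a (x - y)) \<partial>lborel)"
    using nn_integral_coord[OF assms, of "\<lambda>y. ennreal (wgt a (x - y))"] by (simp add: nn_integral_Nrm)
  also have "\<dots> \<le> (\<integral>\<^sup>+y. ennreal (1 / 2) * ennreal (wgt a (y - x)) \<partial>lborel)"
    by (intro nn_integral_mono mult_mono ennreal_leI gd_le) (auto simp: wgt_def power2_commute[of "a * x"] right_diff_distrib)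
  also have "\<dots> = ennreal (1 / 2) * ennreal (pi / a)"
    by (subst nn_integral_cmult) (auto simp: nn_integral_wgt a_ge)
  also have "\<dots> = ennreal (1 / 2 * (pi / a))"
    using a_ge by (intro ennreal_mult[symmetric]) auto
  also have "\<dots> \<le> ennreal (2 / a)"
    using a_ge pi_less_4 by (intro ennreal_leI) (simp add: divide_simps)
  finally show "P.expectation (\<lambda>X. wgt a (x - X k)) \<le> 2 / a"
    using a_ge by (simp flip: eq)
qed

lemma kmass_bounds: "kmass x \<ge> 0" "kmass x \<le> 2 / a"
proof -
  show "kmass x \<ge> 0"
    unfolding kmass_def using n_pos by (intro divide_nonneg_nonneg sum_nonneg wgt_expectation) auto
  have "(\<Sum>k\<in>B. P.expectation (\<lambda>X. wgt a (x - X k))) \<le> (\<Sum>k\<in>B. 2 / a)"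
    by (intro sum_mono wgt_expectation)
  then show "kmass x \<le> 2 / a"
    unfolding kmass_def using n_pos by (simp add: n_def field_simps)
qed

lemma kmass_eq: "ennreal (kmass x) = ennreal (1 / n) * (\<Sum>k\<in>B. \<integral>\<^sup>+X. ennreal (wgt a (x - X k)) \<partial>P)"
proof -
  have "(\<Sum>k\<in>B. \<integral>\<^sup>+X. ennreal (wgt a (x - X k)) \<partial>P) = (\<Sum>k\<in>B. ennreal (P.expectation (\<lambda>X. wgt a (x - X k))))"
    by (intro sum.cong refl wgt_expectation(1)[symmetric])
  also have "\<dots> = ennreal (\<Sum>k\<in>B. P.expectation (\<lambda>X. wgt a (x - X k)))"
    by (intro sum_ennreal wgt_expectation)
  finally show ?thesis
    using n_pos by (simp add: kmass_def wgt_expectation sum_nonneg flip: ennreal_mult)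
qed

lemma kmass_borel [measurable]: "kmass \<in> borel_measurable borel"
  unfolding kmass_def[abs_def] by measurable

lemma nn_integral_kmass: "(\<integral>\<^sup>+x. ennreal (kmass x) \<partial>lborel) = ennreal (pi / a)"
proof -
  interpret PL: pair_sigma_finite P lborel ..
  have "(\<integral>\<^sup>+x. ennreal (kmass x) \<partial>lborel) = ennreal (1 / n) * (\<Sum>k\<in>B. \<integral>\<^sup>+x. \<integral>\<^sup>+X. ennreal (wgt a (x - X k)) \<partial>P \<partial>lborel)"
    unfolding kmass_eq by (subst nn_integral_cmult, measurable) (subst nn_integral_sum, measurable)
  also have "(\<Sum>k\<in>B. \<integral>\<^sup>+x. \<integral>\<^sup>+X. ennreal (wgt a (x - X k)) \<partial>P \<partial>lborel) = (\<Sum>k\<in>B. \<integral>\<^sup>+X. \<integral>\<^sup>+x. ennreal (wgt a (x - X k)) \<partial>lborel \<partial>P)"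
    by (intro sum.cong refl PL.Fubini') measurable
  also have "\<dots> = (\<Sum>k\<in>B. ennreal (pi / a))"
    using a_ge by (simp add: nn_integral_wgt P.emeasure_space_1)
  also have "ennreal (1 / n) * \<dots> = ennreal (pi / a)"
    using n_pos a_ge by (simp add: n_def ennreal_of_nat_eq_real_of_nat flip: ennreal_mult)
  finally show ?thesis .
qed

definition mean0 :: "real \<Rightarrow> real" where "mean0 x = (\<Sum>k\<in>B. P.expectation (\<lambda>X. kern a (x - X k) / n))"
definition mean1 :: "real \<Rightarrow> real" where "mean1 x = (\<Sum>k\<in>B. P.expectation (\<lambda>X. kern' a (x - X k) / n))"

lemma bias: "\<bar>mean0 x - f x\<bar> \<le> 1 / n" "\<bar>mean1 x - f' x\<bar> \<le> 1 / n"
proof -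
  have gen: "\<bar>(\<Sum>k\<in>B. P.expectation (\<lambda>X. K (x - X k) / n)) - (\<Sum>k\<in>B. h (x - \<theta> k)) / n\<bar> \<le> 1 / n"
    if [measurable]: "K \<in> borel_measurable borel"
      and b: "\<And>u. \<bar>(\<integral>z. gd z * K (u - z) \<partial>lborel) - h u\<bar> \<le> exp (- a\<^sup>2 / 2)" for K h :: "real \<Rightarrow> real"
  proof -
    have e: "P.expectation (\<lambda>X. K (x - X k) / n) = (\<integral>z. gd z * K (x - \<theta> k - z) \<partial>lborel) / n" if "k \<in> B" for k
      using integral_coord[OF that, of "\<lambda>y. K (x - y) / n"] by (simp add: diff_diff_eq)
    have se: "(\<Sum>k\<in>B. P.expectation (\<lambda>X. K (x - X k) / n)) = (\<Sum>k\<in>B. (\<integral>z. gd z * K (x - \<theta> k - z) \<partial>lborel) / n)"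
      by (intro sum.cong refl e)
    define d where "d = (\<lambda>k. ((\<integral>z. gd z * K (x - \<theta> k - z) \<partial>lborel) - h (x - \<theta> k)) / n)"
    have "(\<Sum>k\<in>B. P.expectation (\<lambda>X. K (x - X k) / n)) - (\<Sum>k\<in>B. h (x - \<theta> k)) / n = sum d B"
      unfolding se d_def by (simp add: sum_subtractf diff_divide_distrib sum_divide_distrib)
    moreover have "\<bar>sum d B\<bar> \<le> (\<Sum>k\<in>B. \<bar>d k\<bar>)"
      by (rule sum_abs)
    moreover have "(\<Sum>k\<in>B. \<bar>d k\<bar>) \<le> (\<Sum>k\<in>B. (1 / n) / n)"
    proof (rule sum_mono)
      show "\<bar>d k\<bar> \<le> (1 / n) / n" for k
        using divide_right_mono[OF b[of "x - \<theta> k", unfolded exp_a], of n] n_pos by (simp add: d_def)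
    qed
    moreover have "(\<Sum>k\<in>B. (1 / n) / n) = 1 / n"
      using n_pos by (simp add: n_def)
    ultimately show ?thesis by linarith
  qed
  show "\<bar>mean0 x - f x\<bar> \<le> 1 / n"
    unfolding mean0_def mix_def n_def[symmetric]
    using gen[of "kern a" gd] kern_bias(1)[OF a_ge(1)] by simp
  show "\<bar>mean1 x - f' x\<bar> \<le> 1 / n"
    unfolding mean1_def mix'_def n_def[symmetric]
    using gen[of "kern' a" "\<lambda>u. - u * gd u"] kern_bias(2)[OF a_ge(1)] by simp
qed

lemma deviation_moments:
  shows "(\<integral>\<^sup>+X. ennreal ((phat X x - mean0 x)\<^sup>2) \<partial>P) \<le> ennreal (a\<^sup>2 / n * kmass x)"
    and "(\<integral>\<^sup>+X. ennreal ((phat X x - mean0 x)^4) \<partial>P) \<le> ennreal (10 * a^3 / n\<^sup>2 * kmass x)"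
    and "(\<integral>\<^sup>+X. ennreal ((phat' X x - mean1 x)\<^sup>2) \<partial>P) \<le> ennreal (a^4 / n * kmass x)"
    and "(\<integral>\<^sup>+X. ennreal ((phat' X x - mean1 x)^4) \<partial>P) \<le> ennreal (10 * a^7 / n\<^sup>2 * kmass x)"
proof -
  have gen: "(\<integral>\<^sup>+X. ennreal (((\<Sum>k\<in>B. K (x - X k) / n) - (\<Sum>k\<in>B. P.expectation (\<lambda>X. K (x - X k) / n)))\<^sup>2) \<partial>P) \<le> ennreal (b\<^sup>2 / n * kmass x)"
    "(\<integral>\<^sup>+X. ennreal (((\<Sum>k\<in>B. K (x - X k) / n) - (\<Sum>k\<in>B. P.expectation (\<lambda>X. K (x - X k) / n)))^4) \<partial>P) \<le> ennreal (10 * b^4 / (a * n\<^sup>2) * kmass x)"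
    if K [measurable]: "K \<in> borel_measurable borel" and b: "\<And>u. \<bar>K u\<bar> \<le> b" "\<And>u. (K u)\<^sup>2 \<le> b\<^sup>2 * wgt a u"
    for K :: "real \<Rightarrow> real" and b
  proof -
    have b0: "b \<ge> 0" using b(1)[of 0] by simp
    have ind: "P.indep_vars (\<lambda>_. borel) (\<lambda>k X. K (x - X k) / n) B"
      using indep_coord[of "\<lambda>k y. K (x - y) / n"] by simp
    have bd: "\<bar>K (x - X k) / n\<bar> \<le> b / n" for X and k :: nat
      using b(1)[of "x - X k"] n_pos by (simp add: divide_right_mono)
    have v: "(\<Sum>k\<in>B. P.expectation (\<lambda>X. (K (x - X k) / n)\<^sup>2)) \<le> b\<^sup>2 / n * kmass x"
    proof -
      have "(\<Sum>k\<in>B. P.expectation (\<lambda>X. (K (x - X k) / n)\<^sup>2)) \<le> (\<Sum>k\<in>B. P.expectation (\<lambda>X. b\<^sup>2 / n\<^sup>2 * wgt a (x - X k)))"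
      proof (intro sum_mono integral_mono)
        fix k assume k: "k \<in> B"
        have [measurable]: "(\<lambda>X. X k) \<in> borel_measurable P" using k by (rule coord_measurable)
        show "integrable P (\<lambda>X. (K (x - X k) / n)\<^sup>2)"
        proof (rule P.integrable_bounded[of _ "(b / n)\<^sup>2"])
          show "\<bar>(K (x - X k) / n)\<^sup>2\<bar> \<le> (b / n)\<^sup>2" for X
            using power_mono[OF bd[of X k] abs_ge_zero, where n = 2] by (simp only: power2_abs abs_power2)
        qed measurable
        show "integrable P (\<lambda>X. b\<^sup>2 / n\<^sup>2 * wgt a (x - X k))"
          using wgt_expectation(4)[OF k] by simp
        show "(K (x - X k) / n)\<^sup>2 \<le> b\<^sup>2 / n\<^sup>2 * wgt a (x - X k)" for X
          using b(2)[of "x - X k"] n_pos by (simp add: power_divide divide_right_mono)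
      qed
      also have "\<dots> = b\<^sup>2 / n\<^sup>2 * (\<Sum>k\<in>B. P.expectation (\<lambda>X. wgt a (x - X k)))"
        by (simp only: sum_distrib_left integral_mult_right_zero)
      also have "\<dots> = b\<^sup>2 / n * kmass x"
        by (simp add: kmass_def power2_eq_square)
      finally show ?thesis .
    qed
    show "(\<integral>\<^sup>+X. ennreal (((\<Sum>k\<in>B. K (x - X k) / n) - (\<Sum>k\<in>B. P.expectation (\<lambda>X. K (x - X k) / n)))\<^sup>2) \<partial>P) \<le> ennreal (b\<^sup>2 / n * kmass x)"
      by (rule P.sum_deviation_moments(1)[where c = "b / n", OF fin ind _ v]) (rule bd)
    \<comment> \<open>One factor \<open>kmass x\<close> is kept for the integration over x. The
      other is at most \<open>2 / a\<close>, and \<open>1 / n\<close> is at most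
      \<open>1 / a\<close>, so the constant is \<open>3 * 2 + 4 = 10\<close>.\<close>
    have "3 * (b\<^sup>2 / n * kmass x)\<^sup>2 + 4 * (b / n)\<^sup>2 * (b\<^sup>2 / n * kmass x) = b^4 / n\<^sup>2 * kmass x * (3 * kmass x + 4 * (1 / n))"
      using n_pos by (simp add: power2_eq_square power4_eq_xxxx field_simps)
    also have "\<dots> \<le> b^4 / n\<^sup>2 * kmass x * (3 * (2 / a) + 4 * (1 / a))"
      using kmass_bounds[of x] a_le a_ge by (intro mult_left_mono add_mono) (auto intro: frac_le)
    also have "\<dots> = 10 * b^4 / (a * n\<^sup>2) * kmass x"
      using a_ge n_pos by (simp add: field_simps)
    finally show "(\<integral>\<^sup>+X. ennreal (((\<Sum>k\<in>B. K (x - X k) / n) - (\<Sum>k\<in>B. P.expectation (\<lambda>X. K (x - X k) / n)))^4) \<partial>P) \<le> ennreal (10 * b^4 / (a * n\<^sup>2) * kmass x)"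
      by (intro order_trans[OF P.sum_deviation_moments(2)[where c = "b / n", OF fin ind _ v]] ennreal_leI) (rule bd)
  qed
  note k = kern_bounds[OF a_ge(4)]
  have 4: "(a\<^sup>2)\<^sup>2 = a^4" "(a\<^sup>2)^4 = a^8" by (simp_all flip: power_mult)
  have "10 * a^4 / (a * n\<^sup>2) = 10 * a^3 / n\<^sup>2" "10 * a^8 / (a * n\<^sup>2) = 10 * a^7 / n\<^sup>2"
    using a_ge n_pos by (simp_all add: eval_nat_numeral)
  with gen[of "kern a" a] gen[of "kern' a" "a\<^sup>2"] k
  show "(\<integral>\<^sup>+X. ennreal ((phat X x - mean0 x)\<^sup>2) \<partial>P) \<le> ennreal (a\<^sup>2 / n * kmass x)"
    and "(\<integral>\<^sup>+X. ennreal ((phat X x - mean0 x)^4) \<partial>P) \<le> ennreal (10 * a^3 / n\<^sup>2 * kmass x)"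
    and "(\<integral>\<^sup>+X. ennreal ((phat' X x - mean1 x)\<^sup>2) \<partial>P) \<le> ennreal (a^4 / n * kmass x)"
    and "(\<integral>\<^sup>+X. ennreal ((phat' X x - mean1 x)^4) \<partial>P) \<le> ennreal (10 * a^7 / n\<^sup>2 * kmass x)"
    unfolding phat_def phat'_def mean0_def mean1_def by (auto simp: 4)
qed

end

section \<open>Regret of the estimated score\<close>

text \<open>
  The point is the exponent of \<open>\<rho>\<close> in the leading term. It comes from \<open>F \<le> max \<rho> p0 + \<bar>p0 - mean0\<bar> + \<delta>\<close>, which
  cancels one of the two denominators without any concentration inequality for \<open>p0\<close>.
\<close>

lemma regularized_score_error:
  fixes F F1 p0 p1 mean0 mean1 \<rho> \<Lambda> \<delta> \<kappa> :: real
  assumes \<rho>: "\<rho> > 0" and F: "F > 0" and \<Lambda>: "\<Lambda> > 0" "(F1 / max \<rho> F)\<^sup>2 \<le> \<Lambda>"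
    and b: "\<bar>mean0 - F\<bar> \<le> \<delta>" "\<bar>mean1 - F1\<bar> \<le> \<delta>" "\<delta> \<le> \<kappa> * \<rho>"
  shows "F * (p1 / max \<rho> p0 - F1 / max \<rho> F)\<^sup>2 \<le>
      (6 + 4 * \<kappa>) / \<rho> * ((p1 - mean1)\<^sup>2 + \<Lambda> * (p0 - mean0)\<^sup>2)
      + ((p1 - mean1)^4 / \<Lambda> + 3 * \<Lambda> * (p0 - mean0)^4) / \<rho>^3 + 4 * (1 + \<Lambda>) * \<delta>\<^sup>2 / \<rho>\<^sup>2 * F"
proof -
  define m where "m = max \<rho> p0"
  define M where "M = max \<rho> F"
  define s where "s = F1 / M"
  define D where "D = p0 - mean0"
  define D1 where "D1 = p1 - mean1"
  define Q where "Q = D1\<^sup>2 + \<Lambda> * D\<^sup>2"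
  define \<beta> where "\<beta> = (1 + \<Lambda>) * \<delta>\<^sup>2"
  have m: "m \<ge> \<rho>" "m \<ge> p0" "m > 0" and M: "M > 0" using \<rho> by (auto simp: m_def M_def)
  have \<delta>: "\<delta> \<ge> 0" using b by linarith
  have Q0: "Q \<ge> 0" "\<beta> \<ge> 0" using \<Lambda> by (auto simp: Q_def \<beta>_def)
  \<comment> \<open>In this form the error of the denominator is multiplied by the bounded score
    \<open>s\<close> and not by the estimated ratio.\<close>
  have "p1 / m - s = ((p1 - F1) + s * (M - m)) / m"
    using m M by (simp add: s_def field_simps)
  then have "(p1 / m - s)\<^sup>2 = ((p1 - F1) + s * (M - m))\<^sup>2 / m\<^sup>2"
    by (simp add: power_divide)
  also have "\<dots> \<le> (2 * (p1 - F1)\<^sup>2 + 2 * (\<Lambda> * (p0 - F)\<^sup>2)) / m\<^sup>2"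
  proof (rule divide_right_mono)
    have "\<bar>M - m\<bar> \<le> \<bar>p0 - F\<bar>" by (auto simp: M_def m_def)
    then have "(M - m)\<^sup>2 \<le> (p0 - F)\<^sup>2" by (simp add: abs_le_square_iff)
    then have "s\<^sup>2 * (M - m)\<^sup>2 \<le> \<Lambda> * (p0 - F)\<^sup>2"
      using \<Lambda> by (intro mult_mono) (auto simp: s_def M_def)
    then show "((p1 - F1) + s * (M - m))\<^sup>2 \<le> 2 * (p1 - F1)\<^sup>2 + 2 * (\<Lambda> * (p0 - F)\<^sup>2)"
      using sq_sum_le[of "p1 - F1" "s * (M - m)"] by (simp add: power_mult_distrib)
  qed simp
  also have "\<dots> \<le> (4 * Q + 4 * \<beta>) / m\<^sup>2"
  proof (rule divide_right_mono)
    have "(mean1 - F1)\<^sup>2 \<le> \<delta>\<^sup>2" "(mean0 - F)\<^sup>2 \<le> \<delta>\<^sup>2"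
      using b \<delta> by (auto simp: abs_le_square_iff[symmetric])
    then have 1: "(p1 - F1)\<^sup>2 \<le> 2 * D1\<^sup>2 + 2 * \<delta>\<^sup>2" "(p0 - F)\<^sup>2 \<le> 2 * D\<^sup>2 + 2 * \<delta>\<^sup>2"
      using sq_sum_le[of D1 "mean1 - F1"] sq_sum_le[of D "mean0 - F"] by (auto simp: D_def D1_def)
    then have "\<Lambda> * (p0 - F)\<^sup>2 \<le> \<Lambda> * (2 * D\<^sup>2 + 2 * \<delta>\<^sup>2)"
      using \<Lambda> by (intro mult_left_mono) auto
    then show "2 * (p1 - F1)\<^sup>2 + 2 * (\<Lambda> * (p0 - F)\<^sup>2) \<le> 4 * Q + 4 * \<beta>"
      using 1 by (simp add: Q_def \<beta>_def algebra_simps)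
  qed simp
  finally have "F * (p1 / m - s)\<^sup>2 \<le> F * ((4 * Q + 4 * \<beta>) / m\<^sup>2)"
    using F by (intro mult_left_mono) auto
  also have "\<dots> = 4 * Q * (F / m\<^sup>2) + 4 * \<beta> * (F / m\<^sup>2)"
    by (simp add: add_divide_distrib distrib_left algebra_simps)
  also have "\<dots> \<le> 4 * Q * ((3 / 2 + \<kappa>) / \<rho> + D\<^sup>2 / (2 * \<rho>^3)) + 4 * \<beta> * (F / \<rho>\<^sup>2)"
  proof (intro add_mono mult_left_mono)
    have "F \<le> m + \<bar>D\<bar> + \<delta>" using b m by (auto simp: D_def)
    then have "F / m\<^sup>2 \<le> (m + \<bar>D\<bar> + \<delta>) / m\<^sup>2" by (rule divide_right_mono) simp
    also have "\<dots> = 1 / m + (\<bar>D\<bar> + \<delta>) / m\<^sup>2"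
      using m by (simp add: add_divide_distrib power2_eq_square)
    also have "\<dots> \<le> 1 / \<rho> + (\<bar>D\<bar> + \<delta>) / \<rho>\<^sup>2"
      using m \<rho> \<delta> by (intro add_mono divide_left_mono power_mono mult_pos_pos) auto
    \<comment> \<open>The arithmetic-geometric mean inequality trades \<bar>D\<bar> for a square.
      Multiplied by \<open>Q\<close>, that square is the reason why fourth moments are
      needed.\<close>
    also have "\<dots> \<le> 1 / \<rho> + ((\<rho> + D\<^sup>2 / \<rho>) / 2 + \<kappa> * \<rho>) / \<rho>\<^sup>2"
    proof (intro add_left_mono divide_right_mono add_mono b)
      have "2 * \<rho> * \<bar>D\<bar> \<le> \<rho>\<^sup>2 + D\<^sup>2" using sum_squares_bound[of \<rho> "\<bar>D\<bar>"] by simp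
      then show "\<bar>D\<bar> \<le> (\<rho> + D\<^sup>2 / \<rho>) / 2" using \<rho> by (simp add: field_simps power2_eq_square)
    qed auto
    also have "\<dots> = (3 / 2 + \<kappa>) / \<rho> + D\<^sup>2 / (2 * \<rho>^3)"
      using \<rho> by (simp add: field_simps power2_eq_square power3_eq_cube)
    finally show "F / m\<^sup>2 \<le> (3 / 2 + \<kappa>) / \<rho> + D\<^sup>2 / (2 * \<rho>^3)" .
    show "F / m\<^sup>2 \<le> F / \<rho>\<^sup>2"
      using m \<rho> F by (intro divide_left_mono power_mono mult_pos_pos) auto
  qed (use Q0 in auto)
  also have "4 * Q * ((3 / 2 + \<kappa>) / \<rho> + D\<^sup>2 / (2 * \<rho>^3)) = (6 + 4 * \<kappa>) / \<rho> * Q + (2 * Q * D\<^sup>2) / \<rho>^3"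
    by (simp add: add_divide_distrib algebra_simps)
  also have "2 * Q * D\<^sup>2 \<le> D1^4 / \<Lambda> + 3 * \<Lambda> * D^4"
  proof -
    have "2 * D1\<^sup>2 * (\<Lambda> * D\<^sup>2) \<le> (D1\<^sup>2)\<^sup>2 + (\<Lambda> * D\<^sup>2)\<^sup>2" by (rule sum_squares_bound)
    then have "\<Lambda> * (2 * D1\<^sup>2 * D\<^sup>2) \<le> \<Lambda> * (D1^4 / \<Lambda> + \<Lambda> * D^4)"
      using \<Lambda> by (simp add: distrib_left power_mult_distrib flip: power_mult) (simp add: power2_eq_square mult_ac)
    then have "2 * D1\<^sup>2 * D\<^sup>2 \<le> D1^4 / \<Lambda> + \<Lambda> * D^4"
      using \<Lambda> by (simp only: mult_le_cancel_left_pos)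
    then show ?thesis
      by (simp add: Q_def power4_eq_xxxx power2_eq_square algebra_simps)
  qed
  finally have "F * (p1 / m - s)\<^sup>2 \<le> (6 + 4 * \<kappa>) / \<rho> * Q + (D1^4 / \<Lambda> + 3 * \<Lambda> * D^4) / \<rho>^3 + 4 * \<beta> * (F / \<rho>\<^sup>2)"
    using \<rho> by (simp add: divide_right_mono)
  moreover have "4 * \<beta> * (F / \<rho>\<^sup>2) = 4 * (1 + \<Lambda>) * \<delta>\<^sup>2 / \<rho>\<^sup>2 * F"
    by (simp add: \<beta>_def)
  ultimately show ?thesis
    by (simp only: Q_def D_def D1_def m_def M_def s_def)
qed

context geb_block
begin

definition psi :: "(nat \<Rightarrow> real) \<Rightarrow> real \<Rightarrow> real" where
  "psi X x = phat' X x / max \<rho> (phat X x)"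

lemma phat_measurable_P [measurable]:
  "(\<lambda>X. phat X x) \<in> borel_measurable P" "(\<lambda>X. phat' X x) \<in> borel_measurable P"
  unfolding phat_def phat'_def by measurable

lemma phat_measurable [measurable]:
  "(\<lambda>x. phat X x) \<in> borel_measurable borel" "(\<lambda>x. phat' X x) \<in> borel_measurable borel"
  unfolding phat_def phat'_def by measurable

lemma phat_pair_measurable [measurable]:
  "(\<lambda>z. phat (fst z) (snd z)) \<in> borel_measurable (P \<Otimes>\<^sub>M lborel)"
  "(\<lambda>z. phat' (fst z) (snd z)) \<in> borel_measurable (P \<Otimes>\<^sub>M lborel)"
  unfolding phat_def phat'_def by measurable

lemma psi_measurable [measurable]:
  "(\<lambda>x. psi X x) \<in> borel_measurable borel" "(\<lambda>z. psi (fst z) (snd z)) \<in> borel_measurable (P \<Otimes>\<^sub>M lborel)"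
  unfolding psi_def by measurable

lemma own_psi_measurable:
  assumes [measurable]: "(\<lambda>X. X k) \<in> borel_measurable P"
  shows "(\<lambda>X. psi X (X k)) \<in> borel_measurable P"
proof -
  have "(\<lambda>X. (X, X k)) \<in> P \<rightarrow>\<^sub>M P \<Otimes>\<^sub>M lborel" by measurable
  from measurable_compose[OF this psi_measurable(2)] show ?thesis by simp
qed

text \<open>Weights of \<open>kmass x\<close> and \<open>f x\<close> after the moment bounds are
  inserted: \<open>kreg\<close> collects the second and the fourth moments, \<open>kreg0\<close> the
  squared bias.\<close>

definition "kreg = (6 + 4 / r) * (1 + lam) * a^4 / (n * \<rho>) + (10 / lam + 30 * lam) * a^5 / (n\<^sup>2 * \<rho>^3)"
definition "kreg0 = 4 * (1 + lam * a\<^sup>2) / (n\<^sup>2 * \<rho>\<^sup>2)"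

lemma kreg_nonneg: "kreg \<ge> 0" "kreg0 \<ge> 0"
  using lam a_ge n_pos rho_pos unfolding kreg_def kreg0_def
  by (auto intro!: add_nonneg_nonneg divide_nonneg_nonneg mult_nonneg_nonneg)

lemma mean_measurable [measurable]: "mean0 \<in> borel_measurable borel" "mean1 \<in> borel_measurable borel"
  unfolding mean0_def[abs_def] mean1_def[abs_def] by measurable

lemma regularized_error_expectation:
  "(\<integral>\<^sup>+X. ennreal (f x * (psi X x - f' x / max \<rho> (f x))\<^sup>2) \<partial>P) \<le> ennreal (kreg * kmass x + kreg0 * f x)"
proof -
  define \<Lambda> where "\<Lambda> = lam * a\<^sup>2"
  have \<Lambda>: "\<Lambda> > 0" using lam a_ge by (simp add: \<Lambda>_def)
  define k1 where "k1 = (6 + 4 / r) / \<rho>"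
  have k1: "k1 \<ge> 0" using rho_pos by (simp add: k1_def)
  define k2 where "k2 = 1 / (\<Lambda> * \<rho>^3)"
  define k3 where "k3 = 3 * \<Lambda> / \<rho>^3"
  define k4 where "k4 = 4 * (1 + \<Lambda>) * (1 / n)\<^sup>2 / \<rho>\<^sup>2"
  have k: "k2 \<ge> 0" "k3 \<ge> 0" "k4 \<ge> 0" using rho_pos \<Lambda> by (auto simp: k2_def k3_def k4_def)
  \<comment> \<open>The bias is at most a multiple of the floor \<rho>, so
    \<open>regularized_score_error\<close> applies with \<kappa> equal to
    \<open>1 / r\<close>.\<close>
  have \<kappa>: "1 / n \<le> (1 / r) * \<rho>"
  proof -
    have "sqrt n \<le> n" using n_pos by (simp add: sqrt_le_D real_le_lsqrt power2_eq_square)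
    then have "1 / n \<le> 1 / sqrt n" using n_pos by (intro divide_left_mono) auto
    also have "\<dots> \<le> a / sqrt n" using a_ge n_pos by (intro divide_right_mono) auto
    finally show ?thesis using rho_pos by (simp add: \<rho>_def)
  qed
  have le: "ennreal (f x * (psi X x - f' x / max \<rho> (f x))\<^sup>2) \<le>
     ennreal k1 * ennreal ((phat' X x - mean1 x)\<^sup>2) + ennreal (k1 * \<Lambda>) * ennreal ((phat X x - mean0 x)\<^sup>2)
     + ennreal k2 * ennreal ((phat' X x - mean1 x)^4) + ennreal k3 * ennreal ((phat X x - mean0 x)^4) + ennreal (k4 * f x)" for X
  proof -
    have "f x * (psi X x - f' x / max \<rho> (f x))\<^sup>2 \<le> k1 * ((phat' X x - mean1 x)\<^sup>2 + \<Lambda> * (phat X x - mean0 x)\<^sup>2)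
       + ((phat' X x - mean1 x)^4 / \<Lambda> + 3 * \<Lambda> * (phat X x - mean0 x)^4) / \<rho>^3 + k4 * f x"
      unfolding psi_def k1_def k4_def
      using regularized_score_error[OF rho_pos(1) f_pos \<Lambda> score_le_a[folded \<Lambda>_def] bias \<kappa>] by simp
    also have "\<dots> = k1 * (phat' X x - mean1 x)\<^sup>2 + k1 * \<Lambda> * (phat X x - mean0 x)\<^sup>2
       + k2 * (phat' X x - mean1 x)^4 + k3 * (phat X x - mean0 x)^4 + k4 * f x"
      by (simp add: k2_def k3_def add_divide_distrib algebra_simps)
    finally show ?thesis
      using k1 k \<Lambda> f_pos[of x] by (simp add: ennreal_leI flip: ennreal_plus ennreal_mult)
  qed
  have "(\<integral>\<^sup>+X. ennreal (f x * (psi X x - f' x / max \<rho> (f x))\<^sup>2) \<partial>P) \<le>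
     (\<integral>\<^sup>+X. ennreal k1 * ennreal ((phat' X x - mean1 x)\<^sup>2) + ennreal (k1 * \<Lambda>) * ennreal ((phat X x - mean0 x)\<^sup>2)
     + ennreal k2 * ennreal ((phat' X x - mean1 x)^4) + ennreal k3 * ennreal ((phat X x - mean0 x)^4) + ennreal (k4 * f x) \<partial>P)"
    by (intro nn_integral_mono le)
  also have "\<dots> = ennreal k1 * (\<integral>\<^sup>+X. ennreal ((phat' X x - mean1 x)\<^sup>2) \<partial>P) + ennreal (k1 * \<Lambda>) * (\<integral>\<^sup>+X. ennreal ((phat X x - mean0 x)\<^sup>2) \<partial>P)
     + ennreal k2 * (\<integral>\<^sup>+X. ennreal ((phat' X x - mean1 x)^4) \<partial>P) + ennreal k3 * (\<integral>\<^sup>+X. ennreal ((phat X x - mean0 x)^4) \<partial>P) + ennreal (k4 * f x)"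
    by (simp add: nn_integral_add nn_integral_cmult P.emeasure_space_1)
  also have "\<dots> \<le> ennreal k1 * ennreal (a^4 / n * kmass x) + ennreal (k1 * \<Lambda>) * ennreal (a\<^sup>2 / n * kmass x)
     + ennreal k2 * ennreal (10 * a^7 / n\<^sup>2 * kmass x) + ennreal k3 * ennreal (10 * a^3 / n\<^sup>2 * kmass x) + ennreal (k4 * f x)"
    by (intro add_mono mult_left_mono deviation_moments) auto
  also have "\<dots> = ennreal (k1 * (a^4 / n * kmass x) + (k1 * \<Lambda>) * (a\<^sup>2 / n * kmass x)
     + k2 * (10 * a^7 / n\<^sup>2 * kmass x) + k3 * (10 * a^3 / n\<^sup>2 * kmass x) + k4 * f x)"
    using k1 k \<Lambda> f_pos[of x] kmass_bounds[of x] a_ge n_pos by (simp flip: ennreal_plus ennreal_mult)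
  also have "k1 * (a^4 / n * kmass x) + (k1 * \<Lambda>) * (a\<^sup>2 / n * kmass x)
     + k2 * (10 * a^7 / n\<^sup>2 * kmass x) + k3 * (10 * a^3 / n\<^sup>2 * kmass x) + k4 * f x = kreg * kmass x + kreg0 * f x"
  proof -
    have "k1 * (a^4 / n) + (k1 * \<Lambda>) * (a\<^sup>2 / n) = (6 + 4 / r) * (1 + lam) * a^4 / (n * \<rho>)"
    proof -
      have "k1 * (a^4 / n) + (k1 * \<Lambda>) * (a\<^sup>2 / n) = k1 * (1 + lam) * (a^4 / n)"
        by (simp add: \<Lambda>_def algebra_simps add_divide_distrib power4_eq_xxxx power2_eq_square)
      then show ?thesis by (simp add: k1_def mult.commute)
    qed
    moreover have "k2 * (10 * a^7 / n\<^sup>2) = 10 / lam * a^5 / (n\<^sup>2 * \<rho>^3)"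
      using a_ge lam by (simp add: k2_def \<Lambda>_def field_simps eval_nat_numeral)
    moreover have "k3 * (10 * a^3 / n\<^sup>2) = 30 * lam * a^5 / (n\<^sup>2 * \<rho>^3)"
      by (simp add: k3_def \<Lambda>_def field_simps eval_nat_numeral)
    moreover have "k4 = kreg0"
      by (simp add: k4_def kreg0_def \<Lambda>_def power_divide)
    ultimately have "kreg = k1 * (a^4 / n) + (k1 * \<Lambda>) * (a\<^sup>2 / n) + k2 * (10 * a^7 / n\<^sup>2) + k3 * (10 * a^3 / n\<^sup>2)" "k4 = kreg0"
      by (simp_all add: kreg_def distrib_right add_divide_distrib)
    then show ?thesis
      by (simp add: algebra_simps)
  qed
  finally show ?thesis .
qed

text \<open>
  The price for bounding the denominator of the score from below by \<open>\<rho>\<close>.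
\<close>

definition trunc :: ennreal where "trunc = (\<integral>\<^sup>+x. ennreal (g x) * indicator {x. f x < \<rho>} x \<partial>lborel)"

definition "Kreg = 8 * ((6 + 4 / r1) * (1 + lam) / r1 + (10 + 30 * lam) / r1^3 + (1 + lam) / r1\<^sup>2)"

lemma Kreg_nonneg: "Kreg \<ge> 0"
  unfolding Kreg_def using r lam
  by (intro mult_nonneg_nonneg add_nonneg_nonneg divide_nonneg_nonneg) auto

text \<open>With \<open>\<rho> = r * a / sqrt n\<close> the three parts are multiples of
  \<open>a\<^sup>2 / sqrt n\<close>, \<open>a / sqrt n\<close> and \<open>1 / n\<close>, so the
  second moments dominate. The factor \<open>4 / a\<close> stands for the integral
  \<open>pi / a\<close> of \<open>kmass\<close>.\<close>

lemma kreg_bound: "2 * (kreg * (4 / a) + kreg0) \<le> Kreg * (a\<^sup>2 / sqrt n)"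
proof -
  define q where "q = sqrt n"
  have q: "q > 0" "q\<^sup>2 = n" "q \<ge> 1" using n_pos by (auto simp: q_def)
  define u where "u = 1 / r"
  have u: "u \<le> 1 / r1" "u > 0" using r by (auto simp: u_def frac_le)
  have 1: "(6 + 4 / r) * (1 + lam) * a^4 / (n * \<rho>) * (4 / a) = 4 * ((6 + 4 * u) * (1 + lam) * u) * (a\<^sup>2 / q)"
    using rho_pos a_ge q unfolding \<rho>_def q_def[symmetric] u_def q(2)[symmetric]
    by (simp add: field_simps eval_nat_numeral)
  have 2: "(10 / lam + 30 * lam) * a^5 / (n\<^sup>2 * \<rho>^3) * (4 / a) = 4 * ((10 / lam + 30 * lam) * u^3) * (a / q)"
    using rho_pos a_ge q lam unfolding \<rho>_def q_def[symmetric] u_def q(2)[symmetric]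
    by (simp add: field_simps eval_nat_numeral)
  have 3: "kreg0 = 4 * ((1 / a\<^sup>2 + lam) * u\<^sup>2) * (1 / q\<^sup>2)"
    using rho_pos a_ge q unfolding kreg0_def \<rho>_def q_def[symmetric] u_def q(2)[symmetric]
    by (simp add: field_simps eval_nat_numeral)
  have "kreg * (4 / a) + kreg0 = 4 * ((6 + 4 * u) * (1 + lam) * u) * (a\<^sup>2 / q)
     + 4 * ((10 / lam + 30 * lam) * u^3) * (a / q) + 4 * ((1 / a\<^sup>2 + lam) * u\<^sup>2) * (1 / q\<^sup>2)"
    unfolding kreg_def distrib_right[of _ _ "4 / a"] 1 2 3 ..
  also have "\<dots> \<le> 4 * ((6 + 4 * (1 / r1)) * (1 + lam) * (1 / r1)) * (a\<^sup>2 / q)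
     + 4 * ((10 + 30 * lam) * (1 / r1)^3) * (a\<^sup>2 / q) + 4 * ((1 + lam) * (1 / r1)\<^sup>2) * (a\<^sup>2 / q)"
  proof (intro add_mono mult_mono power_mono order_refl)
    show "a / q \<le> a\<^sup>2 / q"
      using a_ge q by (intro divide_right_mono) (auto simp: power2_eq_square)
    have "1 / q\<^sup>2 \<le> 1 / q"
      using q by (intro divide_left_mono) (auto simp: power2_eq_square)
    also have "\<dots> \<le> a\<^sup>2 / q" using a_ge q by (intro divide_right_mono) auto
    finally show "1 / q\<^sup>2 \<le> a\<^sup>2 / q" .
    show "1 / a\<^sup>2 \<le> 1" using a_ge by simp
    show "10 / lam \<le> 10" using lam by (simp add: divide_le_eq)
  qed (use u lam q a_ge r in \<open>auto intro!: add_nonneg_nonneg mult_nonneg_nonneg divide_nonneg_nonneg\<close>)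
  also have "\<dots> = Kreg / 2 * (a\<^sup>2 / q)"
    by (simp add: Kreg_def power_divide distrib_right add_divide_distrib) 
  finally show ?thesis by (simp add: q_def)
qed

lemma nn_integral_f: "(\<integral>\<^sup>+x. ennreal (f x) \<partial>lborel) = 1"
proof -
  have "(\<integral>\<^sup>+x. ennreal (f x) \<partial>lborel) = (\<integral>\<^sup>+x. ennreal (1 / n) * (\<Sum>k\<in>B. ennreal (gd (x - \<theta> k))) \<partial>lborel)"
    using n_pos by (intro nn_integral_cong) (simp add: mix_def n_def sum_nonneg flip: ennreal_mult)
  also have "\<dots> = ennreal (1 / n) * (\<integral>\<^sup>+x. (\<Sum>k\<in>B. ennreal (gd (x - \<theta> k))) \<partial>lborel)"
    by (rule nn_integral_cmult) measurable
  also have "(\<integral>\<^sup>+x. (\<Sum>k\<in>B. ennreal (gd (x - \<theta> k))) \<partial>lborel) = (\<Sum>k\<in>B. (\<integral>\<^sup>+x. ennreal (gd (x - \<theta> k)) \<partial>lborel))"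
    by (rule nn_integral_sum) measurable
  also have "ennreal (1 / n) * (\<Sum>k\<in>B. (\<integral>\<^sup>+x. ennreal (gd (x - \<theta> k)) \<partial>lborel)) = 1"
  proof -
    have s1: "(\<Sum>k\<in>B. (\<integral>\<^sup>+x. ennreal (gd (x - \<theta> k)) \<partial>lborel)) = ennreal n"
      by (simp add: nn_integral_gd n_def ennreal_of_nat_eq_real_of_nat)
    have s2: "ennreal (1 / n) * ennreal n = ennreal (1 / n * n)"
      using n_pos by (intro ennreal_mult[symmetric]) auto
    show ?thesis unfolding s1 s2 using n_pos by simp
  qed
  finally show ?thesis .
qed

text \<open>The regularized score serves as intermediate point. It differs from
  \<open>f' / f\<close> only where \<open>f < \<rho>\<close>, and there by at most
  \<open>\<bar>f' / f\<bar>\<close>, so the squared gap weighted by f is at most g, the integrand of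
  \<open>trunc\<close>.\<close>

lemma regret_bound:
  "(\<integral>\<^sup>+X. \<integral>\<^sup>+x. ennreal (f x * (psi X x - f' x / f x)\<^sup>2) \<partial>lborel \<partial>P) \<le> ennreal (Kreg * (a\<^sup>2 / sqrt n)) + 2 * trunc"
proof -
  interpret PL: pair_sigma_finite P lborel ..
  have le: "ennreal (f x * (psi X x - f' x / f x)\<^sup>2) \<le>
      2 * ennreal (f x * (psi X x - f' x / max \<rho> (f x))\<^sup>2) + 2 * (ennreal (g x) * indicator {x. f x < \<rho>} x)" for x X
  proof -
    have fx: "f x > 0" by (rule f_pos)
    define s where "s = f' x / max \<rho> (f x)"
    define s0 where "s0 = f' x / f x"
    have "f x * (s - s0)\<^sup>2 \<le> g x * indicator {x. f x < \<rho>} x"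
    proof (cases "f x < \<rho>")
      case True
      have "\<bar>s - s0\<bar> = \<bar>f' x\<bar> * (1 / f x - 1 / \<rho>)"
      proof -
        have "s - s0 = - (f' x * (1 / f x - 1 / \<rho>))"
          using True by (simp add: s_def s0_def right_diff_distrib)
        moreover have "1 / f x - 1 / \<rho> \<ge> 0" using True fx by (simp add: frac_le)
        ultimately show ?thesis by (simp add: abs_mult)
      qed
      also have "\<dots> \<le> \<bar>f' x\<bar> * (1 / f x)"
        using rho_pos by (intro mult_left_mono) auto
      finally have "\<bar>s - s0\<bar> \<le> \<bar>f' x / f x\<bar>" using fx by simp
      then have "(s - s0)\<^sup>2 \<le> (f' x / f x)\<^sup>2" by (simp only: abs_le_square_iff)
      then have "f x * (s - s0)\<^sup>2 \<le> f x * (f' x / f x)\<^sup>2" using fx by (intro mult_left_mono) auto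
      also have "\<dots> = (f' x)\<^sup>2 / f x" using fx by (simp add: power2_eq_square)
      also have "\<dots> \<le> g x" by (rule f'_sq_over_f)
      finally show ?thesis using True by simp
    next
      case False
      then show ?thesis by (simp add: s_def s0_def max_def g_nonneg)
    qed
    moreover have "(psi X x - s0)\<^sup>2 \<le> 2 * (psi X x - s)\<^sup>2 + 2 * (s - s0)\<^sup>2"
      using sum_squares_bound[of "psi X x - s" "s - s0"] by (simp add: power2_eq_square algebra_simps)
    then have "f x * (psi X x - s0)\<^sup>2 \<le> f x * (2 * (psi X x - s)\<^sup>2 + 2 * (s - s0)\<^sup>2)"
      using fx by (intro mult_left_mono) auto
    ultimately have "f x * (psi X x - s0)\<^sup>2 \<le> 2 * (f x * (psi X x - s)\<^sup>2) + 2 * (g x * indicator {x. f x < \<rho>} x)"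
      by (simp add: algebra_simps)
    then have "ennreal (f x * (psi X x - s0)\<^sup>2) \<le> ennreal (2 * (f x * (psi X x - s)\<^sup>2) + 2 * (g x * indicator {x. f x < \<rho>} x))"
      by (rule ennreal_leI)
    also have "\<dots> = 2 * ennreal (f x * (psi X x - s)\<^sup>2) + 2 * (ennreal (g x) * indicator {x. f x < \<rho>} x)"
      using fx g_nonneg[of x] by (simp add: ennreal_mult split: split_indicator)
    finally show ?thesis by (simp add: s_def s0_def)
  qed
  have "(\<integral>\<^sup>+X. \<integral>\<^sup>+x. ennreal (f x * (psi X x - f' x / f x)\<^sup>2) \<partial>lborel \<partial>P) \<le>
      (\<integral>\<^sup>+X. \<integral>\<^sup>+x. 2 * ennreal (f x * (psi X x - f' x / max \<rho> (f x))\<^sup>2) + 2 * (ennreal (g x) * indicator {x. f x < \<rho>} x) \<partial>lborel \<partial>P)"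
    by (intro nn_integral_mono le)
  also have "\<dots> = (\<integral>\<^sup>+X. 2 * (\<integral>\<^sup>+x. ennreal (f x * (psi X x - f' x / max \<rho> (f x))\<^sup>2) \<partial>lborel) + 2 * trunc \<partial>P)"
  proof (rule nn_integral_cong)
    fix X
    have 1: "(\<lambda>x. ennreal (f x * (psi X x - f' x / max \<rho> (f x))\<^sup>2)) \<in> borel_measurable lborel"
      by measurable
    have 2: "(\<lambda>x. ennreal (g x) * indicator {x. f x < \<rho>} x) \<in> borel_measurable lborel"
      by measurable
    show "(\<integral>\<^sup>+x. 2 * ennreal (f x * (psi X x - f' x / max \<rho> (f x))\<^sup>2) + 2 * (ennreal (g x) * indicator {x. f x < \<rho>} x) \<partial>lborel)
       = 2 * (\<integral>\<^sup>+x. ennreal (f x * (psi X x - f' x / max \<rho> (f x))\<^sup>2) \<partial>lborel) + 2 * trunc"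
      unfolding trunc_def nn_integral_cmult[OF 1, symmetric] nn_integral_cmult[OF 2, symmetric]
      by (intro nn_integral_add borel_measurable_times_ennreal borel_measurable_const 1 2)
  qed
  also have "\<dots> = 2 * (\<integral>\<^sup>+X. (\<integral>\<^sup>+x. ennreal (f x * (psi X x - f' x / max \<rho> (f x))\<^sup>2) \<partial>lborel) \<partial>P) + 2 * trunc"
    by (subst nn_integral_add, measurable) (simp add: nn_integral_cmult P.emeasure_space_1)
  finally have main: "(\<integral>\<^sup>+X. \<integral>\<^sup>+x. ennreal (f x * (psi X x - f' x / f x)\<^sup>2) \<partial>lborel \<partial>P) \<le>
      2 * (\<integral>\<^sup>+X. (\<integral>\<^sup>+x. ennreal (f x * (psi X x - f' x / max \<rho> (f x))\<^sup>2) \<partial>lborel) \<partial>P) + 2 * trunc" .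
  have "(\<integral>\<^sup>+X. (\<integral>\<^sup>+x. ennreal (f x * (psi X x - f' x / max \<rho> (f x))\<^sup>2) \<partial>lborel) \<partial>P)
      = (\<integral>\<^sup>+x. (\<integral>\<^sup>+X. ennreal (f x * (psi X x - f' x / max \<rho> (f x))\<^sup>2) \<partial>P) \<partial>lborel)"
    by (rule PL.Fubini'[symmetric]) measurable
  also have "\<dots> \<le> (\<integral>\<^sup>+x. ennreal (kreg * kmass x + kreg0 * f x) \<partial>lborel)"
    by (intro nn_integral_mono regularized_error_expectation)
  also have "\<dots> = (\<integral>\<^sup>+x. ennreal kreg * ennreal (kmass x) + ennreal kreg0 * ennreal (f x) \<partial>lborel)"
    using kreg_nonneg kmass_bounds f_pos by (intro nn_integral_cong) (simp add: less_imp_le ennreal_mult)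
  also have "\<dots> = ennreal kreg * ennreal (pi / a) + ennreal kreg0"
    by (subst nn_integral_add, measurable) (simp add: nn_integral_cmult nn_integral_kmass nn_integral_f)
  also have "\<dots> = ennreal (kreg * (pi / a) + kreg0)"
    using kreg_nonneg a_ge by (simp flip: ennreal_mult)
  also have "\<dots> \<le> ennreal (kreg * (4 / a) + kreg0)"
    using kreg_nonneg a_ge pi_less_4 by (intro ennreal_leI add_mono mult_left_mono divide_right_mono) auto
  finally have "2 * (\<integral>\<^sup>+X. (\<integral>\<^sup>+x. ennreal (f x * (psi X x - f' x / max \<rho> (f x))\<^sup>2) \<partial>lborel) \<partial>P)
      \<le> 2 * ennreal (kreg * (4 / a) + kreg0)"
    by (rule mult_left_mono) simp
  also have "\<dots> = ennreal (2 * (kreg * (4 / a) + kreg0))"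
    using kreg_nonneg a_ge by (subst ennreal_mult) auto
  also have "\<dots> \<le> ennreal (Kreg * (a\<^sup>2 / sqrt n))"
    by (intro ennreal_leI kreg_bound)
  finally show ?thesis
    using main by (meson add_right_mono order_trans)
qed

end

section \<open>The empirical Bayes rule at its own observations\<close>

context finite_block
begin

text \<open>Total risk of the posterior mean, hence the ideal separable risk of the block at unit
  noise.\<close>

definition Rstar :: ennreal where
  "Rstar = (\<integral>\<^sup>+x. ennreal (\<Sum>k\<in>B. gd (x - \<theta> k) * (x + f' x / f x - \<theta> k)\<^sup>2) \<partial>lborel)"

lemma separable_risk_eq:
  assumes [measurable]: "h \<in> borel_measurable borel"
  shows "(\<Sum>k\<in>B. \<integral>\<^sup>+x. ennreal ((h x - \<theta> k)\<^sup>2) \<partial>Nrm (\<theta> k)) =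
    Rstar + ennreal n * (\<integral>\<^sup>+x. ennreal (f x * (h x - (x + f' x / f x))\<^sup>2) \<partial>lborel)"
proof -
  have "(\<Sum>k\<in>B. \<integral>\<^sup>+x. ennreal ((h x - \<theta> k)\<^sup>2) \<partial>Nrm (\<theta> k)) =
      (\<Sum>k\<in>B. \<integral>\<^sup>+x. ennreal (gd (x - \<theta> k)) * ennreal ((h x - \<theta> k)\<^sup>2) \<partial>lborel)"
    by (intro sum.cong refl nn_integral_Nrm) measurable
  also have "\<dots> = (\<integral>\<^sup>+x. (\<Sum>k\<in>B. ennreal (gd (x - \<theta> k)) * ennreal ((h x - \<theta> k)\<^sup>2)) \<partial>lborel)"
    by (rule nn_integral_sum[symmetric]) measurable
  also have "\<dots> = (\<integral>\<^sup>+x. ennreal (\<Sum>k\<in>B. gd (x - \<theta> k) * (x + f' x / f x - \<theta> k)\<^sup>2)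
      + ennreal n * ennreal (f x * (h x - (x + f' x / f x))\<^sup>2) \<partial>lborel)"
  proof (intro nn_integral_cong)
    fix x
    have "(\<Sum>k\<in>B. ennreal (gd (x - \<theta> k)) * ennreal ((h x - \<theta> k)\<^sup>2)) = ennreal (\<Sum>k\<in>B. gd (x - \<theta> k) * (h x - \<theta> k)\<^sup>2)"
      by (simp add: ennreal_mult[symmetric])
    also have "\<dots> = ennreal ((\<Sum>k\<in>B. gd (x - \<theta> k) * (x + f' x / f x - \<theta> k)\<^sup>2) + n * (f x * (h x - (x + f' x / f x))\<^sup>2))"
      unfolding bayes_pointwise[of x "h x"] by (simp add: mult.assoc)
    also have "\<dots> = ennreal (\<Sum>k\<in>B. gd (x - \<theta> k) * (x + f' x / f x - \<theta> k)\<^sup>2) + ennreal (n * (f x * (h x - (x + f' x / f x))\<^sup>2))"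
      using n_pos f_pos[of x] by (intro ennreal_plus sum_nonneg) auto
    also have "ennreal (n * (f x * (h x - (x + f' x / f x))\<^sup>2)) = ennreal n * ennreal (f x * (h x - (x + f' x / f x))\<^sup>2)"
      using n_pos f_pos[of x] by (intro ennreal_mult) auto
    finally show "(\<Sum>k\<in>B. ennreal (gd (x - \<theta> k)) * ennreal ((h x - \<theta> k)\<^sup>2)) =
      ennreal (\<Sum>k\<in>B. gd (x - \<theta> k) * (x + f' x / f x - \<theta> k)\<^sup>2) + ennreal n * ennreal (f x * (h x - (x + f' x / f x))\<^sup>2)" .
  qed
  also have "\<dots> = Rstar + ennreal n * (\<integral>\<^sup>+x. ennreal (f x * (h x - (x + f' x / f x))\<^sup>2) \<partial>lborel)"
    unfolding Rstar_def by (subst nn_integral_add, measurable) (subst nn_integral_cmult, measurable)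
  finally show ?thesis .
qed

lemma Rstar_le:
  assumes "h \<in> borel_measurable borel"
  shows "Rstar \<le> (\<Sum>k\<in>B. \<integral>\<^sup>+x. ennreal ((h x - \<theta> k)\<^sup>2) \<partial>Nrm (\<theta> k))"
  unfolding separable_risk_eq[OF assms] by simp

text \<open>The identity rule has risk n. This keeps the cost bounded when \<open>Rstar\<close> is
  multiplied by a factor slightly above 1.\<close>

lemma Rstar_le_n: "Rstar \<le> ennreal n"
  using Rstar_le[of "\<lambda>x. x"] by (simp add: nn_integral_Nrm_sq n_def ennreal_of_nat_eq_real_of_nat)

end

context geb_block
begin

text \<open>Equal to \<open>2 * a / (n * \<rho>)\<close>: twice the height \<open>a / n\<close> of
  one kernel summand, relative to the floor \<rho>.\<close>

definition "\<delta> = 2 / (r * sqrt n)"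

lemma delta: "\<delta> > 0" "\<delta> \<le> 2 / r1" "\<delta> = 2 / r * (1 / sqrt n)"
proof -
  show "\<delta> > 0" "\<delta> = 2 / r * (1 / sqrt n)" using rho_pos n_pos by (auto simp: \<delta>_def)
  have "r1 * 1 \<le> r * sqrt n" using r n_pos by (intro mult_mono) auto
  then show "\<delta> \<le> 2 / r1" using r unfolding \<delta>_def by (intro frac_le) auto
qed

text \<open>
  Replacing \<open>X k\<close> by an independent copy changes the estimated score at \<open>X k\<close> only by \<open>O(sqrt (ln n / n))\<close>, and
  afterwards \<open>X k\<close> is independent of the estimated score.
\<close>

lemma psi_swap:
  assumes k: "k \<in> B" and X: "\<And>i. i \<in> B \<Longrightarrow> i \<noteq> k \<Longrightarrow> X i = X' i"
  shows "\<bar>psi X u - psi X' u\<bar> \<le> \<delta> * (a + \<bar>psi X' u\<bar>)"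
proof -
  have diff: "\<bar>(\<Sum>i\<in>B. K (u - X i) / n) - (\<Sum>i\<in>B. K (u - X' i) / n)\<bar> \<le> 2 * b / n"
    if b: "\<And>u. \<bar>K u\<bar> \<le> b" for K :: "real \<Rightarrow> real" and b
  proof -
    have "(\<Sum>i\<in>B. K (u - X i) / n) - (\<Sum>i\<in>B. K (u - X' i) / n) = K (u - X k) / n - K (u - X' k) / n"
      using fin k X by (simp add: sum.remove[of B k])
    also have "\<dots> = (K (u - X k) - K (u - X' k)) / n" by (simp add: diff_divide_distrib)
    also have "\<bar>\<dots>\<bar> \<le> (b + b) / n"
      using b[of "u - X k"] b[of "u - X' k"] n_pos by (auto intro!: divide_right_mono)
    finally show ?thesis by simp
  qed
  have d0: "\<bar>phat X u - phat X' u\<bar> \<le> 2 * a / n"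
    unfolding phat_def using kern_bounds(1)[OF a_ge(4)] by (rule diff)
  have d1: "\<bar>phat' X u - phat' X' u\<bar> \<le> 2 * a\<^sup>2 / n"
    unfolding phat'_def using kern_bounds(2)[OF a_ge(4)] by (rule diff)
  define m where "m = max \<rho> (phat X u)"
  define m' where "m' = max \<rho> (phat X' u)"
  have m: "m \<ge> \<rho>" "m > 0" "m' > 0" using rho_pos by (auto simp: m_def m'_def)
  have mm: "\<bar>m' - m\<bar> \<le> 2 * a / n" using d0 by (auto simp: m_def m'_def)
  have "psi X u - psi X' u = (phat' X u - phat' X' u) / m + psi X' u * (m' - m) / m"
    using m by (simp add: psi_def m_def[symmetric] m'_def[symmetric] field_simps)
  then have "\<bar>psi X u - psi X' u\<bar> \<le> \<bar>(phat' X u - phat' X' u) / m\<bar> + \<bar>psi X' u * (m' - m) / m\<bar>"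
    by linarith
  also have "\<dots> = \<bar>phat' X u - phat' X' u\<bar> / m + \<bar>psi X' u\<bar> * \<bar>m' - m\<bar> / m"
    using m by (simp add: abs_mult)
  also have "\<dots> \<le> (2 * a\<^sup>2 / n) / \<rho> + \<bar>psi X' u\<bar> * (2 * a / n) / \<rho>"
    using d1 mm m rho_pos a_ge n_pos by (intro add_mono frac_le mult_left_mono mult_nonneg_nonneg) auto
  also have "\<dots> = 2 * a / (n * \<rho>) * (a + \<bar>psi X' u\<bar>)"
    by (simp add: field_simps add_divide_distrib power2_eq_square)
  also have "2 * a / (n * \<rho>) = \<delta>"
    using a_ge n_pos rho_pos real_div_sqrt[of n] by (simp add: \<rho>_def \<delta>_def field_simps)
  finally show ?thesis .
qed

text \<open>The leading coefficient has to tend to 1, since it multiplies the whole risk;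
  \<open>(u + v)\<^sup>2 \<le> 2 * u\<^sup>2 + 2 * v\<^sup>2\<close> would double it. The cross term
  already carries a factor \<delta>, so splitting it evenly only raises
  \<open>(1 + \<delta>)\<^sup>2\<close> to \<open>(1 + \<delta>)^3\<close>.\<close>

lemma loss_swap:
  assumes "k \<in> B" "\<And>i. i \<in> B \<Longrightarrow> i \<noteq> k \<Longrightarrow> X i = X' i"
  shows "(Y + psi X u)\<^sup>2 \<le> (1 + \<delta>)^3 * (Y + psi X' u)\<^sup>2 + 2 * (1 + \<delta>) * \<delta> * (a\<^sup>2 + Y\<^sup>2)"
proof -
  define e where "e = \<bar>Y + psi X' u\<bar>"
  define q where "q = a + \<bar>Y\<bar>"
  have "\<bar>psi X' u\<bar> \<le> e + \<bar>Y\<bar>" by (auto simp: e_def)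
  then have "\<delta> * (a + \<bar>psi X' u\<bar>) \<le> \<delta> * (a + (e + \<bar>Y\<bar>))"
    using delta by (intro mult_left_mono) auto
  then have "\<bar>Y + psi X u\<bar> \<le> (1 + \<delta>) * e + \<delta> * q"
    using psi_swap[of k X X' u, OF assms] by (simp add: e_def q_def algebra_simps)
  then have "(Y + psi X u)\<^sup>2 \<le> ((1 + \<delta>) * e + \<delta> * q)\<^sup>2"
    using power_mono[of "\<bar>Y + psi X u\<bar>" _ 2] by simp
  also have "\<dots> \<le> (1 + \<delta>)^3 * e\<^sup>2 + (1 + \<delta>) * \<delta> * q\<^sup>2"
  proof -
    have "2 * ((1 + \<delta>) * e) * q \<le> ((1 + \<delta>) * e)\<^sup>2 + q\<^sup>2" by (rule sum_squares_bound)
    then have "\<delta> * (2 * ((1 + \<delta>) * e) * q) \<le> \<delta> * (((1 + \<delta>) * e)\<^sup>2 + q\<^sup>2)"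
      using delta by (intro mult_left_mono) auto
    then show ?thesis by (simp add: power2_eq_square power3_eq_cube algebra_simps)
  qed
  also have "\<dots> \<le> (1 + \<delta>)^3 * e\<^sup>2 + (1 + \<delta>) * \<delta> * (2 * (a\<^sup>2 + Y\<^sup>2))"
    using sum_squares_bound[of a "\<bar>Y\<bar>"] delta
    by (intro add_left_mono mult_left_mono) (auto simp: q_def power2_sum)
  also have "(1 + \<delta>) * \<delta> * (2 * (a\<^sup>2 + Y\<^sup>2)) = 2 * (1 + \<delta>) * \<delta> * (a\<^sup>2 + Y\<^sup>2)"
    by (simp add: algebra_simps)
  finally show ?thesis by (simp only: e_def power2_abs)
qed

lemma upd_measurable [measurable]:
  "(\<lambda>p. psi (z(k := fst p)) (snd p)) \<in> borel_measurable (borel \<Otimes>\<^sub>M borel)"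
  unfolding psi_def phat_def phat'_def fun_upd_apply by measurable

text \<open>\<open>loss_swap\<close> is averaged over an independent copy of coordinate k. On the
  right the score is computed from a full sample X while x is a fresh draw, so the exact risk
  identity for separable rules applies for each fixed X.\<close>

lemma own_risk_le:
  assumes k: "k \<in> B"
  shows "(\<integral>\<^sup>+X. ennreal ((X k - \<theta> k + psi X (X k))\<^sup>2) \<partial>P) \<le>
    ennreal ((1 + \<delta>)^3) * (\<integral>\<^sup>+X. \<integral>\<^sup>+x. ennreal ((x - \<theta> k + psi X x)\<^sup>2) \<partial>Nrm (\<theta> k) \<partial>P)
    + ennreal (2 * (1 + \<delta>) * \<delta> * (a\<^sup>2 + 1))"
proof -
  define B' where "B' = B - {k}"
  have B: "B = insert k B'" "k \<notin> B'" "finite B'" using k fin by (auto simp: B'_def)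
  define N where "N = (\<lambda>i. Nrm (\<theta> i))"
  interpret N: product_sigma_finite N
    unfolding product_sigma_finite_def N_def using prob_space_Nrm prob_space_imp_sigma_finite by blast
  interpret Q: prob_space "PiM B' N" unfolding N_def by (rule prob_space_PiM) simp
  interpret Nk: prob_space "Nrm (\<theta> k)" by simp
  interpret PN: pair_sigma_finite "Nrm (\<theta> k)" "Nrm (\<theta> k)" ..
  have P: "P = PiM (insert k B') N" by (simp add: P_def N_def B(1)[symmetric])
  have split: "(\<integral>\<^sup>+X. F X \<partial>P) = (\<integral>\<^sup>+z. \<integral>\<^sup>+u. F (z(k := u)) \<partial>Nrm (\<theta> k) \<partial>PiM B' N)"
    if "F \<in> borel_measurable P" for F
    unfolding P using N.product_nn_integral_insert[OF B(3,2), of F] that by (simp add: P N_def)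
  define F where "F = (\<lambda>u X. ennreal ((u - \<theta> k + psi X u)\<^sup>2))"
  define c where "c = (1 + \<delta>)^3"
  define d where "d = 2 * (1 + \<delta>) * \<delta>"
  have cd: "c \<ge> 0" "d \<ge> 0" using delta by (auto simp: c_def d_def)
  have [measurable]: "(\<lambda>X. X k) \<in> borel_measurable P" using k by (rule coord_measurable)
  have m1: "(\<lambda>X. F (X k) X) \<in> borel_measurable P"
  proof -
    have [measurable]: "(\<lambda>X. psi X (X k)) \<in> borel_measurable P" by (intro own_psi_measurable) measurable
    show ?thesis unfolding F_def by measurable
  qed
  have m2: "(\<lambda>X. \<integral>\<^sup>+x. F x X \<partial>Nrm (\<theta> k)) \<in> borel_measurable P"
  proof -
    have "(\<lambda>p. F (snd p) (fst p)) \<in> borel_measurable (P \<Otimes>\<^sub>M Nrm (\<theta> k))"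
      unfolding F_def psi_def phat_def phat'_def by measurable
    then show ?thesis
      using Nk.borel_measurable_nn_integral[of "\<lambda>X x. F x X" P] by (simp add: case_prod_beta')
  qed
  have m3: "(\<lambda>p. F (snd p) (z(k := fst p))) \<in> borel_measurable (borel \<Otimes>\<^sub>M borel)" for z
    unfolding F_def by measurable
  have m3': "(\<lambda>p. F (fst p) (z(k := snd p))) \<in> borel_measurable (borel \<Otimes>\<^sub>M borel)" for z
    using measurable_compose[OF measurable_pair_swap' m3[of z]] by (simp add: comp_def case_prod_beta)
  have inner: "(\<integral>\<^sup>+u. F u (z(k := u)) \<partial>Nrm (\<theta> k)) \<le>
      ennreal c * (\<integral>\<^sup>+u. \<integral>\<^sup>+x. F x (z(k := u)) \<partial>Nrm (\<theta> k) \<partial>Nrm (\<theta> k)) + ennreal (d * (a\<^sup>2 + 1))" for z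
  proof -
    have mz: "(\<lambda>p. F (fst p) (z(k := snd p))) \<in> borel_measurable (Nrm (\<theta> k) \<Otimes>\<^sub>M Nrm (\<theta> k))"
      using m3'[of z] by measurable
    then have mz1: "(\<lambda>x. F u (z(k := x))) \<in> borel_measurable (Nrm (\<theta> k))" for u
      using measurable_compose[OF measurable_Pair1' mz] by simp
    have mz2: "(\<lambda>u. \<integral>\<^sup>+x. F u (z(k := x)) \<partial>Nrm (\<theta> k)) \<in> borel_measurable (Nrm (\<theta> k))"
      using Nk.borel_measurable_nn_integral[of "\<lambda>u x. F u (z(k := x))" "Nrm (\<theta> k)"] mz by (simp add: case_prod_beta')
    have "(\<integral>\<^sup>+u. F u (z(k := u)) \<partial>Nrm (\<theta> k)) = (\<integral>\<^sup>+u. \<integral>\<^sup>+x. F u (z(k := u)) \<partial>Nrm (\<theta> k) \<partial>Nrm (\<theta> k))"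
      by (simp add: Nk.emeasure_space_1 del: emeasure_density space_density)
    also have "\<dots> \<le> (\<integral>\<^sup>+u. \<integral>\<^sup>+x. ennreal c * F u (z(k := x)) + ennreal (d * (a\<^sup>2 + (u - \<theta> k)\<^sup>2)) \<partial>Nrm (\<theta> k) \<partial>Nrm (\<theta> k))"
    proof (intro nn_integral_mono)
      fix u x
      show "F u (z(k := u)) \<le> ennreal c * F u (z(k := x)) + ennreal (d * (a\<^sup>2 + (u - \<theta> k)\<^sup>2))"
        using loss_swap[of k "z(k := u)" "z(k := x)" "u - \<theta> k" u] k cd
        unfolding F_def c_def[symmetric] d_def[symmetric]
        by (simp add: ennreal_leI flip: ennreal_plus ennreal_mult)
    qed
    also have "\<dots> = (\<integral>\<^sup>+u. ennreal c * (\<integral>\<^sup>+x. F u (z(k := x)) \<partial>Nrm (\<theta> k)) + ennreal (d * (a\<^sup>2 + (u - \<theta> k)\<^sup>2)) \<partial>Nrm (\<theta> k))"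
      using mz1 by (simp add: nn_integral_add nn_integral_cmult Nk.emeasure_space_1 del: emeasure_density space_density)
    also have "\<dots> = ennreal c * (\<integral>\<^sup>+u. \<integral>\<^sup>+x. F u (z(k := x)) \<partial>Nrm (\<theta> k) \<partial>Nrm (\<theta> k)) + (\<integral>\<^sup>+u. ennreal (d * (a\<^sup>2 + (u - \<theta> k)\<^sup>2)) \<partial>Nrm (\<theta> k))"
      using mz2 by (subst nn_integral_add) (auto simp: nn_integral_cmult)
    also have "(\<integral>\<^sup>+u. ennreal (d * (a\<^sup>2 + (u - \<theta> k)\<^sup>2)) \<partial>Nrm (\<theta> k)) = (\<integral>\<^sup>+u. ennreal d * (ennreal (a\<^sup>2) + ennreal ((u - \<theta> k)\<^sup>2)) \<partial>Nrm (\<theta> k))"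
      using cd by (intro nn_integral_cong) (simp flip: ennreal_plus ennreal_mult)
    also have "\<dots> = ennreal d * (ennreal (a\<^sup>2) + 1)"
      by (simp add: nn_integral_add nn_integral_cmult nn_integral_Nrm_sq Nk.emeasure_space_1 del: emeasure_density space_density)
    also have "\<dots> = ennreal (d * (a\<^sup>2 + 1))"
      using cd by (simp add: ennreal_mult)
    \<comment> \<open>After the exchange of the integrals the copy belongs to the sample, and the
      former observation \<open>u\<close> plays the part of the fresh draw.\<close>
    also have "(\<integral>\<^sup>+u. \<integral>\<^sup>+x. F u (z(k := x)) \<partial>Nrm (\<theta> k) \<partial>Nrm (\<theta> k)) = (\<integral>\<^sup>+x. \<integral>\<^sup>+u. F u (z(k := x)) \<partial>Nrm (\<theta> k) \<partial>Nrm (\<theta> k))"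
      using PN.Fubini'[of "\<lambda>u x. F u (z(k := x))"] mz by (simp add: case_prod_beta')
    finally show ?thesis .
  qed
  have "(\<integral>\<^sup>+X. F (X k) X \<partial>P) = (\<integral>\<^sup>+z. \<integral>\<^sup>+u. F u (z(k := u)) \<partial>Nrm (\<theta> k) \<partial>PiM B' N)"
    by (subst split[OF m1]) simp
  also have "\<dots> \<le> (\<integral>\<^sup>+z. ennreal c * (\<integral>\<^sup>+u. \<integral>\<^sup>+x. F x (z(k := u)) \<partial>Nrm (\<theta> k) \<partial>Nrm (\<theta> k)) + ennreal (d * (a\<^sup>2 + 1)) \<partial>PiM B' N)"
    by (intro nn_integral_mono inner)
  also have "\<dots> = ennreal c * (\<integral>\<^sup>+z. \<integral>\<^sup>+u. \<integral>\<^sup>+x. F x (z(k := u)) \<partial>Nrm (\<theta> k) \<partial>Nrm (\<theta> k) \<partial>PiM B' N) + ennreal (d * (a\<^sup>2 + 1))"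
  proof -
    have mm: "(\<lambda>z. \<integral>\<^sup>+u. \<integral>\<^sup>+x. F x (z(k := u)) \<partial>Nrm (\<theta> k) \<partial>Nrm (\<theta> k)) \<in> borel_measurable (PiM B' N)"
    proof -
      have "(\<lambda>p. (\<integral>\<^sup>+x. F x ((fst p)(k := snd p)) \<partial>Nrm (\<theta> k))) \<in> borel_measurable (PiM B' N \<Otimes>\<^sub>M Nrm (\<theta> k))"
      proof (rule measurable_compose[OF _ m2])
        show "(\<lambda>p. (fst p)(k := snd p)) \<in> PiM B' N \<Otimes>\<^sub>M Nrm (\<theta> k) \<rightarrow>\<^sub>M P"
          using measurable_add_dim[of k B' N] unfolding P by (simp add: N_def case_prod_beta')
      qed
      then show ?thesis
        using Nk.borel_measurable_nn_integral[of "\<lambda>z u. \<integral>\<^sup>+x. F x (z(k := u)) \<partial>Nrm (\<theta> k)" "PiM B' N"] by (simp add: case_prod_beta')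
    qed
    then show ?thesis
      by (simp add: nn_integral_add nn_integral_cmult Q.emeasure_space_1)
  qed
  also have "(\<integral>\<^sup>+z. \<integral>\<^sup>+u. \<integral>\<^sup>+x. F x (z(k := u)) \<partial>Nrm (\<theta> k) \<partial>Nrm (\<theta> k) \<partial>PiM B' N) = (\<integral>\<^sup>+X. \<integral>\<^sup>+x. F x X \<partial>Nrm (\<theta> k) \<partial>P)"
    by (rule split[OF m2, symmetric])
  finally show ?thesis
    by (simp add: F_def c_def d_def)
qed

text \<open>Bounds for \<delta> and \<open>(1 + \<delta>)^3\<close> that are uniform in n and r,
  from \<open>n \<ge> 1\<close> and \<open>r \<ge> r1\<close>.\<close>

definition "\<delta>m = 2 / r1"
definition "Bm = (1 + \<delta>m)^3"
definition "Kgeb = (3 + 3 * \<delta>m + \<delta>m\<^sup>2) * \<delta>m + Bm * Kreg + 4 * (1 + \<delta>m) * \<delta>m"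

lemma geb_risk:
  "total_risk (\<lambda>k X. (X k - \<theta> k + psi X (X k))\<^sup>2) \<le>
    Rstar + ennreal n * (ennreal (Kgeb * (a\<^sup>2 / sqrt n)) + ennreal (2 * Bm) * trunc)"
proof -
  define q where "q = a\<^sup>2 / sqrt n"
  have q: "q \<ge> 1 / sqrt n" "q > 0" using a_ge n_pos by (auto simp: q_def divide_right_mono)
  have dm: "\<delta> \<le> \<delta>m" "\<delta>m \<ge> 0" using delta r by (auto simp: \<delta>m_def)
  have dq: "\<delta> \<le> \<delta>m * (1 / sqrt n)"
    unfolding delta(3) \<delta>m_def using r n_pos by (intro mult_right_mono) (auto intro: frac_le)
  have dq1: "\<delta> \<le> \<delta>m * q" using mult_left_mono[OF q(1) dm(2)] dq by linarith
  have dqa: "\<delta> * a\<^sup>2 \<le> \<delta>m * q" using mult_right_mono[OF dq, of "a\<^sup>2"] by (simp add: q_def)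
  note Kreg = Kreg_nonneg
  define A where "A = (\<integral>\<^sup>+X. \<integral>\<^sup>+x. ennreal (f x * (psi X x - f' x / f x)\<^sup>2) \<partial>lborel \<partial>P)"
  have A: "A \<le> ennreal (Kreg * q) + 2 * trunc" unfolding A_def q_def by (rule regret_bound)
  have sum: "(\<Sum>k\<in>B. \<integral>\<^sup>+X. \<integral>\<^sup>+x. ennreal ((x - \<theta> k + psi X x)\<^sup>2) \<partial>Nrm (\<theta> k) \<partial>P) = Rstar + ennreal n * A"
  proof -
    have mk: "(\<lambda>X. \<integral>\<^sup>+x. ennreal ((x - \<theta> k + psi X x)\<^sup>2) \<partial>Nrm (\<theta> k)) \<in> borel_measurable P" for k
    proof -
      interpret Nk: prob_space "Nrm (\<theta> k)" by simp
      have "(\<lambda>p. ennreal ((snd p - \<theta> k + psi (fst p) (snd p))\<^sup>2)) \<in> borel_measurable (P \<Otimes>\<^sub>M Nrm (\<theta> k))"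
        unfolding psi_def phat_def phat'_def by measurable
      then show ?thesis
        using Nk.borel_measurable_nn_integral[of "\<lambda>X x. ennreal ((x - \<theta> k + psi X x)\<^sup>2)" P] by (simp add: case_prod_beta')
    qed
    have mA: "(\<lambda>X. \<integral>\<^sup>+x. ennreal (f x * (psi X x - f' x / f x)\<^sup>2) \<partial>lborel) \<in> borel_measurable P"
      by measurable
    have eq: "(\<Sum>k\<in>B. \<integral>\<^sup>+x. ennreal ((x - \<theta> k + psi X x)\<^sup>2) \<partial>Nrm (\<theta> k)) =
        Rstar + ennreal n * (\<integral>\<^sup>+x. ennreal (f x * (psi X x - f' x / f x)\<^sup>2) \<partial>lborel)" for X
      using separable_risk_eq[of "\<lambda>x. x + psi X x"] by (simp add: algebra_simps)
    have "(\<Sum>k\<in>B. \<integral>\<^sup>+X. \<integral>\<^sup>+x. ennreal ((x - \<theta> k + psi X x)\<^sup>2) \<partial>Nrm (\<theta> k) \<partial>P)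
        = (\<integral>\<^sup>+X. (\<Sum>k\<in>B. \<integral>\<^sup>+x. ennreal ((x - \<theta> k + psi X x)\<^sup>2) \<partial>Nrm (\<theta> k)) \<partial>P)"
      by (rule nn_integral_sum[symmetric]) (rule mk)
    also have "\<dots> = Rstar + ennreal n * A"
      unfolding eq A_def using mA by (simp add: nn_integral_add nn_integral_cmult P.emeasure_space_1)
    finally show ?thesis .
  qed
  have "total_risk (\<lambda>k X. (X k - \<theta> k + psi X (X k))\<^sup>2) \<le>
     (\<Sum>k\<in>B. ennreal ((1 + \<delta>)^3) * (\<integral>\<^sup>+X. \<integral>\<^sup>+x. ennreal ((x - \<theta> k + psi X x)\<^sup>2) \<partial>Nrm (\<theta> k) \<partial>P)
    + ennreal (2 * (1 + \<delta>) * \<delta> * (a\<^sup>2 + 1)))"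
    by (intro sum_mono own_risk_le)
  also have "\<dots> = ennreal ((1 + \<delta>)^3) * (Rstar + ennreal n * A) + ennreal n * ennreal (2 * (1 + \<delta>) * \<delta> * (a\<^sup>2 + 1))"
    by (simp add: sum.distrib sum n_def ennreal_of_nat_eq_real_of_nat flip: sum_distrib_left)
  also have "\<dots> = ennreal ((1 + \<delta>)^3) * Rstar + ennreal n * (ennreal ((1 + \<delta>)^3) * A + ennreal (2 * (1 + \<delta>) * \<delta> * (a\<^sup>2 + 1)))"
  proof -
    have "c * (R + m * A) + m * e = c * R + m * (c * A + e)" for c R m A e :: ennreal
      by (simp add: distrib_left mult_ac add_ac)
    then show ?thesis .
  qed
  finally have main: "total_risk (\<lambda>k X. (X k - \<theta> k + psi X (X k))\<^sup>2) \<le>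
    ennreal ((1 + \<delta>)^3) * Rstar + ennreal n * (ennreal ((1 + \<delta>)^3) * A + ennreal (2 * (1 + \<delta>) * \<delta> * (a\<^sup>2 + 1)))" .
  \<comment> \<open>The excess of the factor over 1 is \<open>O(\<delta>)\<close> and
    \<open>Rstar \<le> n\<close>, so the exchange costs at most a multiple of
    \<open>n * a\<^sup>2 / sqrt n\<close>, the order of the regret.\<close>
  have 1: "ennreal ((1 + \<delta>)^3) * Rstar \<le> Rstar + ennreal n * ennreal ((3 + 3 * \<delta>m + \<delta>m\<^sup>2) * \<delta>m * q)"
  proof -
    have "(1 + \<delta>)^3 = 1 + (3 + 3 * \<delta> + \<delta>\<^sup>2) * \<delta>" by (simp add: power3_eq_cube power2_eq_square algebra_simps)
    also have "\<dots> \<le> 1 + (3 + 3 * \<delta>m + \<delta>m\<^sup>2) * (\<delta>m * q)"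
      using dm delta dq1 by (intro add_left_mono mult_mono add_mono power_mono) auto
    finally have "(1 + \<delta>)^3 \<le> 1 + (3 + 3 * \<delta>m + \<delta>m\<^sup>2) * (\<delta>m * q)" .
    then have "ennreal ((1 + \<delta>)^3) * Rstar \<le> ennreal (1 + (3 + 3 * \<delta>m + \<delta>m\<^sup>2) * (\<delta>m * q)) * Rstar"
      by (intro mult_right_mono ennreal_leI) auto
    also have "\<dots> = Rstar + ennreal ((3 + 3 * \<delta>m + \<delta>m\<^sup>2) * (\<delta>m * q)) * Rstar"
      using dm q by (subst ennreal_plus) (auto simp: distrib_right)
    also have "\<dots> \<le> Rstar + ennreal ((3 + 3 * \<delta>m + \<delta>m\<^sup>2) * (\<delta>m * q)) * ennreal n"
      by (intro add_left_mono mult_left_mono Rstar_le_n) auto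
    finally show ?thesis by (simp add: mult_ac)
  qed
  have 2: "ennreal ((1 + \<delta>)^3) * A + ennreal (2 * (1 + \<delta>) * \<delta> * (a\<^sup>2 + 1)) \<le>
      ennreal Bm * (ennreal (Kreg * q) + 2 * trunc) + ennreal (4 * (1 + \<delta>m) * \<delta>m * q)"
  proof (rule add_mono)
    have "(1 + \<delta>)^3 \<le> Bm" unfolding Bm_def using dm delta by (intro power_mono) auto
    then show "ennreal ((1 + \<delta>)^3) * A \<le> ennreal Bm * (ennreal (Kreg * q) + 2 * trunc)"
      by (intro mult_mono A ennreal_leI) auto
    have "2 * (1 + \<delta>) * \<delta> * (a\<^sup>2 + 1) = 2 * (1 + \<delta>) * (\<delta> * a\<^sup>2 + \<delta>)" by (simp add: algebra_simps)
    also have "\<dots> \<le> 2 * (1 + \<delta>m) * (\<delta>m * q + \<delta>m * q)"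
    proof (rule mult_mono)
      show "\<delta> * a\<^sup>2 + \<delta> \<le> \<delta>m * q + \<delta>m * q" using dqa dq1 by (rule add_mono)
    qed (use dm delta(1) in auto)
    finally have "2 * (1 + \<delta>) * \<delta> * (a\<^sup>2 + 1) \<le> 4 * (1 + \<delta>m) * \<delta>m * q" by (simp add: algebra_simps)
    then show "ennreal (2 * (1 + \<delta>) * \<delta> * (a\<^sup>2 + 1)) \<le> ennreal (4 * (1 + \<delta>m) * \<delta>m * q)"
      by (rule ennreal_leI)
  qed
  have "total_risk (\<lambda>k X. (X k - \<theta> k + psi X (X k))\<^sup>2) \<le>
     Rstar + ennreal n * ennreal ((3 + 3 * \<delta>m + \<delta>m\<^sup>2) * \<delta>m * q) +
     ennreal n * (ennreal Bm * (ennreal (Kreg * q) + 2 * trunc) + ennreal (4 * (1 + \<delta>m) * \<delta>m * q))"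
    by (rule order_trans[OF main add_mono[OF 1 mult_left_mono[OF 2]]]) simp
  also have "\<dots> = Rstar + ennreal n * (ennreal (Kgeb * q) + ennreal (2 * Bm) * trunc)"
  proof -
    have Bm: "Bm \<ge> 0" using dm by (simp add: Bm_def)
    have "ennreal (Kgeb * q) = ennreal ((3 + 3 * \<delta>m + \<delta>m\<^sup>2) * \<delta>m * q) + ennreal Bm * ennreal (Kreg * q) + ennreal (4 * (1 + \<delta>m) * \<delta>m * q)"
    proof -
      have "ennreal Bm * ennreal (Kreg * q) = ennreal (Bm * Kreg * q)"
        using Bm Kreg q by (simp add: mult.assoc flip: ennreal_mult)
      moreover have "Kgeb * q = (3 + 3 * \<delta>m + \<delta>m\<^sup>2) * \<delta>m * q + Bm * Kreg * q + 4 * (1 + \<delta>m) * \<delta>m * q"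
        by (simp only: Kgeb_def distrib_right)
      moreover have "0 \<le> (3 + 3 * \<delta>m + \<delta>m\<^sup>2) * \<delta>m * q" "0 \<le> Bm * Kreg * q" "0 \<le> 4 * (1 + \<delta>m) * \<delta>m * q"
        using dm q Kreg Bm by auto
      ultimately show ?thesis by (simp only: ennreal_plus add_nonneg_nonneg)
    qed
    moreover have "ennreal (2 * Bm) = 2 * ennreal Bm"
      using Bm by (simp add: ennreal_mult)
    ultimately show ?thesis
      by (simp add: distrib_left mult_ac add_ac)
  qed
  finally show ?thesis by (simp add: q_def)
qed

end

section \<open>The truncation term\<close>

context geb_block
begin

text \<open>\<open>trunc\<close> is the average of these over the block for
  \<open>A = {x. f x < \<rho>}\<close>, so it can be bounded mean by mean.\<close>

definition score_mass :: "nat \<Rightarrow> real set \<Rightarrow> ennreal" where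
  "score_mass k A = (\<integral>\<^sup>+x. ennreal ((x - \<theta> k)\<^sup>2) * indicator A x \<partial>Nrm (\<theta> k))"

lemma score_mass_mono: "A \<subseteq> A' \<Longrightarrow> score_mass k A \<le> score_mass k A'"
  unfolding score_mass_def by (intro nn_integral_mono mult_left_mono) (auto split: split_indicator)

lemma score_mass_le_1: "score_mass k A \<le> 1"
  using score_mass_mono[of A UNIV k] by (simp add: score_mass_def nn_integral_Nrm_sq)

lemma score_mass_tail: "t \<ge> 1 \<Longrightarrow> A \<subseteq> {x. t \<le> \<bar>x - \<theta> k\<bar>} \<Longrightarrow> score_mass k A \<le> ennreal (2 * (t + 1) * gd t)"
  using score_mass_mono[of A "{x. t \<le> \<bar>x - \<theta> k\<bar>}" k] gd_tail[of t "\<theta> k"] unfolding score_mass_def by (meson order_trans)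

lemma g_integral:
  assumes [measurable]: "A \<in> sets borel"
  shows "(\<integral>\<^sup>+x. ennreal (g x) * indicator A x \<partial>lborel) = ennreal (1 / n) * (\<Sum>k\<in>B. score_mass k A)"
proof -
  have "(\<integral>\<^sup>+x. ennreal (g x) * indicator A x \<partial>lborel)
      = (\<integral>\<^sup>+x. ennreal (1 / n) * (\<Sum>k\<in>B. ennreal (gd (x - \<theta> k)) * (ennreal ((x - \<theta> k)\<^sup>2) * indicator A x)) \<partial>lborel)"
  proof (intro nn_integral_cong)
    fix x
    have "ennreal (g x) = ennreal (1 / n) * ennreal (\<Sum>k\<in>B. (x - \<theta> k)\<^sup>2 * gd (x - \<theta> k))"
      using n_pos by (simp add: mixq_def n_def sum_nonneg flip: ennreal_mult)
    also have "ennreal (\<Sum>k\<in>B. (x - \<theta> k)\<^sup>2 * gd (x - \<theta> k)) = (\<Sum>k\<in>B. ennreal (gd (x - \<theta> k)) * ennreal ((x - \<theta> k)\<^sup>2))"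
      by (simp add: mult.commute flip: ennreal_mult)
    finally show "ennreal (g x) * indicator A x = ennreal (1 / n) * (\<Sum>k\<in>B. ennreal (gd (x - \<theta> k)) * (ennreal ((x - \<theta> k)\<^sup>2) * indicator A x))"
      by (simp add: sum_distrib_right mult.assoc)
  qed
  also have "\<dots> = ennreal (1 / n) * (\<integral>\<^sup>+x. (\<Sum>k\<in>B. ennreal (gd (x - \<theta> k)) * (ennreal ((x - \<theta> k)\<^sup>2) * indicator A x)) \<partial>lborel)"
    by (rule nn_integral_cmult) measurable
  also have "(\<integral>\<^sup>+x. (\<Sum>k\<in>B. ennreal (gd (x - \<theta> k)) * (ennreal ((x - \<theta> k)\<^sup>2) * indicator A x)) \<partial>lborel)
      = (\<Sum>k\<in>B. \<integral>\<^sup>+x. ennreal (gd (x - \<theta> k)) * (ennreal ((x - \<theta> k)\<^sup>2) * indicator A x) \<partial>lborel)"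
    by (rule nn_integral_sum) measurable
  also have "\<dots> = (\<Sum>k\<in>B. score_mass k A)"
    unfolding score_mass_def by (intro sum.cong refl nn_integral_Nrm[symmetric]) measurable
  finally show ?thesis .
qed

lemma g_integral_le:
  assumes "A \<in> sets borel" and w: "\<And>k. k \<in> B \<Longrightarrow> score_mass k A \<le> ennreal (w k)" "\<And>k. k \<in> B \<Longrightarrow> w k \<ge> 0"
  shows "(\<integral>\<^sup>+x. ennreal (g x) * indicator A x \<partial>lborel) \<le> ennreal ((\<Sum>k\<in>B. w k) / n)"
proof -
  have "(\<Sum>k\<in>B. score_mass k A) \<le> (\<Sum>k\<in>B. ennreal (w k))" by (intro sum_mono w)
  also have "\<dots> = ennreal (\<Sum>k\<in>B. w k)" using w by (intro sum_ennreal) auto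
  finally have "ennreal (1 / n) * (\<Sum>k\<in>B. score_mass k A) \<le> ennreal (1 / n) * ennreal (\<Sum>k\<in>B. w k)"
    by (rule mult_left_mono) simp
  also have "\<dots> = ennreal ((\<Sum>k\<in>B. w k) / n)"
    using n_pos w by (simp add: sum_nonneg flip: ennreal_mult)
  finally show ?thesis by (simp add: g_integral[OF assms(1)])
qed

lemma f_less_rho_sets [measurable]: "{x. f x < \<rho>} \<in> sets borel"
  by measurable

lemma trunc_le_1: "trunc \<le> 1"
proof -
  have "trunc \<le> ennreal ((\<Sum>k\<in>B. 1) / n)"
    unfolding trunc_def by (rule g_integral_le) (auto simp: score_mass_le_1)
  then show ?thesis using n_pos by (simp add: n_def)
qed

lemma trunc_le_window:
  assumes L: "L \<ge> 3 * a"
  shows "trunc \<le> ennreal (2 * L * \<rho> * (lam * a\<^sup>2) + card {k\<in>B. \<bar>\<theta> k\<bar> > L / 2} / n + 2 / n)"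
proof -
  have L0: "L > 0" "L / 2 \<ge> 1" using L a_ge by auto
  \<comment> \<open>\<open>L \<ge> 3 * a\<close> gives \<open>t\<^sup>2 \<ge> 2 * a\<^sup>2\<close>.
    One half of the exponent in \<open>exp (- t\<^sup>2 / 2)\<close> then yields
    \<open>1 / n\<close>, and the other half absorbs the factor t.\<close>
  have tail: "2 * (L / 2 + 1) * gd (L / 2) \<le> 2 / n"
  proof -
    define t where "t = L / 2"
    have t: "t \<ge> 1" "t \<ge> 3 / 2 * a" using L0 L by (auto simp: t_def)
    have "(3 / 2 * a)\<^sup>2 \<le> t\<^sup>2" using t a_ge by (intro power_mono) auto
    then have "t\<^sup>2 \<ge> 2 * a\<^sup>2" using a_ge by (simp add: power_mult_distrib power2_eq_square)
    then have e1: "exp (- t\<^sup>2 / 4) \<le> 1 / n"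
      unfolding exp_a[symmetric] by simp
    have "1 + t\<^sup>2 / 4 \<le> exp (t\<^sup>2 / 4)" by (rule exp_ge_add_one_self)
    moreover have "t \<le> 1 + t\<^sup>2 / 4" using sum_squares_bound[of 1 "t / 2"] by (simp add: power_divide)
    ultimately have "t \<le> exp (t\<^sup>2 / 4)" by linarith
    then have e2: "t * exp (- t\<^sup>2 / 4) \<le> 1" by (simp add: exp_minus field_simps)
    have "gd t \<le> exp (- t\<^sup>2 / 2) / 2" unfolding gd_eq using sqrt_2pi by (intro divide_left_mono) auto
    also have "exp (- t\<^sup>2 / 2) = exp (- t\<^sup>2 / 4) * exp (- t\<^sup>2 / 4)" by (simp flip: exp_add)
    finally have "2 * (t + 1) * gd t \<le> 2 * (t + t) * (exp (- t\<^sup>2 / 4) * exp (- t\<^sup>2 / 4) / 2)"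
      using t by (intro mult_mono) auto
    also have "\<dots> = 2 * ((t * exp (- t\<^sup>2 / 4)) * exp (- t\<^sup>2 / 4))" by simp
    also have "\<dots> \<le> 2 * (1 * (1 / n))" using t e1 e2 by (intro mult_left_mono mult_mono) auto
    finally show ?thesis by (simp add: t_def)
  qed
  have "trunc \<le> (\<integral>\<^sup>+x. ennreal (\<rho> * (lam * a\<^sup>2)) * indicator {-L..L} x + ennreal (g x) * indicator {x. \<bar>x\<bar> > L} x \<partial>lborel)"
    unfolding trunc_def
  proof (intro nn_integral_mono)
    fix x
    show "ennreal (g x) * indicator {x. f x < \<rho>} x \<le> ennreal (\<rho> * (lam * a\<^sup>2)) * indicator {-L..L} x + ennreal (g x) * indicator {x. \<bar>x\<bar> > L} x"
      using g_le_a[of x] by (auto split: split_indicator intro!: ennreal_leI simp: max_def)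
  qed
  also have "\<dots> = (\<integral>\<^sup>+x. ennreal (\<rho> * (lam * a\<^sup>2)) * indicator {-L..L} x \<partial>lborel) + (\<integral>\<^sup>+x. ennreal (g x) * indicator {x. \<bar>x\<bar> > L} x \<partial>lborel)"
    by (rule nn_integral_add) measurable
  also have "(\<integral>\<^sup>+x. ennreal (\<rho> * (lam * a\<^sup>2)) * indicator {-L..L} x \<partial>lborel) = ennreal (\<rho> * (lam * a\<^sup>2)) * ennreal (2 * L)"
    using L0 by (simp add: nn_integral_cmult_indicator)
  also have "\<dots> = ennreal (2 * L * \<rho> * (lam * a\<^sup>2))"
    using L0 rho_pos lam by (simp add: mult_ac flip: ennreal_mult)
  also have "(\<integral>\<^sup>+x. ennreal (g x) * indicator {x. \<bar>x\<bar> > L} x \<partial>lborel) \<le>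
      ennreal ((\<Sum>k\<in>B. (if \<bar>\<theta> k\<bar> > L / 2 then 1 else 0) + 2 / n) / n)"
  proof (rule g_integral_le)
    fix k assume "k \<in> B"
    show "score_mass k {x. L < \<bar>x\<bar>} \<le> ennreal ((if \<bar>\<theta> k\<bar> > L / 2 then 1 else 0) + 2 / n)"
    proof (cases "\<bar>\<theta> k\<bar> > L / 2")
      case True
      then have "ennreal 1 \<le> ennreal ((if \<bar>\<theta> k\<bar> > L / 2 then 1 else 0) + 2 / n)"
        using True n_pos by (intro ennreal_leI) simp
      then have "1 \<le> ennreal ((if \<bar>\<theta> k\<bar> > L / 2 then 1 else 0) + 2 / n)"
        by (simp only: ennreal_1)
      with score_mass_le_1 show ?thesis by (rule order_trans)
    next
      case False
      have "L / 2 \<le> \<bar>x - \<theta> k\<bar>" if "L < \<bar>x\<bar>" for x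
        using abs_triangle_ineq[of "x - \<theta> k" "\<theta> k"] that False by simp
      then have "{x. L < \<bar>x\<bar>} \<subseteq> {x. L / 2 \<le> \<bar>x - \<theta> k\<bar>}" by auto
      from score_mass_tail[OF L0(2) this] show ?thesis
        by (rule order_trans, intro ennreal_leI) (use tail False in simp)
    qed
    show "(if \<bar>\<theta> k\<bar> > L / 2 then 1 else 0) + 2 / n \<ge> 0" using n_pos by simp
  qed measurable
  also have "(\<Sum>k\<in>B. (if \<bar>\<theta> k\<bar> > L / 2 then 1 else 0) + 2 / n) / n = card {k\<in>B. \<bar>\<theta> k\<bar> > L / 2} / n + 2 / n"
    using n_pos fin by (simp add: sum.distrib sum.If_cases n_def[symmetric] Int_def add_divide_distrib)
  also have "ennreal (2 * L * \<rho> * (lam * a\<^sup>2)) + ennreal (card {k\<in>B. \<bar>\<theta> k\<bar> > L / 2} / n + 2 / n)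
     = ennreal (2 * L * \<rho> * (lam * a\<^sup>2) + card {k\<in>B. \<bar>\<theta> k\<bar> > L / 2} / n + 2 / n)"
    using L0 rho_pos lam n_pos by (simp add: add.assoc flip: ennreal_plus)
  finally show ?thesis by (auto intro: add_left_mono)
qed

text \<open>The common measure of sparsity. It bounds soft thresholding and, up to
  \<open>a\<^sup>2 / sqrt n\<close>, the truncation term; it is comparable to the mean of the test
  statistic up to \<open>ln n\<close>, and at most the second entry of the rate.\<close>

definition energy :: real where "energy = (\<Sum>k\<in>B. min ((\<theta> k)\<^sup>2) (ln n)) / n"

lemma energy_nonneg: "energy \<ge> 0"
  unfolding energy_def using ln_n n_pos by (intro divide_nonneg_nonneg sum_nonneg) auto

text \<open>Half of the components suffice, each evaluated at its largest possible distance from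
  x.\<close>

lemma f_ge_half:
  assumes "real (card {k\<in>B. \<bar>\<theta> k\<bar> \<le> t}) \<ge> n / 2"
  shows "f x \<ge> gd (\<bar>x\<bar> + t) / 2"
proof -
  have "n / 2 * gd (\<bar>x\<bar> + t) \<le> real (card {k\<in>B. \<bar>\<theta> k\<bar> \<le> t}) * gd (\<bar>x\<bar> + t)"
    using assms by (intro mult_right_mono) auto
  also have "\<dots> = (\<Sum>k\<in>{k\<in>B. \<bar>\<theta> k\<bar> \<le> t}. gd (\<bar>x\<bar> + t))" by simp
  also have "\<dots> \<le> (\<Sum>k\<in>{k\<in>B. \<bar>\<theta> k\<bar> \<le> t}. gd (x - \<theta> k))"
    by (intro sum_mono gd_mono) auto
  also have "\<dots> \<le> (\<Sum>k\<in>B. gd (x - \<theta> k))"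
    using fin by (intro sum_mono2) auto
  also have "\<dots> = n * f x" using n_pos by (simp add: mix_def n_def)
  finally show ?thesis using n_pos by (simp add: field_simps)
qed

definition "c3 = 7 + max 0 (ln r2)"

text \<open>With half of the means in \<open>[-1, 1]\<close>, f is at least half a Gaussian shifted
  by a bounded amount, and \<open>f < \<rho>\<close> with \<rho> of order
  \<open>a * exp (- a\<^sup>2 / 4)\<close> forces a deviation of order a, up to a constant.\<close>

lemma score_region_moderate:
  assumes h: "real (card {k\<in>B. \<bar>\<theta> k\<bar> \<le> 1}) \<ge> n / 2" and k: "\<bar>\<theta> k\<bar> \<le> 1" and x: "f x < \<rho>"
  shows "3 / 16 * a\<^sup>2 \<le> (x - \<theta> k)\<^sup>2 + c3"
proof -
  define z where "z = x - \<theta> k"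
  have "gd (\<bar>z\<bar> + 2) \<le> gd (\<bar>x\<bar> + 1)"
    using k by (intro gd_mono) (auto simp: z_def)
  also have "\<dots> < 2 * \<rho>" using f_ge_half[OF h, of x] x by simp
  finally have "exp (- (\<bar>z\<bar> + 2)\<^sup>2 / 2) < sqrt (2 * pi) * (2 * \<rho>)"
    unfolding gd_eq by (simp add: pos_divide_less_eq mult.commute)
  also have "\<dots> \<le> 3 * (2 * \<rho>)"
    using sqrt_2pi rho_pos by (intro mult_right_mono) auto
  finally have "ln (exp (- (\<bar>z\<bar> + 2)\<^sup>2 / 2)) < ln (6 * \<rho>)"
    using rho_pos by (subst ln_less_cancel_iff) auto
  then have 1: "- (\<bar>z\<bar> + 2)\<^sup>2 / 2 < ln 6 + ln \<rho>" using rho_pos by (simp add: ln_mult)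
  have "ln (6::real) \<le> 2"
  proof -
    have "(6::real) \<le> (1 + 1 + 1/2)\<^sup>2" by (simp add: power2_eq_square)
    also have "\<dots> \<le> (exp 1)\<^sup>2" using exp_lower_Taylor_quadratic[of 1] by (intro power_mono) auto
    finally have "(6::real) \<le> exp 2" by (simp flip: exp_double)
    then show ?thesis using ln_mono[of 6 "exp 2"] by simp
  qed
  moreover have "ln \<rho> = ln r + ln a - ln n / 2"
    using rho_pos a_ge n_pos unfolding \<rho>_def by (simp add: ln_mult ln_div ln_sqrt)
  \<comment> \<open>The logarithm of \<rho> contributes \<open>ln n / 2 = a\<^sup>2 / 4\<close>;
    charging \<open>ln a\<close> to \<open>a\<^sup>2 / 16\<close> leaves
    \<open>1 / 4 - 1 / 16 = 3 / 16\<close>.\<close>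
  moreover have "ln a \<le> a\<^sup>2 / 16 + 1"
  proof -
    have "ln (a\<^sup>2 / 8) \<le> a\<^sup>2 / 8 - 1" using a_ge by (intro ln_le_minus_one) auto
    moreover have "ln (a\<^sup>2 / 8) = 2 * ln a - 3 * ln 2"
      using a_ge ln_realpow[of 2 3] by (simp add: ln_div ln_realpow)
    moreover have "ln (2::real) \<le> 1" using ln_le_minus_one[of 2] by simp
    ultimately show ?thesis by simp
  qed
  moreover have "ln r \<le> max 0 (ln r2)" using r by (auto simp: max_def intro: order_trans[of _ "ln r2"])
  moreover have "ln n = a\<^sup>2 / 2" by (simp add: a_sq)
  moreover have "(\<bar>z\<bar> + 2)\<^sup>2 \<le> 2 * z\<^sup>2 + 8"
    using sum_squares_bound[of "\<bar>z\<bar>" 2] by (simp add: power2_sum)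
  ultimately show ?thesis using 1 unfolding c3_def z_def[symmetric] by linarith
qed

text \<open>A Chebyshev step: on the region \<open>w * ((x - \<theta> k)\<^sup>2 + c3)\<close> is at
  least 1, and inserting this factor bounds the second moment by w times moments of order at most
  four. This gains \<open>1 / a\<^sup>2\<close>.\<close>

lemma score_mass_moderate:
  assumes "real (card {k\<in>B. \<bar>\<theta> k\<bar> \<le> 1}) \<ge> n / 2" "\<bar>\<theta> k\<bar> \<le> 1"
  shows "score_mass k {x. f x < \<rho>} \<le> ennreal (16 / 3 * (3 + c3) / a\<^sup>2)"
proof -
  interpret Nk: prob_space "Nrm (\<theta> k)" by simp
  have c3: "c3 \<ge> 0" by (simp add: c3_def)
  define w where "w = 16 / 3 / a\<^sup>2"
  have w: "w \<ge> 0" by (simp add: w_def)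
  have "score_mass k {x. f x < \<rho>} \<le> (\<integral>\<^sup>+x. ennreal w * (ennreal ((x - \<theta> k)^4) + ennreal c3 * ennreal ((x - \<theta> k)\<^sup>2)) \<partial>Nrm (\<theta> k))"
    unfolding score_mass_def
  proof (intro nn_integral_mono)
    fix x
    have "(x - \<theta> k)\<^sup>2 \<le> w * ((x - \<theta> k)^4 + c3 * (x - \<theta> k)\<^sup>2)" if "f x < \<rho>"
    proof -
      have "1 \<le> w * ((x - \<theta> k)\<^sup>2 + c3)"
        using score_region_moderate[OF assms that] a_ge by (simp add: w_def field_simps)
      then have "1 * (x - \<theta> k)\<^sup>2 \<le> w * ((x - \<theta> k)\<^sup>2 + c3) * (x - \<theta> k)\<^sup>2"
        by (rule mult_right_mono) simp
      then show ?thesis by (simp add: algebra_simps power4_eq_xxxx power2_eq_square)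
    qed
    then show "ennreal ((x - \<theta> k)\<^sup>2) * indicator {x. f x < \<rho>} x \<le> ennreal w * (ennreal ((x - \<theta> k)^4) + ennreal c3 * ennreal ((x - \<theta> k)\<^sup>2))"
      using c3 w by (auto split: split_indicator simp: ennreal_leI simp flip: ennreal_mult ennreal_plus)
  qed
  also have "\<dots> = ennreal w * (3 + ennreal c3 * 1)"
    by (simp add: nn_integral_cmult nn_integral_add nn_integral_Nrm_4 nn_integral_Nrm_sq)
  also have "\<dots> = ennreal (w * (3 + c3))"
    using w c3 by (simp add: ennreal_mult ennreal_plus)
  finally show ?thesis by (simp add: w_def)
qed

text \<open>The 6 is 2, for using only half of the means, times the bound 3 for
  \<open>sqrt (2 * pi)\<close>. The exponential pays for shifting a Gaussian by
  \<open>2 * sqrt 2 / a\<close> at distances up to \<open>sqrt lam * a\<close>.\<close>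

definition "\<kappa>0 = 6 * exp (4 * sqrt lam + 4)"

text \<open>A shift of order \<open>1 / a\<close> changes the Gaussian at distance
  \<open>O(a)\<close> only by a bounded factor. So f is bounded below like one Gaussian centred at
  the k-th mean, \<open>f < \<rho>\<close> becomes a tail event of level \<rho>, and the second
  moment on it is \<open>O(a * \<rho>)\<close>, which is
  \<open>O(a\<^sup>2 / sqrt n)\<close>.\<close>

lemma score_mass_small:
  assumes h: "real (card {k\<in>B. \<bar>\<theta> k\<bar> \<le> sqrt 2 / a}) \<ge> n / 2" and k: "\<bar>\<theta> k\<bar> \<le> sqrt 2 / a"
  shows "score_mass k {x. f x < \<rho>} \<le> ennreal (4 * sqrt lam * \<kappa>0 * (a * \<rho>))"
proof -
  define A where "A = sqrt lam"
  have A: "A \<ge> 1" "A\<^sup>2 = lam" using lam by (auto simp: A_def)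
  have \<kappa>0: "\<kappa>0 \<ge> 6" using A by (simp add: \<kappa>0_def A_def[symmetric])
  \<comment> \<open>\<open>y\<close> solves \<open>exp (- y\<^sup>2 / 2) = \<kappa>0 * \<rho>\<close>, up to truncation at \<open>0\<close>\<close>
  define y where "y = sqrt (max 0 (2 * ln (1 / (\<kappa>0 * \<rho>))))"
  have y0: "y \<ge> 0" by (simp add: y_def)
  have y2: "y\<^sup>2 = max 0 (2 * ln (1 / (\<kappa>0 * \<rho>)))" by (simp add: y_def)
  have "y \<le> A * a"
  proof -
    have "ln (1 / (\<kappa>0 * \<rho>)) \<le> ln (1 / \<rho>)"
      using \<kappa>0 rho_pos by (subst ln_le_cancel_iff) (auto simp: field_simps)
    then have "y\<^sup>2 \<le> lam * a\<^sup>2" using lam_a unfolding y2 by (auto simp: max_def split: if_splits)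
    also have "\<dots> = (A * a)\<^sup>2" by (simp add: power_mult_distrib A)
    finally show ?thesis by (rule power2_le_imp_le) (use A a_ge in simp)
  qed
  have s2: "sqrt 2 \<le> 2" using real_sqrt_le_iff[of 2 4] by simp
  define \<eta> where "\<eta> = 2 * sqrt 2 / a"
  have \<eta>: "\<eta> \<ge> 0" "\<eta> * a \<le> 4" "\<eta>\<^sup>2 / 2 \<le> 4"
  proof -
    show "\<eta> \<ge> 0" "\<eta> * a \<le> 4" using a_ge s2 by (auto simp: \<eta>_def)
    have "\<eta>\<^sup>2 / 2 = 4 / a\<^sup>2" by (simp add: \<eta>_def power_divide power_mult_distrib)
    also have "\<dots> \<le> 4" using a_ge by (simp add: divide_le_eq)
    finally show "\<eta>\<^sup>2 / 2 \<le> 4" .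
  qed
  have sub: "{x. f x < \<rho>} \<subseteq> {x. y \<le> \<bar>x - \<theta> k\<bar>}"
  proof safe
    fix x assume x: "f x < \<rho>"
    define z where "z = x - \<theta> k"
    show "y \<le> \<bar>x - \<theta> k\<bar>"
    proof (cases "\<bar>z\<bar> \<le> A * a")
      case False
      then show ?thesis using \<open>y \<le> A * a\<close> by (simp add: z_def)
    next
      case True
      have "gd (\<bar>z\<bar> + \<eta>) \<le> gd (\<bar>x\<bar> + sqrt 2 / a)"
        using k a_ge by (intro gd_mono) (auto simp: z_def \<eta>_def)
      also have "\<dots> < 2 * \<rho>" using f_ge_half[OF h, of x] x by simp
      finally have "exp (- (\<bar>z\<bar> + \<eta>)\<^sup>2 / 2) < sqrt (2 * pi) * (2 * \<rho>)"
        unfolding gd_eq by (simp add: pos_divide_less_eq mult.commute)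
      also have "\<dots> \<le> 3 * (2 * \<rho>)"
        using sqrt_2pi rho_pos by (intro mult_right_mono) auto
      finally have "exp (- (\<bar>z\<bar> + \<eta>)\<^sup>2 / 2) * exp (\<eta> * \<bar>z\<bar> + \<eta>\<^sup>2 / 2) < 6 * \<rho> * exp (\<eta> * \<bar>z\<bar> + \<eta>\<^sup>2 / 2)"
        by (intro mult_strict_right_mono) auto
      also have "exp (- (\<bar>z\<bar> + \<eta>)\<^sup>2 / 2) * exp (\<eta> * \<bar>z\<bar> + \<eta>\<^sup>2 / 2) = exp (- z\<^sup>2 / 2)"
        by (simp add: power2_sum field_simps flip: exp_add)
      also have "6 * \<rho> * exp (\<eta> * \<bar>z\<bar> + \<eta>\<^sup>2 / 2) \<le> \<kappa>0 * \<rho>"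
      proof -
        have "\<eta> * \<bar>z\<bar> \<le> \<eta> * (A * a)" using True \<eta> by (intro mult_left_mono) auto
        also have "\<dots> = A * (\<eta> * a)" by simp
        also have "\<dots> \<le> A * 4" using \<eta> A by (intro mult_left_mono) auto
        finally have "exp (\<eta> * \<bar>z\<bar> + \<eta>\<^sup>2 / 2) \<le> exp (4 * sqrt lam + 4)" using \<eta> by (simp add: A_def)
        then show ?thesis using rho_pos by (simp add: \<kappa>0_def)
      qed
      finally have "ln (exp (- z\<^sup>2 / 2)) < ln (\<kappa>0 * \<rho>)"
        using \<kappa>0 rho_pos by (subst ln_less_cancel_iff) auto
      then have "z\<^sup>2 \<ge> 2 * ln (1 / (\<kappa>0 * \<rho>))" using \<kappa>0 rho_pos by (simp add: ln_div)
      then have "y\<^sup>2 \<le> z\<^sup>2" unfolding y2 by simp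
      then show ?thesis using y0 unfolding z_def[symmetric] by (simp add: abs_le_square_iff[symmetric])
    qed
  qed
  show ?thesis
  proof (cases "y \<ge> 1")
    case True
    then have "y\<^sup>2 = 2 * ln (1 / (\<kappa>0 * \<rho>))"
      unfolding y2 by (auto simp: y_def max_def split: if_splits)
    then have e: "exp (- y\<^sup>2 / 2) = \<kappa>0 * \<rho>" using \<kappa>0 rho_pos by (simp add: ln_div)
    have "gd y \<le> exp (- y\<^sup>2 / 2) / 1"
      unfolding gd_eq using pi_ge_3 by (intro divide_left_mono) auto
    then have gy: "gd y \<le> \<kappa>0 * \<rho>" using e by simp
    have "2 * (y + 1) * gd y \<le> 2 * (A * a + A * a) * (\<kappa>0 * \<rho>)"
      using gy \<open>y \<le> A * a\<close> True by (intro mult_mono) auto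
    also have "\<dots> = 4 * sqrt lam * \<kappa>0 * (a * \<rho>)" by (simp add: A_def)
    finally show ?thesis
      using score_mass_tail[OF True sub] by (meson ennreal_leI order_trans)
  next
    \<comment> \<open>Here \<open>\<kappa>0 * \<rho>\<close> is bounded below by a constant, and the
      trivial bound 1 is good enough.\<close>
    case False
    then have "y\<^sup>2 \<le> 1" using y0 by (simp add: power_le_one)
    then have "ln (1 / (\<kappa>0 * \<rho>)) \<le> 1 / 2" unfolding y2 by simp
    then have "exp (ln (1 / (\<kappa>0 * \<rho>))) \<le> exp (1 / 2)" by (simp only: exp_le_cancel_iff)
    then have "1 / (\<kappa>0 * \<rho>) \<le> exp (1 / 2)" using \<kappa>0 rho_pos by simp
    also have "exp (1 / 2) \<le> (4::real)"
    proof -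
      have "exp (1 / 2) \<le> exp (1::real)" by simp
      then show ?thesis using exp_le by linarith
    qed
    finally have "1 \<le> 4 * (\<kappa>0 * \<rho>)" using \<kappa>0 rho_pos by (simp add: field_simps)
    also have "\<dots> \<le> 4 * sqrt lam * \<kappa>0 * (a * \<rho>)"
    proof -
      have "1 * 1 \<le> A * a" using A a_ge by (intro mult_mono) auto
      then have "4 * (\<kappa>0 * \<rho>) * 1 \<le> 4 * (\<kappa>0 * \<rho>) * (A * a)" using \<kappa>0 rho_pos by (intro mult_left_mono) auto
      then show ?thesis by (simp add: A_def mult_ac)
    qed
    finally show ?thesis by (rule le_ennreal_of_le_1[OF score_mass_le_1])
  qed
qed

definition "KT = 2 + 16 / 3 * (3 + c3) + 4 * sqrt lam * \<kappa>0 * r2"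

text \<open>
  For \<open>p\<close> near \<open>2\<close> and sparse means the entry \<open>C powr p / ln n powr (p / 2 - 1)\<close> of the rate is smaller than
  \<open>(ln n)\<^sup>2 / sqrt n\<close> by a power of \<open>ln n\<close>, so that \<open>trunc_le_window\<close> does not suffice.
\<close>

lemma trunc_le_energy: "trunc \<le> ennreal (KT * (energy + a\<^sup>2 / sqrt n))"
proof -
  define m where "m = (\<lambda>k. min ((\<theta> k)\<^sup>2) (ln n))"
  define C where "C = 16 / 3 * (3 + c3)"
  define C' where "C' = 4 * sqrt lam * \<kappa>0 * r2"
  define q where "q = a\<^sup>2 / sqrt n"
  have q: "q \<ge> 0" using n_pos by (simp add: q_def)
  have C: "C \<ge> 0" "C' \<ge> 0" using lam r by (auto simp: C_def C'_def c3_def \<kappa>0_def)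
  have KT: "KT = 2 + C + C'" by (simp add: KT_def C_def C'_def)
  have m0: "m k \<ge> 0" for k using ln_n by (simp add: m_def)
  have m1: "m k \<ge> 1" if "\<bar>\<theta> k\<bar> > 1" for k
    using that ln_n power_mono[of 1 "\<bar>\<theta> k\<bar>" 2] by (simp add: m_def)
  have energy: "energy = sum m B / n" by (simp add: energy_def m_def)
  have count: "real (card {k\<in>B. \<not> \<bar>\<theta> k\<bar> \<le> t}) * e \<le> n * energy" if "\<And>k. \<not> \<bar>\<theta> k\<bar> \<le> t \<Longrightarrow> m k \<ge> e" for t e
  proof -
    have "real (card {k\<in>B. \<not> \<bar>\<theta> k\<bar> \<le> t}) * e = (\<Sum>k\<in>{k\<in>B. \<not> \<bar>\<theta> k\<bar> \<le> t}. e)" by simp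
    also have "\<dots> \<le> (\<Sum>k\<in>{k\<in>B. \<not> \<bar>\<theta> k\<bar> \<le> t}. m k)" using that by (intro sum_mono) auto
    also have "\<dots> \<le> sum m B" using fin m0 by (intro sum_mono2) auto
    finally show ?thesis using n_pos by (simp add: energy)
  qed
  have compl: "real (card {k\<in>B. \<bar>\<theta> k\<bar> \<le> t}) + real (card {k\<in>B. \<not> \<bar>\<theta> k\<bar> \<le> t}) = n" for t
  proof -
    have "card {k\<in>B. \<bar>\<theta> k\<bar> \<le> t} + card {k\<in>B. \<not> \<bar>\<theta> k\<bar> \<le> t} = card ({k\<in>B. \<bar>\<theta> k\<bar> \<le> t} \<union> {k\<in>B. \<not> \<bar>\<theta> k\<bar> \<le> t})"
      using fin by (intro card_Un_disjoint[symmetric]) auto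
    also have "{k\<in>B. \<bar>\<theta> k\<bar> \<le> t} \<union> {k\<in>B. \<not> \<bar>\<theta> k\<bar> \<le> t} = B" by auto
    finally show ?thesis by (simp add: n_def)
  qed
  have Tw: "trunc \<le> ennreal (sum w B / n)"
    if "\<And>k. k \<in> B \<Longrightarrow> score_mass k {x. f x < \<rho>} \<le> ennreal (w k)" "\<And>k. k \<in> B \<Longrightarrow> w k \<ge> 0" for w
    unfolding trunc_def by (rule g_integral_le) (use that in auto)
  have S0: "energy \<ge> 0" by (rule energy_nonneg)
  have ratio: "2 / a\<^sup>2 \<le> 1" "2 / a\<^sup>2 > 0" using a_ge by auto
  have m2: "m k \<ge> 2 / a\<^sup>2" if "\<not> \<bar>\<theta> k\<bar> \<le> sqrt 2 / a" for k
  proof -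
    have "(sqrt 2 / a)\<^sup>2 \<le> \<bar>\<theta> k\<bar>\<^sup>2" using that a_ge by (intro power_mono) auto
    then have "2 / a\<^sup>2 \<le> (\<theta> k)\<^sup>2" by (simp add: power_divide)
    then show ?thesis unfolding m_def by (rule min.boundedI) (use ratio ln_n in linarith)
  qed
  show ?thesis
  proof (cases "energy < 1 / 2")
    case False
    then have "1 \<le> 2 * energy" by simp
    also have "\<dots> \<le> KT * energy" using C S0 by (simp add: KT mult_right_mono)
    also have "\<dots> \<le> KT * (energy + q)" using C q by (intro mult_left_mono) (auto simp: KT)
    finally show ?thesis unfolding q_def by (rule le_ennreal_of_le_1[OF trunc_le_1])
  next
    case True
    have half1: "real (card {k\<in>B. \<bar>\<theta> k\<bar> \<le> 1}) \<ge> n / 2"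
    proof -
      have "real (card {k\<in>B. \<not> \<bar>\<theta> k\<bar> \<le> 1}) * 1 \<le> n * energy" by (rule count) (use m1 in auto)
      also have "\<dots> \<le> n * (1 / 2)" using True n_pos by (intro mult_left_mono) auto
      finally show ?thesis using compl[of 1] by linarith
    qed
    note mod = score_mass_moderate[OF half1, folded C_def]
    show ?thesis
    \<comment> \<open>At the cut \<open>sqrt 2 / a\<close> the square
      \<open>\<theta>\<^sup>2\<close> reaches \<open>2 / a\<^sup>2\<close>, the order of
      \<open>score_mass_moderate\<close>. Means above the cut are paid for by their own energy,
      means below it by \<open>score_mass_small\<close>, provided that the latter are half of the
      block.\<close>
    proof (cases "real (card {k\<in>B. \<bar>\<theta> k\<bar> \<le> sqrt 2 / a}) \<ge> n / 2")
      case half2: True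
      define w where "w = (\<lambda>k. (1 + C) * m k + C' * q)"
      have "trunc \<le> ennreal (sum w B / n)"
      proof (rule Tw)
        fix k assume "k \<in> B"
        show "w k \<ge> 0" using C m0 q by (simp add: w_def)
        consider "\<bar>\<theta> k\<bar> > 1" | "\<bar>\<theta> k\<bar> \<le> 1" "\<not> \<bar>\<theta> k\<bar> \<le> sqrt 2 / a" | "\<bar>\<theta> k\<bar> \<le> sqrt 2 / a" by linarith
        then show "score_mass k {x. f x < \<rho>} \<le> ennreal (w k)"
        proof cases
          case 1
          have "1 \<le> w k" using m1[OF 1] C m0[of k] q by (simp add: w_def distrib_right add_increasing2)
          with score_mass_le_1 show ?thesis by (rule le_ennreal_of_le_1)
        next
          case 2
          have "C / a\<^sup>2 \<le> C * (2 / a\<^sup>2)" using C by (simp add: divide_right_mono)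
          also have "\<dots> \<le> C * m k" using m2[OF 2(2)] C by (intro mult_left_mono) auto
          also have "\<dots> \<le> w k" using C m0[of k] q by (simp add: w_def distrib_right)
          finally show ?thesis using mod[OF 2(1)] by (meson ennreal_leI order_trans)
        next
          case 3
          have "a * \<rho> \<le> r2 * q" using r a_ge n_pos
            by (simp add: \<rho>_def q_def power2_eq_square divide_right_mono mult_right_mono)
          then have "4 * sqrt lam * \<kappa>0 * (a * \<rho>) \<le> 4 * sqrt lam * \<kappa>0 * (r2 * q)"
            using lam by (intro mult_left_mono) (auto simp: \<kappa>0_def)
          also have "\<dots> = C' * q" by (simp add: C'_def)
          also have "\<dots> \<le> w k" using C m0[of k] by (simp add: w_def)
          finally show ?thesis using score_mass_small[OF half2 3] by (meson ennreal_leI order_trans)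
        qed
      qed
      also have "sum w B / n = (1 + C) * energy + C' * q"
        using n_pos by (simp add: w_def sum.distrib energy n_def add_divide_distrib flip: sum_distrib_left)
      also have "\<dots> \<le> KT * energy + KT * q" using C S0 q by (intro add_mono mult_right_mono) (auto simp: KT)
      finally show ?thesis by (simp add: q_def distrib_left ennreal_leI order_trans)
    next
      case False
      \<comment> \<open>In the other case half of the means contribute at least
        \<open>2 / a\<^sup>2\<close> each, so \<open>energy \<ge> 1 / a\<^sup>2\<close>, and the
        moderate bound is itself of the order of \<open>energy\<close>.\<close>
      then have "n / 2 \<le> real (card {k\<in>B. \<not> \<bar>\<theta> k\<bar> \<le> sqrt 2 / a})" using compl[of "sqrt 2 / a"] by linarith
      then have "n / 2 * (2 / a\<^sup>2) \<le> real (card {k\<in>B. \<not> \<bar>\<theta> k\<bar> \<le> sqrt 2 / a}) * (2 / a\<^sup>2)"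
        using ratio by (intro mult_right_mono) auto
      also have "\<dots> \<le> n * energy" by (rule count) (rule m2)
      finally have "n * (1 / a\<^sup>2) \<le> n * energy" by simp
      then have aS: "1 / a\<^sup>2 \<le> energy" using n_pos by (simp only: mult_le_cancel_left_pos)
      define w where "w = (\<lambda>k. m k + C * energy)"
      have "trunc \<le> ennreal (sum w B / n)"
      proof (rule Tw)
        fix k assume "k \<in> B"
        show "w k \<ge> 0" using C m0 S0 by (simp add: w_def)
        show "score_mass k {x. f x < \<rho>} \<le> ennreal (w k)"
        proof (cases "\<bar>\<theta> k\<bar> > 1")
          case True
          have "1 \<le> w k" using m1[OF True] C S0 by (simp add: w_def add_increasing2)
          with score_mass_le_1 show ?thesis by (rule le_ennreal_of_le_1)
        next
          case False
          have "C / a\<^sup>2 = C * (1 / a\<^sup>2)" by simp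
          also have "\<dots> \<le> C * energy" using aS C by (intro mult_left_mono)
          also have "\<dots> \<le> w k" using m0[of k] by (simp add: w_def)
          finally show ?thesis using mod[of k] False by (meson ennreal_leI order_trans not_le)
        qed
      qed
      also have "sum w B / n = (1 + C) * energy"
        using n_pos by (simp add: w_def sum.distrib energy n_def add_divide_distrib distrib_right)
      also have "\<dots> \<le> KT * (energy + q)" using C S0 q by (intro mult_mono) (auto simp: KT)
      finally show ?thesis by (simp add: q_def ennreal_leI order_trans)
    qed
  qed
qed

end

section \<open>Soft thresholding and the sparsity test\<close>

definition soft :: "real \<Rightarrow> real \<Rightarrow> real" where
  "soft t x = sgn x * max 0 (\<bar>x\<bar> - t)"

lemma soft_lipschitz: "\<bar>soft t x - soft t y\<bar> \<le> \<bar>x - y\<bar>" if "t \<ge> 0"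
  using that by (auto simp: soft_def sgn_if max_def)

lemma soft_diff: "\<bar>soft t x - x\<bar> \<le> t" if "t \<ge> 0"
  using that by (auto simp: soft_def sgn_if max_def)

lemma soft_borel [measurable]: "soft t \<in> borel_measurable borel"
  unfolding soft_def[abs_def] sgn_if by measurable

text \<open>Beyond the threshold \<open>gd (t + u) \<le> gd t * exp (- t * u)\<close>, and
  \<open>u\<^sup>2 * exp (- t * u)\<close> integrates to \<open>2 / t^3\<close>. At
  \<open>t = a\<close>, where \<open>gd a\<close> is of order \<open>1 / n\<close>, n such terms add
  up to the order of the remainder \<open>(ln n + 1) powr (- 3 / 2)\<close>.\<close>

lemma soft_risk_0:
  assumes t: "t > 0"
  shows "(\<integral>\<^sup>+z. ennreal ((soft t (z - \<mu>))\<^sup>2) \<partial>Nrm \<mu>) \<le> ennreal (4 * gd t / t^3)"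
proof -
  define F where "F = (\<lambda>u. - (u\<^sup>2 / t + 2 * u / t\<^sup>2 + 2 / t^3) * exp (- t * u))"
  have lim: "(F \<longlongrightarrow> 0) at_top"
    unfolding F_def using t by real_asymp
  have der: "(F has_real_derivative u\<^sup>2 * exp (- t * u)) (at u)" for u
    unfolding F_def using t
    by (auto intro!: derivative_eq_intros simp: field_simps power2_eq_square power3_eq_cube)
  have I1: "(\<integral>\<^sup>+u. ennreal (u\<^sup>2 * exp (- t * u)) * indicator {0..} u \<partial>lborel) = ennreal (2 / t^3)"
  proof -
    have "(\<integral>\<^sup>+u. ennreal (u\<^sup>2 * exp (- t * u)) * indicator {0..} u \<partial>lborel) = ennreal (0 - F 0)"
      by (rule nn_integral_FTC_atLeast[OF _ der _ lim]) auto
    then show ?thesis by (simp add: F_def)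
  qed
  have I2: "(\<integral>\<^sup>+z. ennreal ((z - t)\<^sup>2 * gd z) * indicator {t..} z \<partial>lborel) \<le> ennreal (2 * gd t / t^3)"
  proof -
    have "(\<integral>\<^sup>+z. ennreal ((z - t)\<^sup>2 * gd z) * indicator {t..} z \<partial>lborel)
        = (\<integral>\<^sup>+u. ennreal (u\<^sup>2 * gd (t + u)) * indicator {0..} u \<partial>lborel)"
      by (subst nn_integral_real_affine[where c = 1 and t = t]) (auto simp: indicator_def)
    also have "\<dots> \<le> (\<integral>\<^sup>+u. ennreal (gd t) * (ennreal (u\<^sup>2 * exp (- t * u)) * indicator {0..} u) \<partial>lborel)"
    proof (intro nn_integral_mono)
      fix u :: real
      have "gd (t + u) \<le> gd t * exp (- t * u)"
      proof -
        have "exp (- (t + u)\<^sup>2 / 2) \<le> exp (- t\<^sup>2 / 2 + - t * u)"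
          by (subst exp_le_cancel_iff) (simp add: power2_sum field_simps)
        then have "exp (- (t + u)\<^sup>2 / 2) \<le> exp (- t\<^sup>2 / 2) * exp (- t * u)" by (simp only: exp_add)
        then show ?thesis unfolding gd_eq by (simp add: divide_right_mono)
      qed
      then have "u\<^sup>2 * gd (t + u) \<le> gd t * (u\<^sup>2 * exp (- t * u))"
        by (metis mult.left_commute mult_left_mono zero_le_power2)
      then show "ennreal (u\<^sup>2 * gd (t + u)) * indicator {0..} u \<le> ennreal (gd t) * (ennreal (u\<^sup>2 * exp (- t * u)) * indicator {0..} u)"
        by (auto split: split_indicator simp: ennreal_leI simp flip: ennreal_mult)
    qed
    also have "\<dots> = ennreal (gd t) * ennreal (2 / t^3)"
      by (subst nn_integral_cmult) (simp_all add: I1[simplified])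
    also have "\<dots> = ennreal (2 * gd t / t^3)" using t by (simp flip: ennreal_mult)
    finally show ?thesis .
  qed
  have "(\<integral>\<^sup>+z. ennreal ((soft t (z - \<mu>))\<^sup>2) \<partial>Nrm \<mu>) = (\<integral>\<^sup>+z. ennreal (gd (z - \<mu>)) * ennreal ((soft t (z - \<mu>))\<^sup>2) \<partial>lborel)"
    by (rule nn_integral_Nrm) measurable
  also have "\<dots> = (\<integral>\<^sup>+z. ennreal (gd z) * ennreal ((soft t z)\<^sup>2) \<partial>lborel)"
    by (subst nn_integral_real_affine[where c = 1 and t = \<mu>]) auto
  also have "\<dots> = (\<integral>\<^sup>+z. ennreal ((z - t)\<^sup>2 * gd z) * indicator {t..} z + ennreal ((-z - t)\<^sup>2 * gd (-z)) * indicator {t..} (-z) \<partial>lborel)"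
    using t by (intro nn_integral_cong)
      (auto simp: soft_def sgn_if max_def gd_eq mult.commute power2_commute[of "- _" t] split: split_indicator simp flip: ennreal_mult)
  also have "\<dots> = (\<integral>\<^sup>+z. ennreal ((z - t)\<^sup>2 * gd z) * indicator {t..} z \<partial>lborel) + (\<integral>\<^sup>+z. ennreal ((-z - t)\<^sup>2 * gd (-z)) * indicator {t..} (-z) \<partial>lborel)"
    by (rule nn_integral_add) measurable
  also have "(\<integral>\<^sup>+z. ennreal ((-z - t)\<^sup>2 * gd (-z)) * indicator {t..} (-z) \<partial>lborel) = (\<integral>\<^sup>+z. ennreal ((z - t)\<^sup>2 * gd z) * indicator {t..} z \<partial>lborel)"
    using nn_integral_lborel_uminus[of "\<lambda>z. ennreal ((z - t)\<^sup>2 * gd z) * indicator {t..} z"] by simp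
  also have "(\<integral>\<^sup>+z. ennreal ((z - t)\<^sup>2 * gd z) * indicator {t..} z \<partial>lborel) + (\<integral>\<^sup>+z. ennreal ((z - t)\<^sup>2 * gd z) * indicator {t..} z \<partial>lborel)
      \<le> ennreal (2 * gd t / t^3) + ennreal (2 * gd t / t^3)"
    by (intro add_mono I2)
  also have "\<dots> = ennreal (4 * gd t / t^3)"
    using t by (simp flip: ennreal_plus)
  finally show ?thesis .
qed

text \<open>Completing the square. The \<open>sqrt 2\<close> in \<open>geb_kappa\<close> cancels the
  one found here, which makes the test statistic unbiased for \<open>kap\<close> below.\<close>

lemma nn_integral_Nrm_exp: "(\<integral>x. exp (- x\<^sup>2 / 2) \<partial>Nrm \<mu>) = exp (- \<mu>\<^sup>2 / 4) / sqrt 2"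
proof -
  have "(\<integral>x. exp (- x\<^sup>2 / 2) \<partial>Nrm \<mu>) = (\<integral>x. gd (x - \<mu>) * exp (- x\<^sup>2 / 2) \<partial>lborel)"
    by (subst integral_density) (auto simp: normal_density_gd[of \<mu>])
  also have "(\<lambda>x. gd (x - \<mu>) * exp (- x\<^sup>2 / 2)) = (\<lambda>x. exp (- \<mu>\<^sup>2 / 4) / sqrt 2 * normal_density (\<mu> / 2) (1 / sqrt 2) x)"
  proof
    fix x
    have "- (x - \<mu>)\<^sup>2 / 2 + - x\<^sup>2 / 2 = - \<mu>\<^sup>2 / 4 + - (x - \<mu> / 2)\<^sup>2"
      by (simp add: power2_eq_square field_simps)
    then have "exp (- (x - \<mu>)\<^sup>2 / 2) * exp (- x\<^sup>2 / 2) = exp (- \<mu>\<^sup>2 / 4) * exp (- (x - \<mu> / 2)\<^sup>2)"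
      by (metis exp_add)
    then show "gd (x - \<mu>) * exp (- x\<^sup>2 / 2) = exp (- \<mu>\<^sup>2 / 4) / sqrt 2 * normal_density (\<mu> / 2) (1 / sqrt 2) x"
      by (simp add: gd_eq normal_density_def power_divide real_sqrt_mult)
  qed
  also have "(\<integral>x. exp (- \<mu>\<^sup>2 / 4) / sqrt 2 * normal_density (\<mu> / 2) (1 / sqrt 2) x \<partial>lborel) = exp (- \<mu>\<^sup>2 / 4) / sqrt 2"
    by simp
  finally show ?thesis .
qed

locale geb_test = geb_block +
  fixes b0 b :: real
  assumes b0: "b0 > 0"
  defines "b \<equiv> b0 * ln n / sqrt n"
begin

lemma b_pos: "b > 0"
proof -
  have "ln n > 0" using ln_n by linarith
  then show ?thesis
    using b0 n_pos(1) unfolding b_def by (intro divide_pos_pos mult_pos_pos real_sqrt_gt_zero)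
qed

definition kap :: real where "kap = (\<Sum>k\<in>B. 1 - exp (- (\<theta> k)\<^sup>2 / 4)) / n"

abbreviation "khat \<equiv> geb_kappa B"

lemma khat_measurable [measurable]: "khat \<in> borel_measurable P"
  unfolding geb_kappa_def[abs_def] by measurable

lemma khat_tail:
  assumes t: "t > 0"
  shows "P.prob {X\<in>space P. khat X \<ge> kap + t} \<le> exp (- n * t\<^sup>2)"
    and "P.prob {X\<in>space P. khat X \<le> kap - t} \<le> exp (- n * t\<^sup>2)"
proof -
  have ind: "P.indep_vars (\<lambda>_. borel) (\<lambda>k X. exp (- (X k)\<^sup>2 / 2)) B"
    using indep_coord[of "\<lambda>k x. exp (- x\<^sup>2 / 2)"] by simp
  interpret H: Hoeffding_ineq P B "\<lambda>k X. exp (- (X k)\<^sup>2 / 2)" "\<lambda>_. 0" "\<lambda>_. 1" "\<Sum>k\<in>B. P.expectation (\<lambda>X. exp (- (X k)\<^sup>2 / 2))"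
    by unfold_locales (use fin ind in auto)
  define \<mu> where "\<mu> = (\<Sum>k\<in>B. P.expectation (\<lambda>X. exp (- (X k)\<^sup>2 / 2)))"
  \<comment> \<open>A deviation t of \<open>khat\<close> corresponds to a deviation s of the sum in
    the opposite direction. The summands lie in \<open>[0, 1]\<close>, so the Hoeffding exponent
    \<open>- 2 * s\<^sup>2 / n\<close> equals \<open>- n * t\<^sup>2\<close>.\<close>
  define s where "s = n * t / sqrt 2"
  have s: "s \<ge> 0" "-2 * s\<^sup>2 / (\<Sum>i\<in>B. (1 - 0)\<^sup>2) = - n * t\<^sup>2"
    using t n_pos by (auto simp: s_def power_divide power_mult_distrib n_def power2_eq_square)
  have pos: "(\<Sum>i\<in>B. (1 - 0 :: real)\<^sup>2) > 0" using n_pos by (simp add: n_def)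
  have \<mu>: "\<mu> = n * (1 - kap) / sqrt 2"
  proof -
    have "P.expectation (\<lambda>X. exp (- (X k)\<^sup>2 / 2)) = exp (- (\<theta> k)\<^sup>2 / 4) / sqrt 2" if "k \<in> B" for k
      using integral_distr[of "\<lambda>X. X k" P borel "\<lambda>x. exp (- x\<^sup>2 / 2)"] coord_measurable[OF that]
      by (simp add: distr_coord[OF that] nn_integral_Nrm_exp[simplified])
    then have "\<mu> = (\<Sum>k\<in>B. exp (- (\<theta> k)\<^sup>2 / 4)) / sqrt 2"
      unfolding \<mu>_def by (simp add: sum_divide_distrib)
    moreover have "n * (1 - kap) = (\<Sum>k\<in>B. exp (- (\<theta> k)\<^sup>2 / 4))"
    proof -
      have "n * kap = (\<Sum>k\<in>B. 1 - exp (- (\<theta> k)\<^sup>2 / 4))" using n_pos by (simp add: kap_def)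
      also have "\<dots> = n - (\<Sum>k\<in>B. exp (- (\<theta> k)\<^sup>2 / 4))" by (simp add: sum_subtractf n_def)
      finally show ?thesis by (simp add: right_diff_distrib)
    qed
    ultimately show ?thesis by simp
  qed
  have kh: "khat X = kap - sqrt 2 / n * ((\<Sum>k\<in>B. exp (- (X k)\<^sup>2 / 2)) - \<mu>)" for X
  proof -
    have "sqrt 2 / n * \<mu> = 1 - kap" using n_pos by (simp add: \<mu>)
    then show ?thesis by (simp add: geb_kappa_def n_def[symmetric] right_diff_distrib)
  qed
  have sc: "sqrt 2 / n * s = t" using n_pos by (simp add: s_def)
  have sc2: "sqrt 2 / n > 0" using n_pos by simp
  have "{X\<in>space P. khat X \<ge> kap + t} = {X\<in>space P. (\<Sum>k\<in>B. exp (- (X k)\<^sup>2 / 2)) \<le> \<mu> - s}"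
  proof -
    have "khat X \<ge> kap + t \<longleftrightarrow> (\<Sum>k\<in>B. exp (- (X k)\<^sup>2 / 2)) \<le> \<mu> - s" for X
    proof -
      have "khat X \<ge> kap + t \<longleftrightarrow> sqrt 2 / n * s \<le> sqrt 2 / n * (\<mu> - (\<Sum>k\<in>B. exp (- (X k)\<^sup>2 / 2)))"
        unfolding kh sc by (auto simp: right_diff_distrib)
      also have "\<dots> \<longleftrightarrow> s \<le> \<mu> - (\<Sum>k\<in>B. exp (- (X k)\<^sup>2 / 2))" using sc2 by (simp only: mult_le_cancel_left_pos)
      finally show ?thesis by linarith
    qed
    then show ?thesis by simp
  qed
  then show "P.prob {X\<in>space P. khat X \<ge> kap + t} \<le> exp (- n * t\<^sup>2)"
    using H.Hoeffding_ineq_le[OF s(1) pos] unfolding s(2) \<mu>_def by simp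
  have "{X\<in>space P. khat X \<le> kap - t} = {X\<in>space P. (\<Sum>k\<in>B. exp (- (X k)\<^sup>2 / 2)) \<ge> \<mu> + s}"
  proof -
    have "khat X \<le> kap - t \<longleftrightarrow> (\<Sum>k\<in>B. exp (- (X k)\<^sup>2 / 2)) \<ge> \<mu> + s" for X
    proof -
      have "khat X \<le> kap - t \<longleftrightarrow> sqrt 2 / n * s \<le> sqrt 2 / n * ((\<Sum>k\<in>B. exp (- (X k)\<^sup>2 / 2)) - \<mu>)"
        unfolding kh sc by (auto simp: right_diff_distrib)
      also have "\<dots> \<longleftrightarrow> s \<le> (\<Sum>k\<in>B. exp (- (X k)\<^sup>2 / 2)) - \<mu>" using sc2 by (simp only: mult_le_cancel_left_pos)
      finally show ?thesis by linarith
    qed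
    then show ?thesis by simp
  qed
  then show "P.prob {X\<in>space P. khat X \<le> kap - t} \<le> exp (- n * t\<^sup>2)"
    using H.Hoeffding_ineq_ge[OF s(1) pos] unfolding s(2) \<mu>_def by simp
qed

definition "Kpi = exp (64 / b0\<^sup>2)"

lemma Kpi: "Kpi \<ge> 1"
  by (simp add: Kpi_def)

text \<open>\<open>n * b\<^sup>2\<close> is a multiple of \<open>(ln n)\<^sup>2\<close> and
  eventually exceeds any multiple of \<open>ln n\<close>; \<open>Kpi\<close> is the price for those
  n where it does not yet do so.\<close>

lemma exp_b: "t \<ge> b / 2 \<Longrightarrow> exp (- n * t\<^sup>2) \<le> Kpi / n^8"
proof -
  assume "t \<ge> b / 2"
  then have "(b / 2)\<^sup>2 \<le> t\<^sup>2" using b_pos by (intro power_mono) auto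
  then have "n * (b / 2)\<^sup>2 \<le> n * t\<^sup>2" using n_pos by (intro mult_left_mono) auto
  moreover have "n * (b / 2)\<^sup>2 = (b0 * ln n / 2)\<^sup>2"
    using n_pos by (simp add: b_def power_divide power_mult_distrib)
  moreover have "2 * (b0 * ln n / 2) * (8 / b0) \<le> (b0 * ln n / 2)\<^sup>2 + (8 / b0)\<^sup>2" by (rule sum_squares_bound)
  then have "8 * ln n - 64 / b0\<^sup>2 \<le> (b0 * ln n / 2)\<^sup>2" using b0 by (simp add: power_divide)
  ultimately have "- n * t\<^sup>2 \<le> 64 / b0\<^sup>2 - 8 * ln n" by simp
  then have "exp (- n * t\<^sup>2) \<le> exp (64 / b0\<^sup>2 - 8 * ln n)" by simp
  also have "\<dots> = Kpi / n^8"
    using n_pos exp_of_nat_mult[of 8 "ln n"] by (simp add: exp_diff Kpi_def)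
  finally show ?thesis .
qed

text \<open>The inequality \<open>2 * y \<le> y\<^sup>2 / n^4 + n^4\<close> separates the fourth
  moment of the noise from the event and leaves a deterministic \<open>n^4\<close> against the
  probability \<open>Kpi / n^8\<close>. Each coordinate costs \<open>O(1 / n^4)\<close> and the
  block \<open>O(1 / n^3)\<close>.\<close>

lemma bad_event:
  assumes A: "A \<in> sets P" "P.prob A \<le> Kpi / n^8" and d: "d \<ge> 0"
    and l: "\<And>k X. k \<in> B \<Longrightarrow> l k X \<le> 2 * (X k - \<theta> k)\<^sup>2 + 2 * (d * n^3)"
  shows "(\<Sum>k\<in>B. \<integral>\<^sup>+X. ennreal (l k X) * indicator A X \<partial>P) \<le> ennreal ((3 + Kpi + 2 * d * Kpi) / n^3)"
proof -
  define p where "p = P.prob A"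
  have p: "p \<ge> 0" "p \<le> Kpi / n^8" using A by (auto simp: p_def)
  have each: "(\<integral>\<^sup>+X. ennreal (l k X) * indicator A X \<partial>P) \<le> ennreal ((3 + Kpi + 2 * d * Kpi) / n^4)" if k: "k \<in> B" for k
  proof -
    have [measurable]: "(\<lambda>X. X k) \<in> borel_measurable P" using k by (rule coord_measurable)
    have "(\<integral>\<^sup>+X. ennreal (l k X) * indicator A X \<partial>P) \<le>
        (\<integral>\<^sup>+X. ennreal (1 / n^4) * ennreal ((X k - \<theta> k)^4) + ennreal (n^4 + 2 * (d * n^3)) * indicator A X \<partial>P)"
    proof (intro nn_integral_mono)
      fix X
      define y where "y = (X k - \<theta> k)\<^sup>2"
      have y4: "(X k - \<theta> k)^4 = y\<^sup>2" by (simp add: y_def flip: power_mult)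
      have "2 * (y / n\<^sup>2) * n\<^sup>2 \<le> (y / n\<^sup>2)\<^sup>2 + (n\<^sup>2)\<^sup>2" by (rule sum_squares_bound)
      then have "2 * y \<le> 1 / n^4 * y\<^sup>2 + n^4" using n_pos by (simp add: power_divide flip: power_mult)
      then have "l k X \<le> 1 / n^4 * y\<^sup>2 + (n^4 + 2 * (d * n^3))" using l[OF k, of X] by (simp add: y_def)
      then have "ennreal (l k X) \<le> ennreal (1 / n^4 * y\<^sup>2 + (n^4 + 2 * (d * n^3)))" by (rule ennreal_leI)
      also have "\<dots> = ennreal (1 / n^4) * ennreal (y\<^sup>2) + ennreal (n^4 + 2 * (d * n^3))"
        using n_pos d by (subst ennreal_plus, auto simp flip: ennreal_mult)
      finally show "ennreal (l k X) * indicator A X \<le>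
          ennreal (1 / n^4) * ennreal ((X k - \<theta> k)^4) + ennreal (n^4 + 2 * (d * n^3)) * indicator A X"
        unfolding y4 by (auto split: split_indicator)
    qed
    also have "\<dots> = ennreal (1 / n^4) * (\<integral>\<^sup>+X. ennreal ((X k - \<theta> k)^4) \<partial>P) + ennreal (n^4 + 2 * (d * n^3)) * emeasure P A"
      using A by (simp add: nn_integral_add nn_integral_cmult)
    also have "(\<integral>\<^sup>+X. ennreal ((X k - \<theta> k)^4) \<partial>P) = 3"
      using nn_integral_coord[OF k, of "\<lambda>x. ennreal ((x - \<theta> k)^4)"] by (simp add: nn_integral_Nrm_4)
    also have "emeasure P A = ennreal p" by (simp add: p_def P.emeasure_eq_measure)
    also have "ennreal (1 / n^4) * 3 + ennreal (n^4 + 2 * (d * n^3)) * ennreal p = ennreal (3 / n^4 + (n^4 + 2 * (d * n^3)) * p)"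
    proof -
      have "ennreal (1 / n^4) * 3 = ennreal (3 / n^4)"
        using n_pos ennreal_mult[of "1 / n^4" 3] by simp
      then show ?thesis using n_pos d p by (simp flip: ennreal_plus ennreal_mult)
    qed
    also have "\<dots> \<le> ennreal ((3 + Kpi + 2 * d * Kpi) / n^4)"
    proof (rule ennreal_leI)
      have "n^3 \<le> n^4" using n_pos by (intro power_increasing) auto
      then have "(n^4 + 2 * (d * n^3)) * p \<le> (n^4 + 2 * (d * n^4)) * (Kpi / n^8)"
        using p d n_pos by (intro mult_mono add_mono mult_left_mono) auto
      also have "\<dots> = (1 + 2 * d) * Kpi * (n^4 / n^8)" by (simp add: algebra_simps add_divide_distrib)
      also have "n^4 / n^8 = 1 / n^4" using n_pos by (simp add: eval_nat_numeral)
      finally show "3 / n^4 + (n^4 + 2 * (d * n^3)) * p \<le> (3 + Kpi + 2 * d * Kpi) / n^4"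
        by (simp add: algebra_simps add_divide_distrib)
    qed
    finally show ?thesis .
  qed
  have "(\<Sum>k\<in>B. \<integral>\<^sup>+X. ennreal (l k X) * indicator A X \<partial>P) \<le> (\<Sum>k\<in>B. ennreal ((3 + Kpi + 2 * d * Kpi) / n^4))"
    by (intro sum_mono each)
  also have "\<dots> = ennreal n * ennreal ((3 + Kpi + 2 * d * Kpi) / n^4)"
    by (simp add: n_def ennreal_of_nat_eq_real_of_nat)
  also have "\<dots> = ennreal (n * ((3 + Kpi + 2 * d * Kpi) / n^4))"
    using n_pos d Kpi by (intro ennreal_mult[symmetric]) auto
  also have "n * ((3 + Kpi + 2 * d * Kpi) / n^4) = (3 + Kpi + 2 * d * Kpi) / n^3"
    using n_pos by (simp add: eval_nat_numeral)
  finally show ?thesis .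
qed

definition eb_loss :: "nat \<Rightarrow> (nat \<Rightarrow> real) \<Rightarrow> real" where
  "eb_loss k X = (X k - \<theta> k + psi X (X k))\<^sup>2"

definition soft_loss :: "nat \<Rightarrow> (nat \<Rightarrow> real) \<Rightarrow> real" where
  "soft_loss k X = (soft a (X k) - \<theta> k)\<^sup>2"

text \<open>The floor \<rho> makes the estimated score at most polynomial in n, as
  \<open>bad_event\<close> requires.\<close>

lemma eb_loss_bound: "eb_loss k X \<le> 2 * (X k - \<theta> k)\<^sup>2 + 2 * (1 / r1\<^sup>2 * n^3)"
proof -
  have "\<bar>phat' X u\<bar> \<le> a\<^sup>2" for u
  proof -
    have "\<bar>phat' X u\<bar> \<le> (\<Sum>k\<in>B. \<bar>kern' a (u - X k) / n\<bar>)" unfolding phat'_def by (rule sum_abs)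
    also have "\<dots> \<le> (\<Sum>k\<in>B. a\<^sup>2 / n)"
      using kern_bounds(2)[OF a_ge(4)] n_pos by (intro sum_mono) (simp add: divide_right_mono)
    finally show ?thesis using n_pos by (simp add: n_def)
  qed
  then have "\<bar>psi X (X k)\<bar> \<le> a\<^sup>2 / \<rho>"
    unfolding psi_def abs_divide using rho_pos by (intro frac_le) auto
  also have "a\<^sup>2 / \<rho> = a * sqrt n / r" using a_ge by (simp add: \<rho>_def power2_eq_square)
  also have "\<dots> \<le> a * sqrt n / r1" using r a_ge n_pos by (intro divide_left_mono) auto
  finally have "(psi X (X k))\<^sup>2 \<le> (a * sqrt n / r1)\<^sup>2" using power_mono[of "\<bar>psi X (X k)\<bar>" _ 2] by simp
  also have "\<dots> = a\<^sup>2 * n / r1\<^sup>2" using n_pos by (simp add: power_divide power_mult_distrib)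
  also have "\<dots> \<le> n\<^sup>2 * n / r1\<^sup>2"
    using a_le a_ge n_pos by (intro divide_right_mono mult_right_mono power_mono) auto
  finally have "(psi X (X k))\<^sup>2 \<le> 1 / r1\<^sup>2 * n^3" by (simp add: power2_eq_square power3_eq_cube)
  then show ?thesis
    using sum_squares_bound[of "X k - \<theta> k" "psi X (X k)"] unfolding eb_loss_def by (simp add: power2_sum)
qed

lemma soft_loss_bound: "soft_loss k X \<le> 2 * (X k - \<theta> k)\<^sup>2 + 2 * a\<^sup>2"
proof -
  have "(soft a (X k) - X k)\<^sup>2 \<le> a\<^sup>2"
    using soft_diff[OF a_ge(4), of "X k"] power_mono[of "\<bar>soft a (X k) - X k\<bar>" a 2] by simp
  moreover have "soft_loss k X = ((X k - \<theta> k) + (soft a (X k) - X k))\<^sup>2" by (simp add: soft_loss_def)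
  ultimately show ?thesis
    using sq_sum_le[of "X k - \<theta> k" "soft a (X k) - X k"] by simp
qed

lemma a_sq_le_n3: "a\<^sup>2 \<le> 1 * n^3"
proof -
  have "a\<^sup>2 \<le> n\<^sup>2" using a_le a_ge by (intro power_mono) auto
  also have "\<dots> \<le> n^3" using n_pos by (intro power_increasing) auto
  finally show ?thesis by simp
qed

text \<open>For \<open>\<theta>\<^sup>2 \<le> ln n\<close> the rule is compared with its value at
  pure noise, which costs at most \<open>2 * \<bar>\<theta>\<bar>\<close> by the Lipschitz property.
  For larger means it suffices that the rule moves the observation by at most a.\<close>

lemma soft_loss_risk: "total_risk soft_loss \<le> ennreal (4 / a^3 + 8 * n * energy)"
proof -
  have each: "(\<integral>\<^sup>+X. ennreal (soft_loss k X) \<partial>P) \<le> ennreal (4 / (n * a^3) + 8 * min ((\<theta> k)\<^sup>2) (ln n))" if k: "k \<in> B" for k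
  proof -
    interpret Nk: prob_space "Nrm (\<theta> k)" by simp
    have [measurable]: "(\<lambda>X. X k) \<in> borel_measurable P" using k by (rule coord_measurable)
    have r1: "(\<integral>\<^sup>+X. ennreal (soft_loss k X) \<partial>P) \<le> ennreal (4 / (n * a^3) + 8 * (\<theta> k)\<^sup>2)"
    proof -
      have "(\<integral>\<^sup>+X. ennreal (soft_loss k X) \<partial>P) \<le> (\<integral>\<^sup>+X. 2 * ennreal ((soft a (X k - \<theta> k))\<^sup>2) + ennreal (8 * (\<theta> k)\<^sup>2) \<partial>P)"
      proof (intro nn_integral_mono)
        fix X
        have "\<bar>soft a (X k) - soft a (X k - \<theta> k) - \<theta> k\<bar> \<le> 2 * \<bar>\<theta> k\<bar>"
          using soft_lipschitz[OF a_ge(4), of "X k" "X k - \<theta> k"] by linarith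
        then have "(soft a (X k) - soft a (X k - \<theta> k) - \<theta> k)\<^sup>2 \<le> (2 * \<bar>\<theta> k\<bar>)\<^sup>2"
          by (subst power2_le_iff_abs_le) auto
        moreover have "soft_loss k X = (soft a (X k - \<theta> k) + (soft a (X k) - soft a (X k - \<theta> k) - \<theta> k))\<^sup>2"
          by (simp add: soft_loss_def)
        ultimately have "soft_loss k X \<le> 2 * (soft a (X k - \<theta> k))\<^sup>2 + 8 * (\<theta> k)\<^sup>2"
          using sq_sum_le[of "soft a (X k - \<theta> k)" "soft a (X k) - soft a (X k - \<theta> k) - \<theta> k"]
          by (simp add: power_mult_distrib)
        then have "ennreal (soft_loss k X) \<le> ennreal (2 * (soft a (X k - \<theta> k))\<^sup>2 + 8 * (\<theta> k)\<^sup>2)" by (rule ennreal_leI)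
        then show "ennreal (soft_loss k X) \<le> 2 * ennreal ((soft a (X k - \<theta> k))\<^sup>2) + ennreal (8 * (\<theta> k)\<^sup>2)"
          by (simp add: ennreal_mult)
      qed
      also have "\<dots> = 2 * (\<integral>\<^sup>+X. ennreal ((soft a (X k - \<theta> k))\<^sup>2) \<partial>P) + ennreal (8 * (\<theta> k)\<^sup>2)"
        by (simp add: nn_integral_add nn_integral_cmult P.emeasure_space_1)
      finally have le: "(\<integral>\<^sup>+X. ennreal (soft_loss k X) \<partial>P) \<le> 2 * (\<integral>\<^sup>+X. ennreal ((soft a (X k - \<theta> k))\<^sup>2) \<partial>P) + ennreal (8 * (\<theta> k)\<^sup>2)" .
      have "(\<integral>\<^sup>+X. ennreal ((soft a (X k - \<theta> k))\<^sup>2) \<partial>P) = (\<integral>\<^sup>+x. ennreal ((soft a (x - \<theta> k))\<^sup>2) \<partial>Nrm (\<theta> k))"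
        using nn_integral_coord[OF k, of "\<lambda>x. ennreal ((soft a (x - \<theta> k))\<^sup>2)"] by simp
      also have "\<dots> \<le> ennreal (2 / (n * a^3))"
      proof (rule order_trans[OF soft_risk_0[OF a_ge(3)]], rule ennreal_leI)
        have "gd a \<le> (1 / n) / 2" unfolding gd_eq exp_a using sqrt_2pi n_pos by (intro divide_left_mono) auto
        then have "4 * gd a / a^3 \<le> 4 * (1 / n / 2) / a^3" using a_ge by (intro divide_right_mono mult_left_mono) auto
        then show "4 * gd a / a^3 \<le> 2 / (n * a^3)" by simp
      qed
      finally have "2 * (\<integral>\<^sup>+X. ennreal ((soft a (X k - \<theta> k))\<^sup>2) \<partial>P) \<le> 2 * ennreal (2 / (n * a^3))"
        by (rule mult_left_mono) simp
      also have "\<dots> = ennreal (4 / (n * a^3))"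
        using ennreal_mult[of 2 "2 / (n * a^3)"] n_pos a_ge by simp
      finally have "2 * (\<integral>\<^sup>+X. ennreal ((soft a (X k - \<theta> k))\<^sup>2) \<partial>P) + ennreal (8 * (\<theta> k)\<^sup>2)
          \<le> ennreal (4 / (n * a^3)) + ennreal (8 * (\<theta> k)\<^sup>2)"
        by (rule add_right_mono)
      also have "\<dots> = ennreal (4 / (n * a^3) + 8 * (\<theta> k)\<^sup>2)"
        using n_pos a_ge by (intro ennreal_plus[symmetric]) auto
      finally show ?thesis using le by (rule order_trans[rotated])
    qed
    have r2: "(\<integral>\<^sup>+X. ennreal (soft_loss k X) \<partial>P) \<le> ennreal (8 * ln n)"
    proof -
      have "(\<integral>\<^sup>+X. ennreal (soft_loss k X) \<partial>P) \<le> (\<integral>\<^sup>+X. 2 * ennreal ((X k - \<theta> k)\<^sup>2) + ennreal (2 * a\<^sup>2) \<partial>P)"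
      proof (intro nn_integral_mono)
        fix X
        have "ennreal (soft_loss k X) \<le> ennreal (2 * (X k - \<theta> k)\<^sup>2 + 2 * a\<^sup>2)" by (intro ennreal_leI soft_loss_bound)
        then show "ennreal (soft_loss k X) \<le> 2 * ennreal ((X k - \<theta> k)\<^sup>2) + ennreal (2 * a\<^sup>2)"
          by (simp add: ennreal_mult)
      qed
      also have "\<dots> = 2 * (\<integral>\<^sup>+X. ennreal ((X k - \<theta> k)\<^sup>2) \<partial>P) + ennreal (2 * a\<^sup>2)"
        by (simp add: nn_integral_add nn_integral_cmult P.emeasure_space_1)
      also have "(\<integral>\<^sup>+X. ennreal ((X k - \<theta> k)\<^sup>2) \<partial>P) = 1"
        using nn_integral_coord[OF k, of "\<lambda>x. ennreal ((x - \<theta> k)\<^sup>2)"] by (simp add: nn_integral_Nrm_sq)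
      also have "2 * 1 + ennreal (2 * a\<^sup>2) = ennreal (2 + 2 * a\<^sup>2)"
        using ennreal_plus[of 2 "2 * a\<^sup>2"] by simp
      also have "\<dots> \<le> ennreal (8 * ln n)"
        using a_sq ln_n by (intro ennreal_leI) simp
      finally show ?thesis .
    qed
    have pos: "4 / (n * a^3) \<ge> 0" using n_pos a_ge by simp
    show ?thesis
    proof (cases "(\<theta> k)\<^sup>2 \<le> ln n")
      case True then show ?thesis using r1 by (simp add: min_def)
    next
      case False
      then have "8 * ln n \<le> 4 / (n * a^3) + 8 * min ((\<theta> k)\<^sup>2) (ln n)" using pos by (simp add: min_def)
      then show ?thesis using r2 by (meson ennreal_leI order_trans)
    qed
  qed
  have "total_risk soft_loss \<le> (\<Sum>k\<in>B. ennreal (4 / (n * a^3) + 8 * min ((\<theta> k)\<^sup>2) (ln n)))"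
    by (intro sum_mono each)
  also have "\<dots> = ennreal (\<Sum>k\<in>B. 4 / (n * a^3) + 8 * min ((\<theta> k)\<^sup>2) (ln n))"
    using n_pos a_ge ln_n by (intro sum_ennreal add_nonneg_nonneg) auto
  also have "(\<Sum>k\<in>B. 4 / (n * a^3) + 8 * min ((\<theta> k)\<^sup>2) (ln n)) = 4 / a^3 + 8 * n * energy"
    using n_pos by (simp add: sum.distrib energy_def n_def[symmetric] flip: sum_distrib_left)
  finally show ?thesis .
qed

lemma kap_le_energy: "kap \<le> energy"
proof -
  have "1 - exp (- (\<theta> k)\<^sup>2 / 4) \<le> min ((\<theta> k)\<^sup>2) (ln n)" for k
  proof (rule min.boundedI)
    have "1 + - (\<theta> k)\<^sup>2 / 4 \<le> exp (- (\<theta> k)\<^sup>2 / 4)" by (rule exp_ge_add_one_self)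
    then show "1 - exp (- (\<theta> k)\<^sup>2 / 4) \<le> (\<theta> k)\<^sup>2" using zero_le_power2[of "\<theta> k"] by linarith
    show "1 - exp (- (\<theta> k)\<^sup>2 / 4) \<le> ln n" using ln_n exp_gt_zero[of "- (\<theta> k)\<^sup>2 / 4"] by linarith
  qed
  then show ?thesis unfolding kap_def energy_def using n_pos by (intro divide_right_mono sum_mono) auto
qed

text \<open>A summand of \<open>kap\<close> saturates at 1 but one of \<open>energy\<close> at
  \<open>ln n\<close>, which accounts for the lost logarithm. For \<open>kap \<le> 2 * b\<close>
  this makes \<open>energy\<close> at most of order \<open>(ln n)\<^sup>2 / sqrt n\<close>.\<close>

lemma energy_le_kap: "energy \<le> 8 * ln n * kap"
proof -
  have e: "min u 1 / 2 \<le> 1 - exp (- u)" if u: "u \<ge> 0" for u :: real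
  proof -
    have *: "v / 2 \<le> 1 - exp (- v)" if "0 \<le> v" "v \<le> 1" for v :: real
    proof -
      have "1 + v \<le> exp v" by (rule exp_ge_add_one_self)
      then have "exp (- v) \<le> 1 / (1 + v)" using that by (simp add: exp_minus field_simps)
      also have "\<dots> \<le> 1 - v / 2"
        using that mult_left_mono[of v 1 v] by (simp add: field_simps)
      finally show ?thesis by simp
    qed
    have "exp (- u) \<le> exp (- min u 1)" by simp
    moreover have "min u 1 / 2 \<le> 1 - exp (- min u 1)" using u by (intro *) auto
    ultimately show ?thesis by linarith
  qed
  have "min ((\<theta> k)\<^sup>2) (ln n) \<le> 8 * ln n * (1 - exp (- (\<theta> k)\<^sup>2 / 4))" for k
  proof -
    have "min ((\<theta> k)\<^sup>2) (ln n) \<le> 4 * ln n * min ((\<theta> k)\<^sup>2 / 4) 1"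
    proof (cases "(\<theta> k)\<^sup>2 \<le> 4")
      case True
      have "(\<theta> k)\<^sup>2 * 1 \<le> (\<theta> k)\<^sup>2 * ln n" using ln_n by (intro mult_left_mono) auto
      then show ?thesis using True by (simp add: min_def mult.commute)
    next
      case False then show ?thesis using ln_n by (simp add: min_def)
    qed
    also have "\<dots> = 8 * ln n * (min ((\<theta> k)\<^sup>2 / 4) 1 / 2)" by simp
    also have "\<dots> \<le> 8 * ln n * (1 - exp (- ((\<theta> k)\<^sup>2 / 4)))"
      using ln_n by (intro mult_left_mono e) auto
    finally show ?thesis by simp
  qed
  then have "energy \<le> (\<Sum>k\<in>B. 8 * ln n * (1 - exp (- (\<theta> k)\<^sup>2 / 4))) / n"
    unfolding energy_def using n_pos by (intro divide_right_mono sum_mono) auto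
  then show ?thesis by (simp add: kap_def flip: sum_distrib_left)
qed

end

section \<open>Large blocks\<close>

text \<open>The rate is a minimum of three entries; bounds proved with different constants are
  merged by adding the constants.\<close>

lemma le_mult_min3:
  fixes x :: real
  assumes "x \<le> c1" "x \<le> c2 * E2" "x \<le> c3 * E3" "0 \<le> c1" "0 \<le> c2" "0 \<le> c3" "0 \<le> E2" "0 \<le> E3"
  shows "x \<le> (c1 + c2 + c3) * min 1 (min E2 E3)"
proof -
  define m where "m = min 1 (min E2 E3)"
  have m: "m \<ge> 0" using assms by (simp add: m_def)
  consider "m = 1" | "m = E2" | "m = E3" by (metis m_def min_def)
  then have "x \<le> c1 * m \<or> x \<le> c2 * m \<or> x \<le> c3 * m" by cases (use assms in auto)
  moreover have "c1 * m \<ge> 0" "c2 * m \<ge> 0" "c3 * m \<ge> 0" using assms m by auto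
  ultimately show ?thesis unfolding m_def[symmetric] distrib_right by linarith
qed

lemma ln_le_sqrt: "n \<ge> 1 \<Longrightarrow> ln n \<le> 2 * sqrt n" "n \<ge> 1 \<Longrightarrow> (ln n)\<^sup>2 \<le> 16 * sqrt n" for n :: real
proof -
  assume n: "n \<ge> 1"
  have s: "ln x \<le> x" if "x > 0" for x :: real using ln_le_minus_one[OF that] by simp
  have "ln (sqrt n) \<le> sqrt n" using n by (intro s) simp
  then show "ln n \<le> 2 * sqrt n" using n by (simp add: ln_sqrt)
  have "ln (sqrt (sqrt n)) \<le> sqrt (sqrt n)" using n by (intro s) simp
  then have "ln n \<le> 4 * sqrt (sqrt n)" using n by (simp add: ln_sqrt)
  moreover have "ln n \<ge> 0" using n by simp
  ultimately have "(ln n)\<^sup>2 \<le> (4 * sqrt (sqrt n))\<^sup>2" by (intro power_mono)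
  then show "(ln n)\<^sup>2 \<le> 16 * sqrt n" using n by (simp add: power_mult_distrib)
qed

context geb_block
begin

text \<open>Splitting at \<open>t = sqrt L\<close> gives
  \<open>min (t\<^sup>2) L \<le> t powr p * L powr (1 - p / 2)\<close> for
  \<open>0 < p \<le> 2\<close>; averaging over the block produces the second entry of the
  rate.\<close>

lemma energy_le_power:
  assumes p: "0 < p" "p \<le> 2" and C: "(\<Sum>k\<in>B. \<bar>\<theta> k\<bar> powr p) / n \<le> C powr p"
  shows "energy \<le> C powr p / ln n powr (p / 2 - 1)"
proof -
  define L where "L = ln n"
  have L: "L \<ge> 1" using ln_n by (simp add: L_def)
  have each: "min ((\<theta> k)\<^sup>2) L \<le> \<bar>\<theta> k\<bar> powr p * L powr (1 - p / 2)" for k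
  proof (cases "\<theta> k = 0")
    case True then show ?thesis using L by simp
  next
    case False
    define t where "t = \<bar>\<theta> k\<bar>"
    have t: "t > 0" using False by (simp add: t_def)
    have t2: "(\<theta> k)\<^sup>2 = t powr 2" using t by (simp add: t_def powr_numeral)
    show ?thesis
    proof (cases "t \<le> L powr (1 / 2)")
      case True
      have "t powr 2 = t powr p * t powr (2 - p)" by (simp flip: powr_add)
      also have "\<dots> \<le> t powr p * (L powr (1 / 2)) powr (2 - p)"
        using True t p by (intro mult_left_mono powr_mono2) auto
      also have "(L powr (1 / 2)) powr (2 - p) = L powr (1 - p / 2)"
        by (simp add: powr_powr diff_divide_distrib)
      finally show ?thesis by (simp add: t2 t_def[symmetric] min_le_iff_disj)
    next
      case False
      have "L = L powr (p / 2) * L powr (1 - p / 2)" using L by (simp flip: powr_add)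
      also have "L powr (p / 2) = (L powr (1 / 2)) powr p" by (simp add: powr_powr)
      also have "(L powr (1 / 2)) powr p \<le> t powr p" using False p by (intro powr_mono2) auto
      finally have "L \<le> t powr p * L powr (1 - p / 2)" by (simp add: mult_right_mono)
      then show ?thesis by (simp add: t_def min_le_iff_disj)
    qed
  qed
  have "energy \<le> (\<Sum>k\<in>B. \<bar>\<theta> k\<bar> powr p * L powr (1 - p / 2)) / n"
    unfolding energy_def L_def[symmetric] using n_pos by (intro divide_right_mono sum_mono each) auto
  also have "\<dots> = (\<Sum>k\<in>B. \<bar>\<theta> k\<bar> powr p) / n * L powr (1 - p / 2)" by (simp flip: sum_distrib_right)
  also have "\<dots> \<le> C powr p * L powr (1 - p / 2)" by (intro mult_right_mono C) simp
  also have "L powr (1 - p / 2) = 1 / L powr (p / 2 - 1)"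
    using powr_minus_divide[of L "p / 2 - 1"] by simp
  finally show ?thesis by (simp add: L_def)
qed

lemma markov_power:
  assumes p: "0 < p" and C: "(\<Sum>k\<in>B. \<bar>\<theta> k\<bar> powr p) / n \<le> C powr p" "C \<ge> 0" and u: "u > 0"
  shows "card {k\<in>B. \<bar>\<theta> k\<bar> > u} / n \<le> (C / u) powr p"
proof -
  have "real (card {k\<in>B. \<bar>\<theta> k\<bar> > u}) * u powr p = (\<Sum>k\<in>{k\<in>B. \<bar>\<theta> k\<bar> > u}. u powr p)" by simp
  also have "\<dots> \<le> (\<Sum>k\<in>{k\<in>B. \<bar>\<theta> k\<bar> > u}. \<bar>\<theta> k\<bar> powr p)"
    using u p by (intro sum_mono powr_mono2) auto
  also have "\<dots> \<le> (\<Sum>k\<in>B. \<bar>\<theta> k\<bar> powr p)" using fin by (intro sum_mono2) auto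
  finally have "real (card {k\<in>B. \<bar>\<theta> k\<bar> > u}) * u powr p / n \<le> (\<Sum>k\<in>B. \<bar>\<theta> k\<bar> powr p) / n"
    using n_pos by (intro divide_right_mono) auto
  also have "\<dots> \<le> C powr p" by (rule C)
  finally have "card {k\<in>B. \<bar>\<theta> k\<bar> > u} / n \<le> C powr p / u powr p"
    using u by (simp add: le_divide_eq)
  then show ?thesis using C u by (simp add: powr_divide)
qed

definition "K3 = 30 * r2 * lam + 6 * r2 * lam + 4 + 2"

lemma trunc_le_rate:
  assumes p: "0 < p" "p \<le> 2" and C: "(\<Sum>k\<in>B. \<bar>\<theta> k\<bar> powr p) / n \<le> C powr p" "C \<ge> 0"
  defines "E3 \<equiv> max ((ln n)\<^sup>2 / sqrt n) ((C * ln n powr (3 / 2) / sqrt n) powr (p / (p + 1)))"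
  shows "trunc \<le> ennreal (K3 * E3)"
proof -
  define l where "l = ln n"
  have l: "l \<ge> 1" "l > 0" using ln_n by (auto simp: l_def)
  define w where "w = l powr (3 / 2) / sqrt n"
  have w: "w > 0" using l n_pos by (simp add: w_def)
  have E3: "E3 = max (l\<^sup>2 / sqrt n) ((C * w) powr (p / (p + 1)))" by (simp add: E3_def l_def w_def)
  have E3pos: "E3 \<ge> 0" "E3 \<ge> l\<^sup>2 / sqrt n" "E3 \<ge> (C * w) powr (p / (p + 1))" unfolding E3 by (auto simp: le_max_iff_disj)
  have l3: "l powr (3 / 2) = l * sqrt l"
    using l powr_add[of l 1 "1 / 2"] by (simp add: powr_half_sqrt)
  have al: "a = sqrt 2 * sqrt l" by (simp add: a_def l_def real_sqrt_mult)
  have s2: "sqrt 2 \<le> 3 / 2" by (rule real_le_lsqrt) (auto simp: power2_eq_square)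
  have coef: "2 * L * \<rho> * (lam * a\<^sup>2) \<le> 6 * r2 * lam * (L * w)" if L: "L \<ge> 0" for L
  proof -
    have "\<rho> = r * (sqrt 2 * sqrt l / sqrt n)" by (simp add: \<rho>_def al)
    then have "2 * L * \<rho> * (lam * a\<^sup>2) = 4 * sqrt 2 * r * lam * (L * w)"
      by (simp add: a_sq l_def[symmetric] w_def l3)
    also have "\<dots> \<le> 6 * r2 * lam * (L * w)"
      using s2 r lam L w by (intro mult_right_mono mult_mono) auto
    finally show ?thesis .
  qed
  have n2: "2 / n \<le> 2 * E3"
  proof -
    have "sqrt n \<le> n" using n_pos by (simp add: real_le_lsqrt power2_eq_square)
    then have "1 / n \<le> 1 / sqrt n" using n_pos by (intro divide_left_mono) auto
    also have "\<dots> \<le> l\<^sup>2 / sqrt n" using l n_pos by (intro divide_right_mono) auto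
    finally show ?thesis using E3pos by simp
  qed
  have aw: "3 * a * w \<le> 5 * E3"
  proof -
    have "3 * a * w = 3 * sqrt 2 * (l\<^sup>2 / sqrt n)"
      using l by (simp add: al w_def l3 power2_eq_square mult_ac)
    also have "\<dots> \<le> 5 * (l\<^sup>2 / sqrt n)" using s2 n_pos by (intro mult_right_mono) auto
    finally show ?thesis using E3pos by simp
  qed
  \<comment> \<open>This window balances its cost \<open>L * w\<close> against the Markov bound
    \<open>(C / L) powr p\<close>: at \<open>L = L2\<close> both equal
    \<open>(C * w) powr (p / (p + 1))\<close>.\<close>
  define L2 where "L2 = C powr (p / (p + 1)) * w powr (- (1 / (p + 1)))"
  have L2: "L2 \<ge> 0" by (simp add: L2_def)
  have L2w: "L2 * w = (C * w) powr (p / (p + 1))"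
  proof -
    have "w powr (- (1 / (p + 1))) * w powr 1 = w powr (- (1 / (p + 1)) + 1)" by (simp only: powr_add)
    also have "- (1 / (p + 1)) + 1 = p / (p + 1)" using p by (simp add: field_simps)
    finally have "w powr (- (1 / (p + 1))) * w = w powr (p / (p + 1))" using w by simp
    then show ?thesis using C w by (simp add: L2_def powr_mult mult.assoc)
  qed
  \<comment> \<open>\<open>trunc_le_window\<close> requires at least \<open>3 * a\<close>. When this
    is the larger one, \<open>L * w\<close> is of order \<open>(ln n)\<^sup>2 / sqrt n\<close>, the
    other entry of the maximum \<open>E3\<close>.\<close>
  define L where "L = max (3 * a) L2"
  have L: "L \<ge> 3 * a" "L \<ge> L2" "L > 0" using a_ge by (auto simp: L_def)
  have Lw: "L * w \<le> 5 * E3 + E3"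
  proof -
    have "L * w \<le> 3 * a * w + L2 * w" using a_ge L2 w by (auto simp: L_def max_def)
    then show ?thesis using aw L2w E3pos by simp
  qed
  have t1: "2 * L * \<rho> * (lam * a\<^sup>2) \<le> 6 * r2 * lam * (6 * E3)"
  proof (rule order_trans[OF coef])
    show "0 \<le> L" using L by simp
    show "6 * r2 * lam * (L * w) \<le> 6 * r2 * lam * (6 * E3)"
      using Lw r lam by (intro mult_left_mono) auto
  qed
  have t2: "card {k\<in>B. \<bar>\<theta> k\<bar> > L / 2} / n \<le> 4 * E3"
  proof (cases "C = 0")
    case True
    then have "card {k\<in>B. \<bar>\<theta> k\<bar> > L / 2} / n \<le> 0" using markov_power[OF p(1) C, of "L / 2"] L by simp
    then show ?thesis using E3pos by simp
  next
    case False
    then have C0: "C > 0" using C by simp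
    then have L20: "L2 > 0" using w by (simp add: L2_def)
    have "card {k\<in>B. \<bar>\<theta> k\<bar> > L / 2} / n \<le> (C / (L / 2)) powr p" using L by (intro markov_power p C) auto
    also have "\<dots> \<le> (2 * (C / L2)) powr p"
    proof (rule powr_mono2)
      have le: "C / L \<le> C / L2" using L L20 C0 by (intro divide_left_mono) auto
      have eq: "C / (L / 2) = 2 * (C / L)" by simp
      show "C / (L / 2) \<le> 2 * (C / L2)" unfolding eq by (intro mult_left_mono le) simp
    qed (use p C0 L in auto)
    also have "\<dots> = 2 powr p * (C / L2) powr p" using C0 L20 by (intro powr_mult)
    also have "(C / L2) powr p = (C * w) powr (p / (p + 1))"
    proof -
      have "C / L2 = C powr 1 * C powr (- (p / (p + 1))) * w powr (1 / (p + 1))"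
        using C0 w by (simp add: L2_def powr_minus field_simps)
      also have "C powr 1 * C powr (- (p / (p + 1))) = C powr (1 + - (p / (p + 1)))" by (simp only: powr_add)
      also have "1 + - (p / (p + 1)) = 1 / (p + 1)" using p by (simp add: field_simps)
      also have "C powr (1 / (p + 1)) * w powr (1 / (p + 1)) = (C * w) powr (1 / (p + 1))"
        using C0 w by (simp add: powr_mult)
      finally show ?thesis by (simp add: powr_powr)
    qed
    also have "2 powr p * (C * w) powr (p / (p + 1)) \<le> 4 * E3"
    proof (rule mult_mono)
      have "2 powr p \<le> 2 powr 2" using p by (intro powr_mono) auto
      then show "2 powr p \<le> 4" by (simp add: powr_numeral)
    qed (use E3pos in auto)
    finally show ?thesis .
  qed
  have "2 * L * \<rho> * (lam * a\<^sup>2) + card {k\<in>B. \<bar>\<theta> k\<bar> > L / 2} / n + 2 / n \<le> K3 * E3"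
    using t1 t2 n2 by (simp add: K3_def algebra_simps)
  then show ?thesis using trunc_le_window[OF L(1)] by (meson ennreal_leI order_trans)
qed

end

context geb_test
begin

definition remainder :: real where "remainder = 1 / (ln n + 1) powr (3 / 2)"

text \<open>From \<open>ln n \<ge> 1\<close> follows
  \<open>ln n + 1 \<le> 2 * ln n = a\<^sup>2\<close>. The second bound lets the remainder pay for
  the wrong decisions of the test as well.\<close>

lemma remainder: "1 / a^3 \<le> remainder" "1 / n^3 \<le> remainder" "remainder \<ge> 0"
proof -
  have "(ln n + 1) powr (3 / 2) \<le> (a\<^sup>2) powr (3 / 2)"
    using ln_n by (intro powr_mono2) (auto simp: a_sq)
  also have "\<dots> = a^3"
    using a_ge by (simp add: powr_powr flip: powr_numeral)
  finally have le: "(ln n + 1) powr (3 / 2) \<le> a^3" .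
  have pos: "(ln n + 1) powr (3 / 2) > 0" using ln_n by simp
  show 1: "1 / a^3 \<le> remainder" unfolding remainder_def using le pos a_ge by (intro divide_left_mono) auto
  have "1 / n^3 \<le> 1 / a^3" using a_le a_ge n_pos by (intro divide_left_mono power_mono) auto
  then show "1 / n^3 \<le> remainder" using 1 by linarith
  show "remainder \<ge> 0" by (simp add: remainder_def)
qed

definition geb_loss :: "nat \<Rightarrow> (nat \<Rightarrow> real) \<Rightarrow> real" where
  "geb_loss k X = (if khat X > b then eb_loss k X else soft_loss k X)"

lemma loss_measurable:
  assumes k: "k \<in> B"
  shows "eb_loss k \<in> borel_measurable P" "soft_loss k \<in> borel_measurable P"
proof -
  have [measurable]: "(\<lambda>X. X k) \<in> borel_measurable P" using k by (rule coord_measurable)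
  have [measurable]: "(\<lambda>X. psi X (X k)) \<in> borel_measurable P" by (intro own_psi_measurable) measurable
  show "eb_loss k \<in> borel_measurable P" "soft_loss k \<in> borel_measurable P"
    unfolding eb_loss_def[abs_def] soft_loss_def[abs_def] by measurable
qed

text \<open>These constants are functions of \<open>r1\<close>, \<open>r2\<close> and
  \<open>b0\<close>, independent of the block, the means and r. The universality of the final
  constant rests on this.\<close>

definition "Dk = 3 + Kpi + 2 * (1 / r1\<^sup>2) * Kpi + 2 * Kpi"
definition "cS = 1 + 16 * b0 + 256 * b0"
definition "cQ = 5 + (4 / b0 + KT * (1 + 4 / b0)) + (2 + K3)"
definition "Kblock = 4 + Dk + 8 * cS + 8 * (4 / b0 + KT * (1 + 4 / b0) + 1) + (Kgeb + 2 * Bm) * cQ"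

lemma eb_loss_wrong_branch: "kap \<le> b / 2 \<Longrightarrow> (\<Sum>k\<in>B. \<integral>\<^sup>+X. ennreal (eb_loss k X) * indicator {X\<in>space P. khat X > b} X \<partial>P) \<le> ennreal (Dk * remainder)"
proof -
  assume k: "kap \<le> b / 2"
  have "P.prob {X\<in>space P. khat X > b} \<le> P.prob {X\<in>space P. khat X \<ge> kap + b / 2}"
    using k by (intro P.finite_measure_mono) auto
  also have "\<dots> \<le> exp (- n * (b / 2)\<^sup>2)" using b_pos by (intro khat_tail) simp
  also have "\<dots> \<le> Kpi / n^8" by (rule exp_b) simp
  finally have "(\<Sum>k\<in>B. \<integral>\<^sup>+X. ennreal (eb_loss k X) * indicator {X\<in>space P. khat X > b} X \<partial>P) \<le> ennreal ((3 + Kpi + 2 * (1 / r1\<^sup>2) * Kpi) / n^3)"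
    by (intro bad_event eb_loss_bound) auto
  also have "\<dots> \<le> ennreal (Dk * remainder)"
  proof (rule ennreal_leI)
    have "(3 + Kpi + 2 * (1 / r1\<^sup>2) * Kpi) / n^3 \<le> Dk * (1 / n^3)"
      using Kpi n_pos by (simp add: Dk_def divide_right_mono)
    also have "\<dots> \<le> Dk * remainder" using remainder Kpi by (intro mult_left_mono) (auto simp: Dk_def)
    finally show "(3 + Kpi + 2 * (1 / r1\<^sup>2) * Kpi) / n^3 \<le> Dk * remainder" .
  qed
  finally show ?thesis .
qed

lemma soft_loss_wrong_branch: "kap > 2 * b \<Longrightarrow> (\<Sum>k\<in>B. \<integral>\<^sup>+X. ennreal (soft_loss k X) * indicator {X\<in>space P. khat X \<le> b} X \<partial>P) \<le> ennreal (Dk * remainder)"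
proof -
  assume k: "kap > 2 * b"
  have "P.prob {X\<in>space P. khat X \<le> b} \<le> P.prob {X\<in>space P. khat X \<le> kap - b}"
    using k by (intro P.finite_measure_mono) auto
  also have "\<dots> \<le> exp (- n * b\<^sup>2)" using b_pos by (intro khat_tail) simp
  also have "\<dots> \<le> Kpi / n^8" using b_pos by (intro exp_b) simp
  finally have "(\<Sum>k\<in>B. \<integral>\<^sup>+X. ennreal (soft_loss k X) * indicator {X\<in>space P. khat X \<le> b} X \<partial>P) \<le> ennreal ((3 + Kpi + 2 * 1 * Kpi) / n^3)"
  proof (intro bad_event)
    show "soft_loss k X \<le> 2 * (X k - \<theta> k)\<^sup>2 + 2 * (1 * n^3)" for k X
      using soft_loss_bound[of k X] a_sq_le_n3 by simp
  qed auto
  also have "\<dots> \<le> ennreal (Dk * remainder)"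
  proof (rule ennreal_leI)
    have "(3 + Kpi + 2 * 1 * Kpi) / n^3 \<le> Dk * (1 / n^3)"
      using Kpi n_pos by (simp add: Dk_def divide_right_mono)
    also have "\<dots> \<le> Dk * remainder" using remainder Kpi by (intro mult_left_mono) (auto simp: Dk_def)
    finally show "(3 + Kpi + 2 * 1 * Kpi) / n^3 \<le> Dk * remainder" .
  qed
  finally show ?thesis .
qed

lemma KT_nonneg: "KT \<ge> 0" and K3_nonneg: "K3 \<ge> 0" and Kgeb_nonneg: "Kgeb \<ge> 0" "Bm \<ge> 0"
proof -
  show "KT \<ge> 0" using lam r by (simp add: KT_def c3_def \<kappa>0_def)
  show "K3 \<ge> 0" using lam r by (simp add: K3_def)
  show "Kgeb \<ge> 0" "Bm \<ge> 0" using r Kreg_nonneg by (auto simp: Kgeb_def Bm_def \<delta>m_def)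
qed

lemma geb_block_risk:
  assumes p: "0 < p" "p \<le> 2" and C: "(\<Sum>k\<in>B. \<bar>\<theta> k\<bar> powr p) / n \<le> C powr p" "C \<ge> 0"
  shows "total_risk geb_loss \<le>
    Rstar + ennreal (Kblock * (n * rate p (card B) C + remainder))"
proof -
  define E2 where "E2 = C powr p / ln n powr (p / 2 - 1)"
  define E3 where "E3 = max ((ln n)\<^sup>2 / sqrt n) ((C * ln n powr (3 / 2) / sqrt n) powr (p / (p + 1)))"
  define R where "R = rate p (card B) C"
  have R: "R = min 1 (min E2 E3)" by (simp add: R_def rate_def E2_def E3_def n_def)
  have E: "E2 \<ge> 0" "E3 \<ge> 0" "E3 \<ge> (ln n)\<^sup>2 / sqrt n" by (auto simp: E2_def E3_def le_max_iff_disj)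
  have R0: "R \<ge> 0" using E by (simp add: R)
  have SE2: "energy \<le> E2" unfolding E2_def by (rule energy_le_power[OF p C(1)])
  define q where "q = a\<^sup>2 / sqrt n"
  have q0: "q \<ge> 0" using n_pos by (simp add: q_def)
  define \<tau> where "\<tau> = enn2real trunc"
  have trunc: "trunc = ennreal \<tau>" using trunc_le_1 unfolding \<tau>_def by (metis ennreal_enn2real ennreal_one_less_top order_le_less_trans)
  have \<tau>0: "\<tau> \<ge> 0" by (simp add: \<tau>_def)
  have \<tau>: "\<tau> \<le> x" if "trunc \<le> ennreal x" "x \<ge> 0" for x using that \<tau>0 by (simp add: trunc)
  have S0: "energy \<ge> 0" by (rule energy_nonneg)
  have sq: "sqrt n > 0" using n_pos by simp
  have S_small: "energy \<le> cS * R" if "kap \<le> 2 * b"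
  proof -
    have "energy \<le> 8 * ln n * kap" by (rule energy_le_kap)
    also have "\<dots> \<le> 8 * ln n * (2 * b)" using that ln_n by (intro mult_left_mono) auto
    also have "\<dots> = 16 * b0 * ((ln n)\<^sup>2 / sqrt n)" by (simp add: b_def power2_eq_square)
    finally have 1: "energy \<le> 16 * b0 * ((ln n)\<^sup>2 / sqrt n)" .
    also have "\<dots> \<le> 16 * b0 * E3" using E b0 by (intro mult_left_mono) auto
    finally have 3: "energy \<le> 16 * b0 * E3" .
    have "(ln n)\<^sup>2 / sqrt n \<le> 16" using ln_le_sqrt(2)[OF n_pos(2)] sq by (simp add: divide_le_eq)
    then have "16 * b0 * ((ln n)\<^sup>2 / sqrt n) \<le> 16 * b0 * 16" using b0 by (intro mult_left_mono) auto
    with 1 have 2: "energy \<le> 256 * b0" by simp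
    have "energy \<le> (256 * b0 + 1 + 16 * b0) * R"
      unfolding R using 2 3 SE2 E b0 by (intro le_mult_min3) auto
    then show ?thesis by (simp add: cS_def add_ac)
  qed
  define cB where "cB = 4 / b0 + KT * (1 + 4 / b0)"
  have cB: "cB \<ge> 0" using KT_nonneg b0 by (simp add: cB_def)
  have Q_large: "q + \<tau> \<le> cQ * R" if "kap > b / 2"
  proof -
    \<comment> \<open>The threshold is proportional to \<open>q\<close>, so in this regime
      \<open>q\<close> is paid for by \<open>kap\<close> and thereby by \<open>energy\<close>,
      however small C may be.\<close>
    have "b / 2 = b0 / 4 * q" by (simp add: b_def q_def a_sq)
    then have "q \<le> 4 / b0 * kap" using that b0 by (simp add: field_simps)
    also have "\<dots> \<le> 4 / b0 * energy" using kap_le_energy b0 by (intro mult_left_mono) auto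
    finally have qS: "q \<le> 4 / b0 * energy" .
    have "\<tau> \<le> KT * (energy + q)" using trunc_le_energy KT_nonneg S0 q0 unfolding q_def by (intro \<tau>) auto
    also have "\<dots> \<le> KT * (energy + 4 / b0 * energy)" using qS KT_nonneg by (intro mult_left_mono) auto
    finally have "q + \<tau> \<le> cB * energy" using qS by (simp add: cB_def algebra_simps)
    also have "\<dots> \<le> cB * E2" using SE2 cB by (intro mult_left_mono)
    finally have 2: "q + \<tau> \<le> cB * E2" .
    have "q \<le> 4" using ln_le_sqrt(1)[OF n_pos(2)] sq by (simp add: q_def a_sq divide_le_eq)
    moreover have "\<tau> \<le> 1" using trunc_le_1 by (intro \<tau>) auto
    ultimately have 1: "q + \<tau> \<le> 5" by simp
    have "2 * ln n \<le> 2 * (ln n)\<^sup>2" using ln_n by (simp add: power2_eq_square)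
    then have "q \<le> 2 * ((ln n)\<^sup>2 / sqrt n)" using sq by (simp add: q_def a_sq divide_right_mono)
    moreover have "\<tau> \<le> K3 * E3"
      using trunc_le_rate[OF p C] K3_nonneg E unfolding E3_def by (intro \<tau>) auto
    ultimately have 3: "q + \<tau> \<le> (2 + K3) * E3" using E by (simp add: distrib_right)
    have "q + \<tau> \<le> (5 + cB + (2 + K3)) * R"
      unfolding R using 1 2 3 E cB K3_nonneg by (intro le_mult_min3) auto
    then show ?thesis by (simp add: cQ_def cB_def)
  qed
  have S_mid: "n * energy \<le> n * (cS * R)" if "kap \<le> 2 * b" using S_small[OF that] n_pos by simp
  have G: "total_risk eb_loss \<le> Rstar + ennreal (n * ((Kgeb + 2 * Bm) * cQ * R))" if "kap > b / 2"
  proof -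
    have "total_risk eb_loss \<le> Rstar + ennreal n * (ennreal (Kgeb * q) + ennreal (2 * Bm) * trunc)"
      unfolding eb_loss_def q_def by (rule geb_risk)
    also have "ennreal n * (ennreal (Kgeb * q) + ennreal (2 * Bm) * trunc) = ennreal (n * (Kgeb * q + 2 * Bm * \<tau>))"
      unfolding trunc using n_pos Kgeb_nonneg q0 \<tau>0 by (simp flip: ennreal_mult ennreal_plus)
    also have "\<dots> \<le> ennreal (n * ((Kgeb + 2 * Bm) * cQ * R))"
    proof (intro ennreal_leI mult_left_mono)
      have "Kgeb * q + 2 * Bm * \<tau> \<le> (Kgeb + 2 * Bm) * q + (Kgeb + 2 * Bm) * \<tau>"
        using Kgeb_nonneg q0 \<tau>0 by (intro add_mono mult_right_mono) auto
      also have "\<dots> = (Kgeb + 2 * Bm) * (q + \<tau>)" by (simp add: distrib_left)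
      also have "\<dots> \<le> (Kgeb + 2 * Bm) * (cQ * R)" using Q_large[OF that] Kgeb_nonneg by (intro mult_left_mono) auto
      finally show "Kgeb * q + 2 * Bm * \<tau> \<le> (Kgeb + 2 * Bm) * cQ * R" by (simp add: mult.assoc)
    qed (use n_pos in auto)
    finally show ?thesis by (auto intro: add_left_mono)
  qed
  have cs: "cS \<ge> 0" "cQ \<ge> 0" "Dk \<ge> 0" using b0 cB K3_nonneg Kpi by (auto simp: cS_def cQ_def cB_def Dk_def)
  have L2: "total_risk soft_loss \<le> ennreal (4 * remainder + 8 * cS * (n * R))" if "kap \<le> 2 * b"
  proof -
    have "4 / a^3 + 8 * n * energy \<le> 4 * remainder + 8 * cS * (n * R)"
      using remainder(1) S_mid[OF that] by (simp add: mult_ac)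
    then show ?thesis using soft_loss_risk by (meson ennreal_leI order_trans)
  qed
  have fin_bound: "x \<le> Kblock * (n * R + remainder)"
    if "x \<le> 4 * remainder + 8 * cS * (n * R) + Dk * remainder + n * ((Kgeb + 2 * Bm) * cQ * R)" for x
  proof -
    have nR: "n * R \<ge> 0" using n_pos R0 by simp
    have Kc: "(Kgeb + 2 * Bm) * cQ \<ge> 0" using cs Kgeb_nonneg by simp
    have "4 * remainder + 8 * cS * (n * R) + Dk * remainder + n * ((Kgeb + 2 * Bm) * cQ * R)
        = (4 + Dk) * remainder + (8 * cS + (Kgeb + 2 * Bm) * cQ) * (n * R)" by (simp add: algebra_simps)
    also have "\<dots> \<le> Kblock * remainder + Kblock * (n * R)"
      using cs Kc cB remainder(3) nR unfolding cB_def
      by (intro add_mono mult_right_mono) (auto simp: Kblock_def)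
    finally show ?thesis using that by (simp add: distrib_left)
  qed
  have nn: "remainder \<ge> 0" "n * R \<ge> 0" "n * ((Kgeb + 2 * Bm) * cQ * R) \<ge> 0" "Dk * remainder \<ge> 0" "8 * cS * (n * R) \<ge> 0"
    using remainder R0 n_pos cs Kgeb_nonneg by auto
  \<comment> \<open>In the outer regimes the wrong rule is selected with negligible probability. In
    the middle one both risk bounds hold, and the two losses are simply added.\<close>
  consider (a1) "kap \<le> b / 2" | (a2) "b / 2 < kap" "kap \<le> 2 * b" | (a3) "2 * b < kap" by linarith
  then have "total_risk geb_loss \<le> Rstar + ennreal (Kblock * (n * R + remainder))"
  proof cases
    case a1
    then have kb: "kap \<le> 2 * b" using b_pos by simp
    have "total_risk geb_loss \<le>
        (\<Sum>k\<in>B. \<integral>\<^sup>+X. ennreal (soft_loss k X) + ennreal (eb_loss k X) * indicator {X\<in>space P. khat X > b} X \<partial>P)"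
      by (intro sum_mono nn_integral_mono) (auto simp: geb_loss_def split: split_indicator)
    also have "\<dots> = total_risk soft_loss + (\<Sum>k\<in>B. \<integral>\<^sup>+X. ennreal (eb_loss k X) * indicator {X\<in>space P. khat X > b} X \<partial>P)"
      unfolding sum.distrib[symmetric] using loss_measurable by (intro sum.cong refl nn_integral_add) auto
    also have "\<dots> \<le> ennreal (4 * remainder + 8 * cS * (n * R)) + ennreal (Dk * remainder)"
      by (intro add_mono L2[OF kb] eb_loss_wrong_branch[OF a1])
    also have "\<dots> = ennreal (4 * remainder + 8 * cS * (n * R) + Dk * remainder)"
      using nn by (intro ennreal_plus[symmetric]) auto
    also have "\<dots> \<le> ennreal (Kblock * (n * R + remainder))" using nn by (intro ennreal_leI fin_bound) auto
    finally show ?thesis by (rule order_trans) simp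
  next
    case a2
    have "total_risk geb_loss \<le> (\<Sum>k\<in>B. \<integral>\<^sup>+X. ennreal (eb_loss k X) + ennreal (soft_loss k X) \<partial>P)"
      by (intro sum_mono nn_integral_mono) (auto simp: geb_loss_def)
    also have "\<dots> = total_risk eb_loss + total_risk soft_loss"
      unfolding sum.distrib[symmetric] using loss_measurable by (intro sum.cong refl nn_integral_add) auto
    also have "\<dots> \<le> (Rstar + ennreal (n * ((Kgeb + 2 * Bm) * cQ * R))) + ennreal (4 * remainder + 8 * cS * (n * R))"
      by (intro add_mono G L2 a2)
    also have "\<dots> = Rstar + ennreal (n * ((Kgeb + 2 * Bm) * cQ * R) + (4 * remainder + 8 * cS * (n * R)))"
      using nn by (subst ennreal_plus) (auto simp: add.assoc)
    also have "\<dots> \<le> Rstar + ennreal (Kblock * (n * R + remainder))"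
      using nn by (intro add_left_mono ennreal_leI fin_bound) auto
    finally show ?thesis .
  next
    case a3
    then have kb: "kap > b / 2" using b_pos by simp
    have "total_risk geb_loss \<le>
        (\<Sum>k\<in>B. \<integral>\<^sup>+X. ennreal (eb_loss k X) + ennreal (soft_loss k X) * indicator {X\<in>space P. khat X \<le> b} X \<partial>P)"
      by (intro sum_mono nn_integral_mono) (auto simp: geb_loss_def split: split_indicator)
    also have "\<dots> = total_risk eb_loss + (\<Sum>k\<in>B. \<integral>\<^sup>+X. ennreal (soft_loss k X) * indicator {X\<in>space P. khat X \<le> b} X \<partial>P)"
      unfolding sum.distrib[symmetric] using loss_measurable by (intro sum.cong refl nn_integral_add) auto
    also have "\<dots> \<le> (Rstar + ennreal (n * ((Kgeb + 2 * Bm) * cQ * R))) + ennreal (Dk * remainder)"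
      by (intro add_mono G[OF kb] soft_loss_wrong_branch[OF a3])
    also have "\<dots> = Rstar + ennreal (n * ((Kgeb + 2 * Bm) * cQ * R) + Dk * remainder)"
      using nn by (subst ennreal_plus) (auto simp: add.assoc)
    also have "\<dots> \<le> Rstar + ennreal (Kblock * (n * R + remainder))"
      using nn by (intro add_left_mono ennreal_leI fin_bound) auto
    finally show ?thesis .
  qed
  then show ?thesis by (simp add: R_def)
qed

end

section \<open>James-Stein shrinkage\<close>

text \<open>The exponent \<open>- 2 / 3\<close> is \<open>- 2 / n\<close> at the smallest relevant
  n, which is 3, and is integrable at the origin. The value \<open>top\<close> at 0 spares
  exceptional points in \<open>inverse_norm_bound\<close>.\<close>

definition inv_pow :: "real \<Rightarrow> ennreal" where
  "inv_pow x = (if x = 0 then top else ennreal (max 1 (\<bar>x\<bar> powr (-2/3))))"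

lemma inv_pow_borel [measurable]: "inv_pow \<in> borel_measurable borel"
  unfolding inv_pow_def[abs_def] by measurable

text \<open>The 7 is \<open>1 + 3 + 3\<close>: the mass of the density, and the integral of
  \<open>x powr (- 2 / 3)\<close> over \<open>[0, 1]\<close> together with its mirror image, where
  the density is at most 1.\<close>

lemma nn_integral_inv_pow: "(\<integral>\<^sup>+x. inv_pow x \<partial>Nrm \<mu>) \<le> 7"
proof -
  have half: "(\<integral>\<^sup>+x. ennreal (indicator {0..1} x * x powr (-2/3)) \<partial>lborel) = ennreal 3"
  proof -
    have "((\<lambda>x::real. x powr (-2/3)) has_integral (1 powr (-2/3 + 1) / (-2/3 + 1))) {0..1}"
      by (rule has_integral_powr_from_0) auto
    then have "((\<lambda>x::real. x powr (-2/3)) has_integral 3) {0..1}" by simp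
    from nn_integral_has_integral_lebesgue[OF _ this] show ?thesis by simp
  qed
  have "(\<integral>\<^sup>+x. inv_pow x \<partial>Nrm \<mu>) = (\<integral>\<^sup>+x. ennreal (gd (x - \<mu>)) * inv_pow x \<partial>lborel)"
    by (rule nn_integral_Nrm) measurable
  also have "\<dots> \<le> (\<integral>\<^sup>+x. ennreal (gd (x - \<mu>)) + (ennreal (indicator {0..1} x * x powr (-2/3)) + ennreal (indicator {0..1} (-x) * (-x) powr (-2/3))) \<partial>lborel)"
  proof (rule nn_integral_mono_AE)
    have le: "ennreal (gd (x - \<mu>)) * inv_pow x \<le>
        ennreal (gd (x - \<mu>)) + (ennreal (indicator {0..1} x * x powr (-2/3)) + ennreal (indicator {0..1} (-x) * (-x) powr (-2/3)))"
      if x: "x \<noteq> 0" for x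
    proof -
      have "\<bar>x\<bar> powr (-2/3) \<le> 1" if "\<bar>x\<bar> > 1"
        using that powr_mono[of "-2/3" 0 "\<bar>x\<bar>"] by (auto split: if_splits)
      then have "max 1 (\<bar>x\<bar> powr (-2/3)) \<le> 1 + (indicator {0..1} x * x powr (-2/3) + indicator {0..1} (-x) * (-x) powr (-2/3))"
        using x by (auto simp: indicator_def abs_if split: if_splits)
      then have "gd (x - \<mu>) * max 1 (\<bar>x\<bar> powr (-2/3)) \<le> gd (x - \<mu>) * (1 + (indicator {0..1} x * x powr (-2/3) + indicator {0..1} (-x) * (-x) powr (-2/3)))"
        by (rule mult_left_mono) simp
      also have "\<dots> \<le> gd (x - \<mu>) + 1 * (indicator {0..1} x * x powr (-2/3) + indicator {0..1} (-x) * (-x) powr (-2/3))"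
        unfolding distrib_left[of "gd (x - \<mu>)" 1] mult_1_right
        by (intro add_left_mono mult_right_mono gd_le_1) (auto simp: indicator_def)
      finally have "gd (x - \<mu>) * max 1 (\<bar>x\<bar> powr (-2/3)) \<le> gd (x - \<mu>) + (indicator {0..1} x * x powr (-2/3) + indicator {0..1} (-x) * (-x) powr (-2/3))"
        by simp
      then have "ennreal (gd (x - \<mu>) * max 1 (\<bar>x\<bar> powr (-2/3))) \<le> ennreal (gd (x - \<mu>) + (indicator {0..1} x * x powr (-2/3) + indicator {0..1} (-x) * (-x) powr (-2/3)))"
        by (rule ennreal_leI)
      then show ?thesis
        using x by (simp add: inv_pow_def ennreal_mult)
    qed
    show "AE x in lborel. ennreal (gd (x - \<mu>)) * inv_pow x \<le>
        ennreal (gd (x - \<mu>)) + (ennreal (indicator {0..1} x * x powr (-2/3)) + ennreal (indicator {0..1} (-x) * (-x) powr (-2/3)))"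
      using AE_lborel_singleton[of 0] by eventually_elim (rule le)
  qed
  also have "\<dots> = (\<integral>\<^sup>+x. ennreal (gd (x - \<mu>)) \<partial>lborel) + (ennreal 3 + (\<integral>\<^sup>+x. ennreal (indicator {0..1} (-x) * (-x) powr (-2/3)) \<partial>lborel))"
    by (subst nn_integral_add, measurable) (subst nn_integral_add, measurable, simp only: half)
  also have "(\<integral>\<^sup>+x. ennreal (indicator {0..1} (-x) * (-x) powr (-2/3)) \<partial>lborel) = ennreal 3"
    using nn_integral_lborel_uminus[of "\<lambda>x. ennreal (indicator {0..1} x * x powr (-2/3))"] half by simp
  also have "(\<integral>\<^sup>+x. ennreal (gd (x - \<mu>)) \<partial>lborel) = 1"
    by (rule nn_integral_gd)
  finally show ?thesis by simp
qed

context finite_block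
begin

text \<open>
  \<open>1 / \<parallel>X\<parallel>\<^sup>2\<close> is the product over \<open>k\<close> of its own powers with exponent \<open>1 / n\<close>, each of which is at most
  \<open>\<bar>X k\<bar> powr (- 2 / n)\<close>. For \<open>n \<ge> 3\<close> these functions of a single coordinate are integrable.
\<close>

lemma inverse_norm_bound:
  assumes card3: "card B \<ge> 3"
  shows "ennreal (1 / (\<Sum>l\<in>B. (X l)\<^sup>2)) \<le> (\<Prod>k\<in>B. inv_pow (X k))"
proof (cases "\<exists>k\<in>B. X k = 0")
  case True
  then obtain k where k: "k \<in> B" "X k = 0" by auto
  \<comment> \<open>A vanishing coordinate makes the product infinite, because the other factors are
    at least 1.\<close>
  have ge1: "inv_pow x \<ge> 1" for x by (auto simp: inv_pow_def simp flip: ennreal_1 intro: ennreal_leI)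
  have "1 \<le> (\<Prod>i\<in>B - {k}. inv_pow (X i))" using ge1 by (intro prod_ge_1) auto
  then have "(\<Prod>i\<in>B - {k}. inv_pow (X i)) \<noteq> 0" by (metis not_one_le_zero)
  then have "(\<Prod>i\<in>B. inv_pow (X i)) = top"
    using k fin by (subst prod.remove[of B k]) (auto simp: inv_pow_def ennreal_top_mult)
  then show ?thesis by simp
next
  case False
  define s where "s = (\<Sum>l\<in>B. (X l)\<^sup>2)"
  have ge: "(X k)\<^sup>2 \<le> s" if "k \<in> B" for k
    unfolding s_def using that fin by (intro member_le_sum) auto
  have pos: "(X k)\<^sup>2 > 0" if "k \<in> B" for k using False that by auto
  have s: "s > 0" unfolding s_def using fin ne pos by (intro sum_pos) auto
  have n3: "n \<ge> 3" using card3 by (simp add: n_def)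
  have "1 / s = (1 / s) powr (\<Sum>k\<in>B. 1 / n)" using n_pos s by (simp add: n_def)
  also have "\<dots> = (\<Prod>k\<in>B. (1 / s) powr (1 / n))" using s fin by (subst powr_sum) auto
  also have "\<dots> \<le> (\<Prod>k\<in>B. max 1 (\<bar>X k\<bar> powr (-2/3)))"
  proof (rule prod_mono, safe)
    fix k assume k: "k \<in> B"
    show "(1 / s) powr (1 / n) \<ge> 0" by simp
    have x: "\<bar>X k\<bar> > 0" using pos[OF k] by simp
    have "(1 / s) powr (1 / n) \<le> (1 / (X k)\<^sup>2) powr (1 / n)"
      using ge[OF k] pos[OF k] s n_pos by (intro powr_mono2 divide_left_mono) auto
    also have "1 / (X k)\<^sup>2 = \<bar>X k\<bar> powr (-2)"
      using x by (simp add: powr_minus_divide powr_numeral)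
    also have "(\<bar>X k\<bar> powr (-2)) powr (1 / n) = \<bar>X k\<bar> powr (- (2 / n))" by (simp add: powr_powr)
    also have "\<dots> \<le> max 1 (\<bar>X k\<bar> powr (-2/3))"
    proof (cases "\<bar>X k\<bar> \<ge> 1")
      case True
      then have "\<bar>X k\<bar> powr (- (2 / n)) \<le> \<bar>X k\<bar> powr 0" using n_pos by (intro powr_mono) auto
      then show ?thesis using x by simp
    next
      case False
      have "2 / n \<le> 2 / 3" using n3 by (intro divide_left_mono) auto
      then have "\<bar>X k\<bar> powr (- (2 / n)) \<le> \<bar>X k\<bar> powr (-2/3)" using False x by (intro powr_mono') auto
      then show ?thesis by simp
    qed
    finally show "(1 / s) powr (1 / n) \<le> max 1 (\<bar>X k\<bar> powr (-2/3))" .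
  qed
  finally have "ennreal (1 / s) \<le> ennreal (\<Prod>k\<in>B. max 1 (\<bar>X k\<bar> powr (-2/3)))" by (rule ennreal_leI)
  also have "\<dots> = (\<Prod>k\<in>B. ennreal (max 1 (\<bar>X k\<bar> powr (-2/3))))" by (rule prod_ennreal[symmetric]) simp
  also have "\<dots> = (\<Prod>k\<in>B. inv_pow (X k))" using False by (intro prod.cong refl) (simp add: inv_pow_def)
  finally show ?thesis by (simp add: s_def)
qed

text \<open>Independence splits the integral of the product. A bound exponential in the block size
  is harmless, as it serves blocks of at most \<open>nstar\<close> coordinates.\<close>

lemma inverse_norm_expectation:
  assumes "card B \<ge> 3"
  shows "(\<integral>\<^sup>+X. ennreal (1 / (\<Sum>l\<in>B. (X l)\<^sup>2)) \<partial>P) \<le> ennreal (7 ^ card B)"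
proof -
  interpret N: product_sigma_finite "\<lambda>i. Nrm (\<theta> i)"
    unfolding product_sigma_finite_def using prob_space_Nrm prob_space_imp_sigma_finite by blast
  have "(\<integral>\<^sup>+X. ennreal (1 / (\<Sum>l\<in>B. (X l)\<^sup>2)) \<partial>P) \<le> (\<integral>\<^sup>+X. (\<Prod>k\<in>B. inv_pow (X k)) \<partial>P)"
    by (intro nn_integral_mono inverse_norm_bound assms)
  also have "\<dots> = (\<Prod>k\<in>B. \<integral>\<^sup>+x. inv_pow x \<partial>Nrm (\<theta> k))"
    unfolding P_def by (rule N.product_nn_integral_prod[OF fin]) auto
  also have "\<dots> \<le> (\<Prod>k\<in>B. 7)" by (intro prod_mono_ennreal nn_integral_inv_pow)
  also have "\<dots> = ennreal (7 ^ card B)" by (simp flip: ennreal_power)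
  finally show ?thesis .
qed

lemma sq_expectation: "k \<in> B \<Longrightarrow> (\<integral>\<^sup>+X. ennreal ((X k - \<theta> k)\<^sup>2) \<partial>P) = 1"
  using nn_integral_coord[of k "\<lambda>x. ennreal ((x - \<theta> k)\<^sup>2)"] by (simp add: nn_integral_Nrm_sq)

text \<open>The squared corrections \<open>(m / s * X k)\<^sup>2\<close> sum to
  \<open>m\<^sup>2 / s\<close> with \<open>s = \<parallel>X\<parallel>\<^sup>2\<close>, so a finite
  inverse moment suffices. Below dimension 3 the truncated factor m is 0.\<close>

lemma james_stein_risk:
  "total_risk (\<lambda>k X. (james_stein 1 B X k - \<theta> k)\<^sup>2) \<le> ennreal (2 * n + 2 * n\<^sup>2 * 7 ^ card B)"
proof -
  define m where "m = real (card B - 2)"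
  have m: "0 \<le> m" "m \<le> n" by (auto simp: m_def n_def)
  define Z where "Z = (\<lambda>X::nat \<Rightarrow> real. 1 / (\<Sum>l\<in>B. (X l)\<^sup>2))"
  have comp [measurable]: "(\<lambda>X. X k) \<in> borel_measurable P" if "k \<in> B" for k using that by (rule coord_measurable)
  have Zm: "Z \<in> borel_measurable P" unfolding Z_def by measurable
  have EZ: "ennreal (2 * m\<^sup>2) * (\<integral>\<^sup>+X. ennreal (Z X) \<partial>P) \<le> ennreal (2 * n\<^sup>2 * 7 ^ card B)"
  proof (cases "card B \<ge> 3")
    case True
    have "ennreal (2 * m\<^sup>2) * (\<integral>\<^sup>+X. ennreal (Z X) \<partial>P) \<le> ennreal (2 * n\<^sup>2) * ennreal (7 ^ card B)"
      unfolding Z_def using m True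
      by (intro mult_mono inverse_norm_expectation ennreal_leI mult_left_mono power_mono) auto
    then show ?thesis by (simp flip: ennreal_mult)
  next
    case False
    then have "m = 0" by (simp add: m_def)
    then show ?thesis by simp
  qed
  have le: "(\<Sum>k\<in>B. ennreal ((james_stein 1 B X k - \<theta> k)\<^sup>2)) \<le>
      (\<Sum>k\<in>B. 2 * ennreal ((X k - \<theta> k)\<^sup>2)) + ennreal (2 * m\<^sup>2) * ennreal (Z X)" for X
  proof -
    define s where "s = (\<Sum>l\<in>B. (X l)\<^sup>2)"
    have s: "s \<ge> 0" by (simp add: s_def sum_nonneg)
    have each: "(james_stein 1 B X k - \<theta> k)\<^sup>2 \<le> 2 * (X k - \<theta> k)\<^sup>2 + 2 * (m / s)\<^sup>2 * (X k)\<^sup>2" for k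
    proof -
      have "james_stein 1 B X k - \<theta> k = (X k - \<theta> k) + - (m / s * X k)"
        by (simp add: james_stein_def m_def s_def algebra_simps)
      then have "(james_stein 1 B X k - \<theta> k)\<^sup>2 \<le> 2 * (X k - \<theta> k)\<^sup>2 + 2 * (- (m / s * X k))\<^sup>2"
        using sq_sum_le by metis
      then show ?thesis by (simp add: power_mult_distrib power_divide)
    qed
    have "(\<Sum>k\<in>B. (james_stein 1 B X k - \<theta> k)\<^sup>2) \<le> (\<Sum>k\<in>B. 2 * (X k - \<theta> k)\<^sup>2 + 2 * (m / s)\<^sup>2 * (X k)\<^sup>2)"
      by (intro sum_mono each)
    also have "\<dots> = (\<Sum>k\<in>B. 2 * (X k - \<theta> k)\<^sup>2) + 2 * (m / s)\<^sup>2 * s"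
      by (simp add: sum.distrib s_def flip: sum_distrib_left)
    also have "2 * (m / s)\<^sup>2 * s = 2 * m\<^sup>2 * Z X"
    proof -
      have "Z X = 1 / s" by (simp add: Z_def s_def)
      then show ?thesis by (cases "s = 0") (simp_all add: power_divide power2_eq_square[of s])
    qed
    finally have "ennreal (\<Sum>k\<in>B. (james_stein 1 B X k - \<theta> k)\<^sup>2) \<le> ennreal ((\<Sum>k\<in>B. 2 * (X k - \<theta> k)\<^sup>2) + 2 * m\<^sup>2 * Z X)"
      by (rule ennreal_leI)
    also have "\<dots> = ennreal (\<Sum>k\<in>B. 2 * (X k - \<theta> k)\<^sup>2) + ennreal (2 * m\<^sup>2 * Z X)"
      using s by (intro ennreal_plus sum_nonneg mult_nonneg_nonneg) (auto simp: Z_def s_def[symmetric])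
    also have "ennreal (2 * m\<^sup>2 * Z X) = ennreal (2 * m\<^sup>2) * ennreal (Z X)"
      using s by (intro ennreal_mult) (auto simp: Z_def s_def[symmetric])
    also have "ennreal (\<Sum>k\<in>B. 2 * (X k - \<theta> k)\<^sup>2) = (\<Sum>k\<in>B. 2 * ennreal ((X k - \<theta> k)\<^sup>2))"
      by (subst sum_ennreal[symmetric]) (auto simp: ennreal_mult)
    finally show ?thesis by (simp add: sum_ennreal)
  qed
  have "total_risk (\<lambda>k X. (james_stein 1 B X k - \<theta> k)\<^sup>2) = (\<integral>\<^sup>+X. (\<Sum>k\<in>B. ennreal ((james_stein 1 B X k - \<theta> k)\<^sup>2)) \<partial>P)"
    unfolding james_stein_def by (rule nn_integral_sum[symmetric]) measurable
  also have "\<dots> \<le> (\<integral>\<^sup>+X. (\<Sum>k\<in>B. 2 * ennreal ((X k - \<theta> k)\<^sup>2)) + ennreal (2 * m\<^sup>2) * ennreal (Z X) \<partial>P)"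
    by (intro nn_integral_mono le)
  also have "\<dots> = (\<Sum>k\<in>B. 2 * (\<integral>\<^sup>+X. ennreal ((X k - \<theta> k)\<^sup>2) \<partial>P)) + ennreal (2 * m\<^sup>2) * (\<integral>\<^sup>+X. ennreal (Z X) \<partial>P)"
    using Zm by (simp add: nn_integral_add nn_integral_sum nn_integral_cmult)
  also have "(\<Sum>k\<in>B. 2 * (\<integral>\<^sup>+X. ennreal ((X k - \<theta> k)\<^sup>2) \<partial>P)) = ennreal (2 * n)"
    using n_pos by (simp add: sq_expectation n_def ennreal_mult ennreal_of_nat_eq_real_of_nat mult.commute)
  also have "ennreal (2 * n) + ennreal (2 * m\<^sup>2) * (\<integral>\<^sup>+X. ennreal (Z X) \<partial>P) \<le> ennreal (2 * n) + ennreal (2 * n\<^sup>2 * 7 ^ card B)"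
    by (intro add_left_mono EZ)
  also have "\<dots> = ennreal (2 * n + 2 * n\<^sup>2 * 7 ^ card B)"
    using n_pos by (intro ennreal_plus[symmetric]) auto
  finally show ?thesis .
qed

end

section \<open>From blocks to the sequence model\<close>

abbreviation seq_risk ::
  "enat \<Rightarrow> real \<Rightarrow> (nat \<Rightarrow> real) \<Rightarrow> ((nat \<Rightarrow> real) \<Rightarrow> nat \<Rightarrow> real) \<Rightarrow> nat set \<Rightarrow> ennreal" where
  "seq_risk N \<epsilon> \<beta> est B \<equiv> \<Sum>i\<in>B. \<integral>\<^sup>+y. ennreal ((est y i - \<beta> i)\<^sup>2) \<partial>gauss_seq N \<epsilon> \<beta>"

text \<open>Monotonicity of power means, from Young's inequality for the normalized values
  \<open>\<bar>u k\<bar> / C\<close>. For \<open>p > 2\<close> it permits the exponent 2 in the rate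
  while C is still formed with p.\<close>

lemma power_mean_le:
  fixes u :: "nat \<Rightarrow> real"
  assumes B: "finite B" "B \<noteq> {}" and p: "p > 0" and C: "C \<ge> 0" "C powr p = (\<Sum>k\<in>B. \<bar>u k\<bar> powr p) / real (card B)"
  shows "(\<Sum>k\<in>B. \<bar>u k\<bar> powr min p 2) / real (card B) \<le> C powr min p 2"
proof (cases "p \<le> 2")
  case True then show ?thesis using C by (simp add: min_def)
next
  case False
  define n where "n = real (card B)"
  have n: "n > 0" using B by (simp add: n_def card_gt_0_iff)
  have p2: "p > 2" "min p 2 = 2" using False by auto
  show ?thesis
  proof (cases "C = 0")
    case True
    then have "(\<Sum>k\<in>B. \<bar>u k\<bar> powr p) = 0" using C n by (simp add: n_def)
    then have "\<forall>k\<in>B. \<bar>u k\<bar> powr p = 0" using B by (subst (asm) sum_nonneg_eq_0_iff) auto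
    then have "(\<Sum>k\<in>B. \<bar>u k\<bar> powr 2) = 0" by (intro sum.neutral) auto
    then show ?thesis by (simp add: p2)
  next
    case False
    then have C0: "C > 0" using C by simp
    define v where "v = (\<lambda>k. \<bar>u k\<bar> / C)"
    have young: "x powr 2 \<le> 2 / p * x powr p + (1 - 2 / p)" if "x \<ge> 0" for x
    proof (cases "x = 0")
      case True then show ?thesis using p2 by simp
    next
      case False
      then have "(x powr p) powr (2 / p) * 1 powr (1 - 2 / p) \<le> 2 / p * x powr p + (1 - 2 / p) * 1"
        using p2 that by (intro Youngs_inequality_0) auto
      then show ?thesis using p2 by (simp add: powr_powr)
    qed
    have vp: "(\<Sum>k\<in>B. v k powr p) = n"
    proof -
      have "(\<Sum>k\<in>B. v k powr p) = (\<Sum>k\<in>B. \<bar>u k\<bar> powr p) / C powr p"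
        using C0 by (simp add: v_def powr_divide sum_divide_distrib)
      also have "(\<Sum>k\<in>B. \<bar>u k\<bar> powr p) = n * C powr p" using C n by (simp add: n_def)
      finally show ?thesis using C0 by simp
    qed
    have "(\<Sum>k\<in>B. v k powr 2) \<le> (\<Sum>k\<in>B. 2 / p * v k powr p + (1 - 2 / p))"
      using C0 by (intro sum_mono young) (simp add: v_def)
    also have "\<dots> = 2 / p * (\<Sum>k\<in>B. v k powr p) + n * (1 - 2 / p)"
      by (simp only: sum.distrib sum_distrib_left sum_constant n_def)
    also have "\<dots> = n" by (simp add: vp algebra_simps)
    finally have "(\<Sum>k\<in>B. v k powr 2) \<le> n" .
    moreover have "(\<Sum>k\<in>B. v k powr 2) = (\<Sum>k\<in>B. \<bar>u k\<bar> powr 2) / C powr 2"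
      using C0 by (simp add: v_def powr_divide sum_divide_distrib)
    ultimately have "(\<Sum>k\<in>B. \<bar>u k\<bar> powr 2) \<le> n * C powr 2" using C0 by (simp add: divide_le_eq)
    then show ?thesis using n by (simp add: p2 n_def[symmetric] divide_le_eq mult.commute)
  qed
qed

lemma normalized_norm_powr:
  fixes \<beta> :: "nat \<Rightarrow> real"
  assumes B: "finite B" "B \<noteq> {}" and p: "p > 0" and \<epsilon>: "\<epsilon> > 0"
  defines "C \<equiv> (\<Sum>i\<in>B. \<bar>\<beta> i\<bar> powr p) powr (1 / p) / (\<epsilon> * real (card B) powr (1 / p))"
  shows "C \<ge> 0" "C powr p = (\<Sum>k\<in>B. \<bar>\<beta> k / \<epsilon>\<bar> powr p) / real (card B)"
proof -
  have n: "real (card B) > 0" using B by (simp add: card_gt_0_iff)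
  show "C \<ge> 0" using \<epsilon> by (simp add: C_def)
  have "C powr p = (\<Sum>i\<in>B. \<bar>\<beta> i\<bar> powr p) / (\<epsilon> powr p * real (card B))"
    unfolding C_def using \<epsilon> n p by (simp add: powr_divide powr_mult powr_powr sum_nonneg)
  also have "\<dots> = (\<Sum>k\<in>B. \<bar>\<beta> k / \<epsilon>\<bar> powr p) / real (card B)"
    using \<epsilon> by (simp add: powr_divide flip: sum_divide_distrib)
  finally show "C powr p = (\<Sum>k\<in>B. \<bar>\<beta> k / \<epsilon>\<bar> powr p) / real (card B)" .
qed

text \<open>Both sides are suprema of finite sums, and a finite subset of the union lies in finitely
  many of the finite sets \<open>D j\<close>.\<close>

lemma infsum_ennreal_UN:
  fixes f :: "'a \<Rightarrow> ennreal" and D :: "'b \<Rightarrow> 'a set"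
  assumes fin: "\<And>j. j \<in> J \<Longrightarrow> finite (D j)"
    and disj: "\<And>i j. i \<in> J \<Longrightarrow> j \<in> J \<Longrightarrow> i \<noteq> j \<Longrightarrow> D i \<inter> D j = {}"
  shows "(\<Sum>\<^sub>\<infinity>i\<in>(\<Union>j\<in>J. D j). f i) = (\<Sum>\<^sub>\<infinity>j\<in>J. \<Sum>i\<in>D j. f i)"
proof (rule antisym)
  have eq: "(\<Sum>j\<in>F. \<Sum>i\<in>D j. f i) = (\<Sum>i\<in>(\<Union>j\<in>F. D j). f i)" if "finite F" "F \<subseteq> J" for F
    using that by (intro sum.UNION_disjoint[symmetric]) (use fin disj in blast)+
  show "(\<Sum>\<^sub>\<infinity>i\<in>(\<Union>j\<in>J. D j). f i) \<le> (\<Sum>\<^sub>\<infinity>j\<in>J. \<Sum>i\<in>D j. f i)"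
    unfolding nonneg_infsum_complete[of "\<Union>j\<in>J. D j" f, simplified] nonneg_infsum_complete[of J "\<lambda>j. \<Sum>i\<in>D j. f i", simplified]
  proof (rule SUP_least, safe)
    fix F assume F: "finite F" "F \<subseteq> (\<Union>j\<in>J. D j)"
    then obtain G where G: "finite G" "G \<subseteq> J" "F \<subseteq> (\<Union>j\<in>G. D j)"
      using finite_subset_Union[of F "D ` J"] by (metis finite_subset_image)
    have "sum f F \<le> sum f (\<Union>j\<in>G. D j)"
      using G fin by (intro sum_mono2) auto
    also have "\<dots> = (\<Sum>j\<in>G. \<Sum>i\<in>D j. f i)" using eq[OF G(1,2)] by simp
    also have "\<dots> \<le> (SUP F\<in>{F. finite F \<and> F \<subseteq> J}. \<Sum>j\<in>F. \<Sum>i\<in>D j. f i)"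
      using G by (intro SUP_upper) auto
    finally show "sum f F \<le> (SUP F\<in>{F. finite F \<and> F \<subseteq> J}. \<Sum>j\<in>F. \<Sum>i\<in>D j. f i)" .
  qed
  show "(\<Sum>\<^sub>\<infinity>j\<in>J. \<Sum>i\<in>D j. f i) \<le> (\<Sum>\<^sub>\<infinity>i\<in>(\<Union>j\<in>J. D j). f i)"
    unfolding nonneg_infsum_complete[of "\<Union>j\<in>J. D j" f, simplified] nonneg_infsum_complete[of J "\<lambda>j. \<Sum>i\<in>D j. f i", simplified]
  proof (rule SUP_least, safe)
    fix G assume G: "finite G" "G \<subseteq> J"
    show "(\<Sum>j\<in>G. \<Sum>i\<in>D j. f i) \<le> (SUP F\<in>{F. finite F \<and> F \<subseteq> (\<Union>j\<in>J. D j)}. sum f F)"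
      unfolding eq[OF G] using G fin by (intro SUP_upper) auto
  qed
qed

lemma infsum_ennreal_cmult: "(\<Sum>\<^sub>\<infinity>j\<in>J. c * f j) = c * (\<Sum>\<^sub>\<infinity>j\<in>J. f j)" for c :: ennreal
  unfolding nonneg_infsum_complete[of J f, simplified] nonneg_infsum_complete[of J "\<lambda>j. c * f j", simplified]
  by (simp add: SUP_mult_left_ennreal sum_distrib_left)

lemma distr_normal_scale:
  assumes "\<epsilon> > 0"
  shows "distr (density lborel (normal_density \<mu> \<epsilon>)) borel (\<lambda>x. x / \<epsilon>) = Nrm (\<mu> / \<epsilon>)"
proof -
  interpret prob_space "density lborel (normal_density \<mu> \<epsilon>)"
    using assms by (rule prob_space_normal_density)
  have "distributed (density lborel (normal_density \<mu> \<epsilon>)) lborel (\<lambda>x. x) (normal_density \<mu> \<epsilon>)"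
    unfolding distributed_def by (auto simp: distr_id2)
  from normal_density_affine[OF this assms, of "1 / \<epsilon>" 0]
  have "distributed (density lborel (normal_density \<mu> \<epsilon>)) lborel (\<lambda>x. x / \<epsilon>) (normal_density (\<mu> / \<epsilon>) 1)"
    using assms by simp
  then have "distr (density lborel (normal_density \<mu> \<epsilon>)) lborel (\<lambda>x. x / \<epsilon>) = Nrm (\<mu> / \<epsilon>)"
    by (rule distributed_distr_eq_density)
  moreover have "distr (density lborel (normal_density \<mu> \<epsilon>)) lborel (\<lambda>x. x / \<epsilon>) = distr (density lborel (normal_density \<mu> \<epsilon>)) borel (\<lambda>x. x / \<epsilon>)"
    by (rule distr_cong) auto
  ultimately show ?thesis by simp
qed

text \<open>The rescaled block is a finite marginal of a possibly infinite product; its law is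
  identified through the independence of its coordinates.\<close>

lemma (in finite_block) distr_gauss_seq:
  assumes \<epsilon>: "\<epsilon> > 0" and B: "B \<subseteq> index_set N" and \<theta>: "\<And>i. \<theta> i = \<beta> i / \<epsilon>"
  shows "distr (gauss_seq N \<epsilon> \<beta>) (PiM B (\<lambda>_. borel)) (\<lambda>y. \<lambda>i\<in>B. y i / \<epsilon>) = P"
proof -
  define I where "I = index_set N"
  define M where "M = (\<lambda>i. density lborel (normal_density (\<beta> i) \<epsilon>))"
  have Mp: "prob_space (M i)" for i unfolding M_def using \<epsilon> by (rule prob_space_normal_density)
  have G: "gauss_seq N \<epsilon> \<beta> = PiM I M" by (simp add: gauss_seq_def I_def M_def)
  interpret G: prob_space "PiM I M" by (rule prob_space_PiM) (rule Mp)
  have "G.indep_vars M (\<lambda>i y. y i) I"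
    using Mp ne B by (intro indep_vars_coordinates) (auto simp: I_def)
  from G.indep_vars_subset[OF this] have "G.indep_vars M (\<lambda>i y. y i) B" using B by (simp add: I_def)
  then have ind: "G.indep_vars (\<lambda>_. borel) (\<lambda>i y. y i / \<epsilon>) B"
    by (rule G.indep_vars_compose2) (simp add: M_def)
  have meas: "(\<lambda>y. y i / \<epsilon>) \<in> borel_measurable (PiM I M)" if "i \<in> B" for i
  proof -
    have "i \<in> I" using that B by (auto simp: I_def)
    then have "(\<lambda>y. y i) \<in> measurable (PiM I M) (M i)" by (rule measurable_component_singleton)
    then have "(\<lambda>y. y i) \<in> borel_measurable (PiM I M)" by (simp add: M_def cong: measurable_cong_sets)
    then show ?thesis by simp
  qed
  have "distr (PiM I M) (PiM B (\<lambda>_. borel)) (\<lambda>y. \<lambda>i\<in>B. y i / \<epsilon>) = PiM B (\<lambda>i. distr (PiM I M) borel (\<lambda>y. y i / \<epsilon>))"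
    using ind meas ne by (subst (asm) G.indep_vars_iff_distr_eq_PiM') auto
  also have "\<dots> = P"
    unfolding P_def
  proof (rule PiM_cong)
    fix i assume i: "i \<in> B"
    then have iI: "i \<in> I" using B by (auto simp: I_def)
    have c: "(\<lambda>y. y i) \<in> measurable (PiM I M) (M i)" using iI by (rule measurable_component_singleton)
    have "distr (PiM I M) borel (\<lambda>y. y i / \<epsilon>) = distr (distr (PiM I M) (M i) (\<lambda>y. y i)) borel (\<lambda>x. x / \<epsilon>)"
      using c by (subst distr_distr) (auto simp: M_def comp_def)
    also have "distr (PiM I M) (M i) (\<lambda>y. y i) = M i" using Mp iI by (intro distr_PiM_component)
    also have "distr (M i) borel (\<lambda>x. x / \<epsilon>) = Nrm (\<theta> i)" unfolding M_def \<theta> using \<epsilon> by (rule distr_normal_scale)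
    finally show "distr (PiM I M) borel (\<lambda>y. y i / \<epsilon>) = Nrm (\<theta> i)" .
  qed simp
  finally show ?thesis by (simp add: G)
qed

lemma (in finite_block) nn_integral_gauss_seq:
  assumes \<epsilon>: "\<epsilon> > 0" and B: "B \<subseteq> index_set N" and \<theta>: "\<And>i. \<theta> i = \<beta> i / \<epsilon>"
    and F: "F \<in> borel_measurable P"
  shows "(\<integral>\<^sup>+y. F (\<lambda>i\<in>B. y i / \<epsilon>) \<partial>gauss_seq N \<epsilon> \<beta>) = (\<integral>\<^sup>+X. F X \<partial>P)"
proof -
  have "(\<lambda>y. \<lambda>i\<in>B. y i / \<epsilon>) \<in> measurable (gauss_seq N \<epsilon> \<beta>) (PiM B (\<lambda>_. borel))"
  proof (rule measurable_restrict)
    fix i assume "i \<in> B"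
    then have "(\<lambda>y. y i) \<in> measurable (gauss_seq N \<epsilon> \<beta>) (density lborel (normal_density (\<beta> i) \<epsilon>))"
      unfolding gauss_seq_def using B by (intro measurable_component_singleton) auto
    then have "(\<lambda>y. y i) \<in> borel_measurable (gauss_seq N \<epsilon> \<beta>)" by (simp cong: measurable_cong_sets)
    then show "(\<lambda>y. y i / \<epsilon>) \<in> borel_measurable (gauss_seq N \<epsilon> \<beta>)" by simp
  qed
  moreover have "F \<in> borel_measurable (PiM B (\<lambda>_. borel))"
    using F by (simp cong: measurable_cong_sets add: sets_P)
  ultimately show ?thesis
    by (subst distr_gauss_seq[OF \<epsilon> B \<theta>, symmetric]) (simp add: nn_integral_distr)
qed

context finite_block
begin

text \<open>The substitution \<open>h (\<epsilon> * x) / \<epsilon>\<close> reduces any rule to unit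
  noise, where \<open>Rstar\<close> is the minimum.\<close>

lemma separable_block_risk:
  assumes \<epsilon>: "\<epsilon> > 0" and B: "B \<subseteq> index_set N" and \<theta>: "\<And>i. \<theta> i = \<beta> i / \<epsilon>"
    and h [measurable]: "h \<in> borel_measurable borel"
  shows "ennreal (\<epsilon>\<^sup>2) * Rstar \<le> seq_risk N \<epsilon> \<beta> (\<lambda>y i. h (y i)) B"
proof -
  define h' where "h' = (\<lambda>x. h (\<epsilon> * x) / \<epsilon>)"
  have h' [measurable]: "h' \<in> borel_measurable borel" unfolding h'_def by measurable
  have each: "(\<integral>\<^sup>+y. ennreal ((h (y i) - \<beta> i)\<^sup>2) \<partial>gauss_seq N \<epsilon> \<beta>) = ennreal (\<epsilon>\<^sup>2) * (\<integral>\<^sup>+x. ennreal ((h' x - \<theta> i)\<^sup>2) \<partial>Nrm (\<theta> i))"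
    if i: "i \<in> B" for i
  proof -
    have [measurable]: "(\<lambda>X. X i) \<in> borel_measurable P" using i by (rule coord_measurable)
    have "(\<integral>\<^sup>+y. ennreal ((h (y i) - \<beta> i)\<^sup>2) \<partial>gauss_seq N \<epsilon> \<beta>) = (\<integral>\<^sup>+y. (\<lambda>X. ennreal (\<epsilon>\<^sup>2) * ennreal ((h' (X i) - \<theta> i)\<^sup>2)) (\<lambda>i\<in>B. y i / \<epsilon>) \<partial>gauss_seq N \<epsilon> \<beta>)"
    proof (rule nn_integral_cong)
      fix y
      have "h (y i) - \<beta> i = \<epsilon> * (h' (y i / \<epsilon>) - \<theta> i)" using \<epsilon> by (simp add: h'_def \<theta> right_diff_distrib)
      then show "ennreal ((h (y i) - \<beta> i)\<^sup>2) = (\<lambda>X. ennreal (\<epsilon>\<^sup>2) * ennreal ((h' (X i) - \<theta> i)\<^sup>2)) (\<lambda>i\<in>B. y i / \<epsilon>)"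
        using i by (simp add: power_mult_distrib ennreal_mult)
    qed
    also have "\<dots> = (\<integral>\<^sup>+X. ennreal (\<epsilon>\<^sup>2) * ennreal ((h' (X i) - \<theta> i)\<^sup>2) \<partial>P)"
      by (rule nn_integral_gauss_seq[OF \<epsilon> B \<theta>]) measurable
    also have "\<dots> = ennreal (\<epsilon>\<^sup>2) * (\<integral>\<^sup>+X. ennreal ((h' (X i) - \<theta> i)\<^sup>2) \<partial>P)"
      by (rule nn_integral_cmult) measurable
    also have "(\<integral>\<^sup>+X. ennreal ((h' (X i) - \<theta> i)\<^sup>2) \<partial>P) = (\<integral>\<^sup>+x. ennreal ((h' x - \<theta> i)\<^sup>2) \<partial>Nrm (\<theta> i))"
      using nn_integral_coord[OF i, of "\<lambda>x. ennreal ((h' x - \<theta> i)\<^sup>2)"] by simp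
    finally show ?thesis .
  qed
  have "ennreal (\<epsilon>\<^sup>2) * Rstar \<le> ennreal (\<epsilon>\<^sup>2) * (\<Sum>i\<in>B. \<integral>\<^sup>+x. ennreal ((h' x - \<theta> i)\<^sup>2) \<partial>Nrm (\<theta> i))"
    by (intro mult_left_mono Rstar_le h') simp
  also have "\<dots> = seq_risk N \<epsilon> \<beta> (\<lambda>y i. h (y i)) B"
    using each by (simp add: sum_distrib_left)
  finally show ?thesis .
qed

lemma scaled_block_risk:
  assumes \<epsilon>: "\<epsilon> > 0" and B: "B \<subseteq> index_set N" and \<theta>: "\<And>i. \<theta> i = \<beta> i / \<epsilon>"
    and E: "\<And>i y. i \<in> B \<Longrightarrow> est y i = \<epsilon> * t (\<lambda>i\<in>B. y i / \<epsilon>) i"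
    and t: "\<And>i. i \<in> B \<Longrightarrow> (\<lambda>X. t X i) \<in> borel_measurable P"
  shows "seq_risk N \<epsilon> \<beta> est B =
    ennreal (\<epsilon>\<^sup>2) * total_risk (\<lambda>i X. (t X i - \<theta> i)\<^sup>2)"
  unfolding sum_distrib_left
proof (rule sum.cong[OF refl])
  fix i assume i: "i \<in> B"
  have [measurable]: "(\<lambda>X. t X i) \<in> borel_measurable P" using i by (rule t)
  have "(\<integral>\<^sup>+y. ennreal ((est y i - \<beta> i)\<^sup>2) \<partial>gauss_seq N \<epsilon> \<beta>) = (\<integral>\<^sup>+y. (\<lambda>X. ennreal (\<epsilon>\<^sup>2) * ennreal ((t X i - \<theta> i)\<^sup>2)) (\<lambda>i\<in>B. y i / \<epsilon>) \<partial>gauss_seq N \<epsilon> \<beta>)"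
  proof (rule nn_integral_cong)
    fix y
    have "est y i - \<beta> i = \<epsilon> * (t (\<lambda>i\<in>B. y i / \<epsilon>) i - \<theta> i)" using \<epsilon> E[OF i, of y] by (simp add: \<theta> right_diff_distrib)
    then show "ennreal ((est y i - \<beta> i)\<^sup>2) = (\<lambda>X. ennreal (\<epsilon>\<^sup>2) * ennreal ((t X i - \<theta> i)\<^sup>2)) (\<lambda>i\<in>B. y i / \<epsilon>)"
      by (simp only: power_mult_distrib ennreal_mult zero_le_power2)
  qed
  also have "\<dots> = (\<integral>\<^sup>+X. ennreal (\<epsilon>\<^sup>2) * ennreal ((t X i - \<theta> i)\<^sup>2) \<partial>P)"
    by (rule nn_integral_gauss_seq[OF \<epsilon> B \<theta>]) measurable
  also have "\<dots> = ennreal (\<epsilon>\<^sup>2) * (\<integral>\<^sup>+X. ennreal ((t X i - \<theta> i)\<^sup>2) \<partial>P)"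
    by (rule nn_integral_cmult) measurable
  finally show "(\<integral>\<^sup>+y. ennreal ((est y i - \<beta> i)\<^sup>2) \<partial>gauss_seq N \<epsilon> \<beta>) = ennreal (\<epsilon>\<^sup>2) * (\<integral>\<^sup>+X. ennreal ((t X i - \<theta> i)\<^sup>2) \<partial>P)" .
qed

end

text \<open>Convergence controls all but finitely many n. For the remaining ones the positivity of
  \<open>geb_rho\<close> makes the factors positive, and so is the minimum of a finite set of
  them.\<close>

lemma scale_bounds:
  fixes nstar \<rho>0 :: real and \<eta> :: "nat \<Rightarrow> real"
  assumes "nstar > 2" "\<rho>0 > 0" and \<eta>: "\<eta> \<longlonglongrightarrow> 0"
    and pos: "\<And>n. real n \<ge> nstar \<Longrightarrow> geb_rho \<rho>0 \<eta> n > 0"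
  obtains r1 r2 where "r1 > 0" "\<And>n. real n \<ge> nstar \<Longrightarrow> r1 \<le> (1 + \<eta> n) * \<rho>0 \<and> (1 + \<eta> n) * \<rho>0 \<le> r2"
proof -
  define x where "x = (\<lambda>n. (1 + \<eta> n) * \<rho>0)"
  have xpos: "x n > 0" if "real n \<ge> nstar" for n
  proof -
    have "x n * sqrt (2 * ln (real n) / real n) > 0" using pos[OF that] by (simp add: geb_rho_def x_def)
    moreover have "sqrt (2 * ln (real n) / real n) \<ge> 0" using that assms by (intro real_sqrt_ge_zero divide_nonneg_nonneg) auto
    ultimately show ?thesis by (simp add: zero_less_mult_iff)
  qed
  have lim: "x \<longlonglongrightarrow> (1 + 0) * \<rho>0" unfolding x_def by (intro tendsto_intros \<eta>)
  then have "Bseq x" using convergent_imp_Bseq convergentI by blast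
  then obtain r2 where r2: "\<And>n. \<bar>x n\<bar> \<le> r2" by (auto simp: Bseq_def)
  have "\<forall>\<^sub>F n in sequentially. x n > \<rho>0 / 2"
    using lim by (rule order_tendstoD) (use assms in auto)
  then obtain n1 where n1: "\<And>n. n \<ge> n1 \<Longrightarrow> x n > \<rho>0 / 2" by (auto simp: eventually_sequentially)
  define A where "A = insert (\<rho>0 / 2) (x ` {n. n < n1 \<and> real n \<ge> nstar})"
  have fin: "finite A" by (simp add: A_def)
  have r1: "Min A > 0" using fin xpos assms by (subst Min_gr_iff) (auto simp: A_def)
  have "Min A \<le> x n" if "real n \<ge> nstar" for n
  proof (cases "n < n1")
    case True then show ?thesis using fin that by (intro Min_le) (auto simp: A_def)
  next
    case False
    have "Min A \<le> \<rho>0 / 2" using fin by (intro Min_le) (auto simp: A_def)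
    then show ?thesis using n1[of n] False by simp
  qed
  then show ?thesis using r1 r2 by (intro that[of "Min A" r2]) (auto simp: x_def abs_le_iff)
qed

text \<open>The rule reads only the coordinates of its block, so the observed sequence may be
  replaced by its restriction.\<close>

lemma geb_t_cong:
  assumes "\<And>l. l \<in> B \<Longrightarrow> X l = X' l"
  shows "geb_t \<rho>0 b0 \<eta> B X x = geb_t \<rho>0 b0 \<eta> B X' x"
proof -
  have "geb_phi B X = geb_phi B X'"
    unfolding geb_phi_def by (intro ext arg_cong2[where f="(*)"] refl sum.cong) (simp_all add: assms)
  moreover have "geb_kappa B X = geb_kappa B X'"
    unfolding geb_kappa_def by (simp add: assms)
  ultimately show ?thesis by (simp add: geb_t_def)
qed

definition block_estimate ::
  "real \<Rightarrow> real \<Rightarrow> real \<Rightarrow> (nat \<Rightarrow> real) \<Rightarrow> bool \<Rightarrow> nat set \<Rightarrow> real \<Rightarrow> (nat \<Rightarrow> real) \<Rightarrow> nat \<Rightarrow> real" where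
  "block_estimate nstar \<rho>0 b0 \<eta> js B \<epsilon> y i =
     (if real (card B) \<ge> nstar then \<epsilon> * geb_t \<rho>0 b0 \<eta> B (\<lambda>l. y l / \<epsilon>) (y i / \<epsilon>)
      else if js then james_stein \<epsilon> B y i
      else y i)"

definition block_rate :: "nat set \<Rightarrow> real \<Rightarrow> (nat \<Rightarrow> real) \<Rightarrow> real \<Rightarrow> real" where
  "block_rate B \<epsilon> \<beta> p =
     real (card B) * rate (min p 2) (card B)
        ((\<Sum>i\<in>B. \<bar>\<beta> i\<bar> powr p) powr (1 / p) / (\<epsilon> * real (card B) powr (1 / p)))
      + 1 / (ln (real (card B)) + 1) powr (3 / 2)"

lemma rate_nonneg: "C \<ge> 0 \<Longrightarrow> rate p n C \<ge> 0"
  unfolding rate_def by (auto intro!: divide_nonneg_nonneg simp: le_max_iff_disj)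

text \<open>Comparison with an arbitrary rule h in place of the infimum over one block: the infimum
  over all rules is then taken after summation and never has to be exchanged with an infinite
  sum.\<close>

lemma large_block_risk:
  assumes \<epsilon>: "\<epsilon> > 0" and B: "B \<subseteq> index_set N" "finite B" "card B \<ge> 3" and p: "p > 0" and b0: "b0 > 0"
    and r: "r1 > 0" "r1 \<le> (1 + \<eta> (card B)) * \<rho>0" "(1 + \<eta> (card B)) * \<rho>0 \<le> r2"
    and h: "h \<in> borel_measurable borel"
  shows "seq_risk N \<epsilon> \<beta> (\<lambda>y i. \<epsilon> * geb_t \<rho>0 b0 \<eta> B (\<lambda>l. y l / \<epsilon>) (y i / \<epsilon>)) B \<le>
    seq_risk N \<epsilon> \<beta> (\<lambda>y i. h (y i)) B +
    ennreal (geb_test.Kblock r1 r2 b0 * \<epsilon>\<^sup>2) * ennreal (block_rate B \<epsilon> \<beta> p)"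
proof -
  define \<theta> where "\<theta> = (\<lambda>i. \<beta> i / \<epsilon>)"
  define m where "m = real (card B)"
  define r where "r = (1 + \<eta> (card B)) * \<rho>0"
  interpret geb_test B \<theta> "real (card B)" "sqrt (2 * ln (real (card B)))" r r1 r2
    "r * sqrt (2 * ln (real (card B))) / sqrt (real (card B))" b0 "b0 * ln (real (card B)) / sqrt (real (card B))"
    by unfold_locales (use assms in \<open>auto simp: r_def\<close>)
  have rho: "geb_rho \<rho>0 \<eta> (card B) = r * sqrt (2 * ln (real (card B))) / sqrt (real (card B))"
    by (simp add: geb_rho_def r_def real_sqrt_divide)
  define t where "t = (\<lambda>X i. geb_t \<rho>0 b0 \<eta> B X (X i))"
  have t: "t X i = (if geb_kappa B X > b0 * ln (real (card B)) / sqrt (real (card B)) then X i + psi X (X i)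
      else soft (sqrt (2 * ln (real (card B)))) (X i))" for X i
    by (simp add: t_def geb_t_def rho geb_b_def psi_def deriv_geb_phi geb_phi_eq soft_def)
  have loss: "(t X i - \<theta> i)\<^sup>2 = geb_loss i X" for X i
    by (simp add: t geb_loss_def eb_loss_def soft_loss_def algebra_simps)
  have meas: "(\<lambda>X. t X i) \<in> borel_measurable P" if i: "i \<in> B" for i
  proof -
    have [measurable]: "(\<lambda>X. X i) \<in> borel_measurable P" using i by (rule coord_measurable)
    have [measurable]: "(\<lambda>X. psi X (X i)) \<in> borel_measurable P" by (intro own_psi_measurable) measurable
    show ?thesis unfolding t by measurable
  qed
  have est: "\<epsilon> * geb_t \<rho>0 b0 \<eta> B (\<lambda>l. y l / \<epsilon>) (y i / \<epsilon>) = \<epsilon> * t (\<lambda>i\<in>B. y i / \<epsilon>) i" if "i \<in> B" for y i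
    using that geb_t_cong[of B "\<lambda>l. y l / \<epsilon>" "\<lambda>i\<in>B. y i / \<epsilon>"] by (simp add: t_def)
  define C where "C = (\<Sum>i\<in>B. \<bar>\<beta> i\<bar> powr p) powr (1 / p) / (\<epsilon> * real (card B) powr (1 / p))"
  have C: "C \<ge> 0" "C powr p = (\<Sum>k\<in>B. \<bar>\<theta> k\<bar> powr p) / real (card B)"
    unfolding C_def \<theta>_def by (rule normalized_norm_powr[OF fin ne p \<epsilon>])+
  have rate: "m * rate (min p 2) (card B) C + remainder = block_rate B \<epsilon> \<beta> p"
    by (simp add: m_def remainder_def block_rate_def C_def)
  have "seq_risk N \<epsilon> \<beta> (\<lambda>y i. \<epsilon> * geb_t \<rho>0 b0 \<eta> B (\<lambda>l. y l / \<epsilon>) (y i / \<epsilon>)) B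
      = ennreal (\<epsilon>\<^sup>2) * total_risk (\<lambda>i X. (t X i - \<theta> i)\<^sup>2)"
    by (rule scaled_block_risk[OF \<epsilon> B(1)]) (use est meas in \<open>auto simp: \<theta>_def\<close>)
  also have "\<dots> \<le> ennreal (\<epsilon>\<^sup>2) * (Rstar + ennreal (Kblock * block_rate B \<epsilon> \<beta> p))"
    unfolding loss rate[symmetric] m_def
    using p C by (intro mult_left_mono geb_block_risk power_mean_le fin ne) auto
  also have "\<dots> = ennreal (\<epsilon>\<^sup>2) * Rstar + ennreal (Kblock * \<epsilon>\<^sup>2 * block_rate B \<epsilon> \<beta> p)"
    using \<epsilon> by (simp add: distrib_left mult_ac flip: ennreal_mult')
  also have "ennreal (Kblock * \<epsilon>\<^sup>2 * block_rate B \<epsilon> \<beta> p) = ennreal (Kblock * \<epsilon>\<^sup>2) * ennreal (block_rate B \<epsilon> \<beta> p)"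
    using C by (intro ennreal_mult'') (auto simp: block_rate_def C_def[symmetric] intro!: add_nonneg_nonneg mult_nonneg_nonneg rate_nonneg)
  also have "ennreal (\<epsilon>\<^sup>2) * Rstar \<le> seq_risk N \<epsilon> \<beta> (\<lambda>y i. h (y i)) B"
    by (rule separable_block_risk[OF \<epsilon> B(1) _ h]) (simp add: \<theta>_def)
  finally show ?thesis by (auto intro: add_right_mono)
qed

text \<open>The risk is bounded because the block is small, and the remainder is at least its value
  at \<open>nstar\<close>. Hence the remainder alone pays for the block, also when
  \<open>rate\<close> vanishes.\<close>

lemma small_block_risk:
  assumes \<epsilon>: "\<epsilon> > 0" and B: "B \<subseteq> index_set N" "finite B" "B \<noteq> {}" "real (card B) \<le> nstar" and nstar: "nstar > 2"
  shows "seq_risk N \<epsilon> \<beta> (\<lambda>y i. (if js then james_stein \<epsilon> B y i else y i)) B \<le>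
    ennreal ((2 * nstar + 2 * nstar\<^sup>2 * 7 powr nstar) * (ln nstar + 1) powr (3 / 2) * \<epsilon>\<^sup>2) * ennreal (block_rate B \<epsilon> \<beta> p)"
proof -
  define \<theta> where "\<theta> = (\<lambda>i. \<beta> i / \<epsilon>)"
  interpret finite_block B \<theta> "real (card B)"
    by unfold_locales (use B in auto)
  define t where "t = (\<lambda>X i. if js then james_stein 1 B X i else X i)"
  have meas: "(\<lambda>X. t X i) \<in> borel_measurable P" if i: "i \<in> B" for i
  proof -
    have comp [measurable]: "(\<lambda>X. X k) \<in> borel_measurable P" if "k \<in> B" for k using that by (rule coord_measurable)
    show ?thesis unfolding t_def james_stein_def using i by measurable
  qed
  have est: "(if js then james_stein \<epsilon> B y i else y i) = \<epsilon> * t (\<lambda>i\<in>B. y i / \<epsilon>) i" if "i \<in> B" for y i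
  proof -
    have "(\<Sum>l\<in>B. ((\<lambda>i\<in>B. y i / \<epsilon>) l)\<^sup>2) = (\<Sum>l\<in>B. (y l)\<^sup>2) / \<epsilon>\<^sup>2"
      by (simp add: power_divide sum_divide_distrib)
    then show ?thesis using that \<epsilon> by (simp add: t_def james_stein_def)
  qed
  define K where "K = 2 * nstar + 2 * nstar\<^sup>2 * 7 powr nstar"
  have "total_risk (\<lambda>i X. (t X i - \<theta> i)\<^sup>2) \<le> ennreal (2 * real (card B) + 2 * (real (card B))\<^sup>2 * 7 ^ card B)"
  proof (cases js)
    case True then show ?thesis using james_stein_risk by (simp add: t_def)
  next
    case False
    then have "total_risk (\<lambda>i X. (t X i - \<theta> i)\<^sup>2) = ennreal (real (card B))"
      by (simp add: t_def sq_expectation ennreal_of_nat_eq_real_of_nat)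
    also have "\<dots> \<le> ennreal (2 * real (card B) + 2 * (real (card B))\<^sup>2 * 7 ^ card B)"
      by (intro ennreal_leI) simp
    finally show ?thesis .
  qed
  also have "\<dots> \<le> ennreal K"
  proof (intro ennreal_leI)
    have "(7::real) ^ card B = 7 powr real (card B)" by (simp add: powr_realpow)
    also have "\<dots> \<le> 7 powr nstar" using B by (intro powr_mono) auto
    finally show "2 * real (card B) + 2 * (real (card B))\<^sup>2 * 7 ^ card B \<le> K"
      unfolding K_def using B nstar by (intro add_mono mult_mono power_mono) auto
  qed
  finally have le: "total_risk (\<lambda>i X. (t X i - \<theta> i)\<^sup>2) \<le> ennreal K" .
  have K: "K \<ge> 0" using nstar by (simp add: K_def)
  define l where "l = (ln nstar + 1) powr (3 / 2)"
  have "ln nstar > 0" using nstar by (intro ln_gt_zero) simp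
  then have l: "l > 0" by (simp add: l_def)
  have rate: "1 / l \<le> block_rate B \<epsilon> \<beta> p" "block_rate B \<epsilon> \<beta> p \<ge> 0"
  proof -
    have "ln (real (card B)) \<ge> 0" using n_pos by (intro ln_ge_zero) simp
    then have pos: "(ln (real (card B)) + 1) powr (3 / 2) > 0" by simp
    have "(ln (real (card B)) + 1) powr (3 / 2) \<le> l"
      unfolding l_def using n_pos B by (intro powr_mono2) auto
    then have "1 / l \<le> 1 / (ln (real (card B)) + 1) powr (3 / 2)"
      using pos l by (intro divide_left_mono) auto
    also have "\<dots> \<le> block_rate B \<epsilon> \<beta> p"
      using \<epsilon> unfolding block_rate_def by (auto intro!: mult_nonneg_nonneg rate_nonneg)
    finally show "1 / l \<le> block_rate B \<epsilon> \<beta> p" .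
    moreover have "1 / l \<ge> 0" using l by simp
    ultimately show "block_rate B \<epsilon> \<beta> p \<ge> 0" by linarith
  qed
  have "seq_risk N \<epsilon> \<beta> (\<lambda>y i. (if js then james_stein \<epsilon> B y i else y i)) B
      = ennreal (\<epsilon>\<^sup>2) * total_risk (\<lambda>i X. (t X i - \<theta> i)\<^sup>2)"
    by (rule scaled_block_risk[OF \<epsilon> B(1)]) (use est meas in \<open>auto simp: \<theta>_def\<close>)
  also have "\<dots> \<le> ennreal (\<epsilon>\<^sup>2) * ennreal K" by (intro mult_left_mono le) simp
  also have "\<dots> = ennreal (\<epsilon>\<^sup>2 * K)" using K by (simp flip: ennreal_mult)
  also have "\<dots> \<le> ennreal (K * l * \<epsilon>\<^sup>2 * block_rate B \<epsilon> \<beta> p)"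
  proof (rule ennreal_leI)
    have "K * l * \<epsilon>\<^sup>2 * (1 / l) \<le> K * l * \<epsilon>\<^sup>2 * block_rate B \<epsilon> \<beta> p"
      using rate K l by (intro mult_left_mono) auto
    then show "\<epsilon>\<^sup>2 * K \<le> K * l * \<epsilon>\<^sup>2 * block_rate B \<epsilon> \<beta> p" using l by (simp add: mult.commute)
  qed
  also have "\<dots> = ennreal (K * l * \<epsilon>\<^sup>2) * ennreal (block_rate B \<epsilon> \<beta> p)"
    using rate by (intro ennreal_mult'')
  finally show ?thesis by (simp add: K_def l_def)
qed

lemma risk_block_sum:
  assumes bp: "block_partition N J k"
  shows "risk N \<epsilon> est \<beta> = (\<Sum>\<^sub>\<infinity>j\<in>blocks J. \<Sum>i\<in>block k j. \<integral>\<^sup>+y. ennreal ((est y i - \<beta> i)\<^sup>2) \<partial>gauss_seq N \<epsilon> \<beta>)"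
proof -
  have "index_set N = (\<Union>j\<in>blocks J. block k j)" using bp by (simp add: block_partition_def)
  moreover have "block k i \<inter> block k j = {}" if "i \<in> blocks J" "j \<in> blocks J" "i \<noteq> j" for i j
    using block_index_eq[OF bp that(1)] block_index_eq[OF bp that(2)] that(3) by blast
  ultimately show ?thesis
    unfolding risk_def by (simp add: infsum_ennreal_UN block_def)
qed

theorem theorem3p1:
  fixes nstar \<rho>0 b0 :: real and \<eta> :: "nat \<Rightarrow> real"
  assumes "nstar > 2" and "\<rho>0 > 0" and "b0 > 0" and "\<eta> \<longlonglongrightarrow> 0"
    and "\<And>n. real n \<ge> nstar \<Longrightarrow> geb_rho \<rho>0 \<eta> n > 0"
  shows "\<exists>M::real. \<forall>(N::enat) (J::enat) (k::nat \<Rightarrow> nat) (js::nat \<Rightarrow> bool)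
           (\<epsilon>::real) (\<beta>::nat \<Rightarrow> real) (p::real).
           block_partition N J k \<longrightarrow> \<epsilon> > 0 \<longrightarrow> p > 0 \<longrightarrow>
           risk N \<epsilon> (block_geb nstar \<rho>0 b0 \<eta> js k \<epsilon>) \<beta>
             \<le> ideal_risk N k \<epsilon> \<beta> +
                ennreal (M * \<epsilon>\<^sup>2) *
                (\<Sum>\<^sub>\<infinity>j\<in>blocks J. ennreal
                   (real (card (block k j)) *
                      rate (min p 2) (card (block k j))
                        ((\<Sum>i\<in>block k j. \<bar>\<beta> i\<bar> powr p) powr (1 / p) /
                           (\<epsilon> * real (card (block k j)) powr (1 / p)))
                    + 1 / (ln (real (card (block k j))) + 1) powr (3 / 2)))"
proof -
  obtain r1 r2 where r: "r1 > 0" "\<And>n. real n \<ge> nstar \<Longrightarrow> r1 \<le> (1 + \<eta> n) * \<rho>0 \<and> (1 + \<eta> n) * \<rho>0 \<le> r2"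
    using scale_bounds[OF assms(1,2,4,5)] by blast
  define M1 where "M1 = geb_test.Kblock r1 r2 b0"
  define M2 where "M2 = (2 * nstar + 2 * nstar\<^sup>2 * 7 powr nstar) * (ln nstar + 1) powr (3 / 2)"
  define M where "M = max M1 M2"
  show ?thesis
  proof (intro exI[of _ M] allI impI)
    fix N J :: enat and k :: "nat \<Rightarrow> nat" and js :: "nat \<Rightarrow> bool" and \<epsilon> :: real and \<beta> :: "nat \<Rightarrow> real" and p :: real
    assume bp: "block_partition N J k" and \<epsilon>: "\<epsilon> > 0" and p: "p > 0"
    define est where "est = block_geb nstar \<rho>0 b0 \<eta> js k \<epsilon>"
    define R where "R = (\<Sum>\<^sub>\<infinity>j\<in>blocks J. ennreal (block_rate (block k j) \<epsilon> \<beta> p))"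
    have main: "risk N \<epsilon> est \<beta> \<le> risk N \<epsilon> (separable_estimator k h) \<beta> + ennreal (M * \<epsilon>\<^sup>2) * R"
      if h: "\<forall>j. h j \<in> borel_measurable borel" for h
    proof -
      have each: "seq_risk N \<epsilon> \<beta> est (block k j) \<le>
          seq_risk N \<epsilon> \<beta> (separable_estimator k h) (block k j)
          + ennreal (M * \<epsilon>\<^sup>2) * ennreal (block_rate (block k j) \<epsilon> \<beta> p)"
        if j: "j \<in> blocks J" for j
      proof -
        define B where "B = block k j"
        have B: "finite B" "B \<noteq> {}" "B \<subseteq> index_set N"
          using bp j by (auto simp: B_def block_def block_partition_def)
        have idx: "block_index k i = j" if "i \<in> B" for i
          using block_index_eq[OF bp j] that by (simp add: B_def)
        have sep: "seq_risk N \<epsilon> \<beta> (separable_estimator k h) B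
            = seq_risk N \<epsilon> \<beta> (\<lambda>y i. h j (y i)) B"
          by (intro sum.cong refl) (simp add: separable_estimator_def idx)
        have Mle: "x \<le> y + ennreal (M * \<epsilon>\<^sup>2) * z" if "x \<le> y + ennreal (c * \<epsilon>\<^sup>2) * z" "c \<le> M" for x y z c
        proof -
          have "ennreal (c * \<epsilon>\<^sup>2) * z \<le> ennreal (M * \<epsilon>\<^sup>2) * z"
            using that(2) by (intro mult_right_mono ennreal_leI) auto
          then show ?thesis using that(1) by (meson add_left_mono order_trans)
        qed
        show ?thesis
        proof (cases "real (card B) \<ge> nstar")
          case True
          have e: "seq_risk N \<epsilon> \<beta> est B =
              seq_risk N \<epsilon> \<beta> (\<lambda>y i. \<epsilon> * geb_t \<rho>0 b0 \<eta> B (\<lambda>l. y l / \<epsilon>) (y i / \<epsilon>)) B"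
            using True by (intro sum.cong refl) (simp add: est_def block_geb_def idx Let_def B_def[symmetric])
          \<comment> \<open>Here \<open>nstar > 2\<close> enters: blocks treated by the empirical
            Bayes rule have at least 3 coordinates, so that \<open>ln n \<ge> 1\<close>.\<close>
          have c3: "card B \<ge> 3" using True assms(1) by linarith
          show ?thesis
            unfolding B_def[symmetric] sep e
            by (rule Mle[OF large_block_risk[OF \<epsilon> B(3,1) c3 p assms(3) r(1)]])
               (use r(2)[OF True] h in \<open>auto simp: M_def M1_def\<close>)
        next
          case False
          have est_eq: "est y i = (if js j then james_stein \<epsilon> B y i else y i)" if "i \<in> B" for y i
            using False idx[OF that] unfolding est_def block_geb_def Let_def by (auto simp: B_def)
          have e: "seq_risk N \<epsilon> \<beta> est B =
              seq_risk N \<epsilon> \<beta> (\<lambda>y i. (if js j then james_stein \<epsilon> B y i else y i)) B"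
            by (intro sum.cong refl) (simp add: est_eq)
          have "seq_risk N \<epsilon> \<beta> est B \<le> ennreal (M2 * \<epsilon>\<^sup>2) * ennreal (block_rate B \<epsilon> \<beta> p)"
            unfolding e M2_def by (rule small_block_risk[OF \<epsilon> B(3,1,2) _ assms(1)]) (use False in simp)
          then have "seq_risk N \<epsilon> \<beta> est B \<le>
              seq_risk N \<epsilon> \<beta> (separable_estimator k h) B
              + ennreal (M2 * \<epsilon>\<^sup>2) * ennreal (block_rate B \<epsilon> \<beta> p)"
            by (rule order_trans) simp
          then show ?thesis unfolding B_def[symmetric] by (rule Mle) (simp add: M_def)
        qed
      qed
      have "risk N \<epsilon> est \<beta> \<le> (\<Sum>\<^sub>\<infinity>j\<in>blocks J.
          seq_risk N \<epsilon> \<beta> (separable_estimator k h) (block k j)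
          + ennreal (M * \<epsilon>\<^sup>2) * ennreal (block_rate (block k j) \<epsilon> \<beta> p))"
        unfolding risk_block_sum[OF bp] by (intro infsum_mono each nonneg_summable_on_complete) auto
      also have "\<dots> = risk N \<epsilon> (separable_estimator k h) \<beta> + ennreal (M * \<epsilon>\<^sup>2) * R"
        unfolding risk_block_sum[OF bp] R_def infsum_ennreal_cmult[symmetric] by (intro infsum_add nonneg_summable_on_complete) auto
      finally show ?thesis .
    qed
    define K where "K = ennreal (M * \<epsilon>\<^sup>2) * R"
    have "risk N \<epsilon> est \<beta> \<le> ideal_risk N k \<epsilon> \<beta> + K"
    \<comment> \<open>A finite \<open>K\<close> can be moved to the left, so that the infimum over h
      applies to the right side alone; for infinite \<open>K\<close> the claim is trivial.\<close>
    proof (cases "K = top")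
      case False
      have "risk N \<epsilon> est \<beta> - K \<le> ideal_risk N k \<epsilon> \<beta>"
        unfolding ideal_risk_def
      proof (rule INF_greatest)
        fix h :: "nat \<Rightarrow> real \<Rightarrow> real" assume "h \<in> {h. \<forall>j. h j \<in> borel_measurable borel}"
        then have "risk N \<epsilon> est \<beta> \<le> risk N \<epsilon> (separable_estimator k h) \<beta> + K" unfolding K_def by (intro main) simp
        then show "risk N \<epsilon> est \<beta> - K \<le> risk N \<epsilon> (separable_estimator k h) \<beta>"
          using False by (simp add: ennreal_minus_le_iff add.commute)
      qed
      then show ?thesis by (simp add: ennreal_minus_le_iff add.commute)
    qed simp
    then show "risk N \<epsilon> (block_geb nstar \<rho>0 b0 \<eta> js k \<epsilon>) \<beta>
             \<le> ideal_risk N k \<epsilon> \<beta> +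
                ennreal (M * \<epsilon>\<^sup>2) *
                (\<Sum>\<^sub>\<infinity>j\<in>blocks J. ennreal
                   (real (card (block k j)) *
                      rate (min p 2) (card (block k j))
                        ((\<Sum>i\<in>block k j. \<bar>\<beta> i\<bar> powr p) powr (1 / p) /
                           (\<epsilon> * real (card (block k j)) powr (1 / p)))
                    + 1 / (ln (real (card (block k j))) + 1) powr (3 / 2)))"
      by (simp add: est_def K_def R_def block_rate_def)
  qed
qed

end
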